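(* For every measurable subset $\omega$ of $\Omega$, $$ 2\, C_\infty^{(W)}(\chi_\omega) = C_\infty^{(S)}(\chi_\omega) = \inf \left\{\frac{\int_\omega \sum_{\lambda\in U}\left|\sum_{k\in I(\lambda)}c_k\phi_k(x)\right|^2\, dV_g}{\sum_{k=1}^{+\infty}|c_k|^2}\ \Big\vert\ (c_j)_{j\in \mathbb{N}^*}\in\ell^2(\mathbb{C})\setminus\{0\} \right\}, $$ where $U$ is the set of all distinct values among the $\lambda_k$, $k\in\mathbb{N}^*$, and $I(\lambda)=\{j\in \mathbb{N}^*\ \vert\ \lambda_j=\lambda\}$ for $\lambda\in U$.
   Context: Setting. $(M,g)$ is a smooth $n$-dimensional Riemannian manifold ($n\ge 1$), $\Omega$ is a bounded connected open subset of $M$ (the case $\partial\Omega=\emptyset$ is allowed; then $\Omega$ is a compact connected Riemannian manifold), and $V_g$ is the Riemannian volume measure; measurability is with respect to $V_g$. If $\partial\Omega\ne\emptyset$, one of the following boundary conditions $By=0$ on $\partial\Omega$ is fixed: Dirichlet ($By=y_{|\partial\Omega}$); Neumann ($By=\frac{\partial y}{\partial n}_{|\partial\Omega}$); mixed Dirichlet-Neumann ($By=\chi_{\Gamma_0}y_{|\partial\Omega}+\chi_{\Gamma_1}\frac{\partial y}{\partial n}_{|\partial\Omega}$ with $\partial\Omega=\Gamma_0\cup\Gamma_1$, $\Gamma_0\cap\Gamma_1=\emptyset$); Robin ($By=\frac{\partial y}{\partial n}_{|\partial\Omega}+\beta y_{|\partial\Omega}$, with $\beta\ge0$ bounded measurable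 on $\partial\Omega$, $\int_{\partial\Omega}\beta>0$). $X=\{y\in L^2(\Omega,\mathbb{C}) : \int_\Omega y\,dV_g=0\}$ in the Neumann and boundaryless cases, and $X=L^2(\Omega,\mathbb{C})$ otherwise. $A=-\triangle_g$ with domain $D(A)=\{y\in X : Ay\in X,\ By=0\}$ is a positive selfadjoint operator; $\|y\|_{D(A)}=\|Ay\|_{L^2}$ and $\|y\|_{D(A^{1/2})}=\|A^{1/2}y\|_{L^2}$. $(\phi_j)_{j\in\mathbb{N}^*}$ is a fixed orthonormal Hilbertian basis of $X$ of real-valued eigenfunctions of $A$, with $A\phi_j=\lambda_j^2\phi_j$, $\lambda_j>0$. $\chi_\omega$ is the characteristic function of $\omega$. Time asymptotic observability constants. For $(y^0,y^1)\in D(A^{1/2})\times X$, let $y$ be the solution of the wave equation $\partial_{tt}y=\triangle_g y$ (with $By=0$) such that $y(0)=y^0$, $\partial_ty(0)=y^1$. Then $$C_\infty^{(W)}(\chi_\omega)=\inf\left\{ \lim_{T\to+\infty} \frac{1}{T} \frac{ \int_0^T\int_\omega \vert \partial_{t} y(t,x) \vert ^2\, dV_g \, dt }{\Vert (y^0,y^1)\Vert^2_{D(A^{1/2})\times X}} \ \Big\vert\ (y^0,y^1)\in D(A^{1/2})\times X \setminus\{(0,0)\} \right\}.$$ For $y^0\in D(A)$, let $y$ be the solution of the Schr\"odinger equation $i\partial_ty=\triangle_gy$ (with $By=0$) such that $y(0)=y^0$. Then $$C_\infty^{(S)}(\chi_\omega)=\inf\left\{ \lim_{T\to+\infty} \frac{1}{T}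 \frac{ \int_0^T\int_\omega \vert \partial_{t}y(t,x) \vert ^2\, dV_g \, dt }{\Vert y^0\Vert^2_{D(A)}} \ \Big\vert\ y^0\in D(A) \setminus\{0\} \right\}.$$ *)

theory Defs
  imports "HOL-Analysis.Analysis"
begin

section \<open>Smooth functions on open subsets of Euclidean space\<close>

primrec Ck_on ::
  "nat \<Rightarrow> ('a::euclidean_space \<Rightarrow> 'b::real_normed_vector) \<Rightarrow> 'a set \<Rightarrow> bool" where
  "Ck_on 0 f S \<longleftrightarrow> continuous_on S f"
| "Ck_on (Suc k) f S \<longleftrightarrow>
     (\<forall>x\<in>S. f differentiable (at x)) \<and>
     (\<forall>v. Ck_on k (\<lambda>x. frechet_derivative f (at x) v) S)"

definition smooth_on :: "('a::euclidean_space \<Rightarrow> 'b::real_normed_vector) \<Rightarrow> 'a set \<Rightarrow> bool" where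
  "smooth_on f S \<longleftrightarrow> (\<forall>k. Ck_on k f S)"

definition partial :: "'n::finite \<Rightarrow> (real^'n \<Rightarrow> real) \<Rightarrow> real^'n \<Rightarrow> real" where
  "partial i f z = frechet_derivative f (at z) (axis i 1)"

section \<open>Riemannian manifolds\<close>

text \<open>The manifold is the whole type \<open>'m\<close>, its dimension is the cardinality of \<open>'n\<close>. A chart is
  a pair of its domain and its coordinate map (whose values outside the domain are irrelevant).
  The atlas need not be maximal. The metric is given by its Gram matrices
  in the coordinates of each chart.\<close>

type_synonym ('m,'n) chart = "'m set \<times> ('m \<Rightarrow> real^'n)"

record ('m,'n::finite) riem =
  charts :: "('m,'n) chart set"
  gram :: "('m,'n) chart \<Rightarrow> real^'n \<Rightarrow> real^'n^'n"

definition chart_image :: "('m,'n::finite) chart \<Rightarrow> (real^'n) set" where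
  "chart_image C = snd C ` fst C"

definition chart_inv :: "('m,'n::finite) chart \<Rightarrow> real^'n \<Rightarrow> 'm" where
  "chart_inv C = inv_into (fst C) (snd C)"

definition transition_matrix ::
  "('m,'n::finite) chart \<Rightarrow> ('m,'n) chart \<Rightarrow> 'm \<Rightarrow> real^'n^'n" where
  "transition_matrix C D x = jacobian (snd D \<circ> chart_inv C) (at (snd C x))"

definition riemannian_manifold ::
  "('m::{t2_space,second_countable_topology},'n::finite) riem \<Rightarrow> bool" where
  "riemannian_manifold M \<longleftrightarrow>
     (\<Union>C\<in>charts M. fst C) = UNIV \<and>
     (\<forall>C\<in>charts M. open (fst C) \<and> open (chart_image C) \<and>
        homeomorphism (fst C) (chart_image C) (snd C) (chart_inv C)) \<and>
     (\<forall>C\<in>charts M. \<forall>D\<in>charts M.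
        smooth_on (snd D \<circ> chart_inv C) (snd C ` (fst C \<inter> fst D))) \<and>
     (\<forall>C\<in>charts M. smooth_on (gram M C) (chart_image C) \<and>
        (\<forall>z\<in>chart_image C. transpose (gram M C z) = gram M C z \<and>
           (\<forall>v. v \<noteq> 0 \<longrightarrow> v \<bullet> (gram M C z *v v) > 0))) \<and>
     (\<forall>C\<in>charts M. \<forall>D\<in>charts M. \<forall>x\<in>fst C \<inter> fst D.
        gram M C (snd C x) =
          transpose (transition_matrix C D x) ** gram M D (snd D x) ** transition_matrix C D x)"

text \<open>An arbitrary chart around \<open>x\<close>; it is only used in expressions whose value at \<open>x\<close> is the same
  in all charts around \<open>x\<close>.\<close>

definition chart_at :: "('m,'n::finite) riem \<Rightarrow> 'm \<Rightarrow> ('m,'n) chart" where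
  "chart_at M x = (SOME C. C \<in> charts M \<and> x \<in> fst C)"

definition riem_volume ::
  "('m::{t2_space,second_countable_topology},'n::finite) riem \<Rightarrow> 'm measure" where
  "riem_volume M = completion (THE V. sets V = sets borel \<and>
     (\<forall>C\<in>charts M. \<forall>E\<in>sets borel. E \<subseteq> fst C \<longrightarrow>
        emeasure V E = (\<integral>\<^sup>+z\<in>snd C ` E. ennreal (sqrt (det (gram M C z))) \<partial>lborel)))"

subsection \<open>Distance and hypersurface measure\<close>

definition pw_C1_curve ::
  "('m::{t2_space,second_countable_topology},'n::finite) riem \<Rightarrow> (real \<Rightarrow> 'm) \<Rightarrow> bool" where
  "pw_C1_curve M p \<longleftrightarrow> continuous_on {0..1} p \<and>
     (\<forall>C\<in>charts M. \<forall>a b. 0 \<le> a \<and> a \<le> b \<and> b \<le> 1 \<and> p ` {a..b} \<subseteq> fst C \<longrightarrow>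
        (snd C \<circ> p) piecewise_C1_differentiable_on {a..b})"

definition speed :: "('m,'n::finite) riem \<Rightarrow> (real \<Rightarrow> 'm) \<Rightarrow> real \<Rightarrow> real" where
  "speed M p t =
     (let C = chart_at M (p t); v = vector_derivative (snd C \<circ> p) (at t)
      in sqrt (v \<bullet> (gram M C (snd C (p t)) *v v)))"

definition riem_dist ::
  "('m::{t2_space,second_countable_topology},'n::finite) riem \<Rightarrow> 'm \<Rightarrow> 'm \<Rightarrow> ennreal" where
  "riem_dist M x y = (INF p\<in>{p. pw_C1_curve M p \<and> p 0 = x \<and> p 1 = y}.
     \<integral>\<^sup>+t\<in>{0..1}. ennreal (speed M p t) \<partial>lborel)"

definition riem_bounded ::
  "('m::{t2_space,second_countable_topology},'n::finite) riem \<Rightarrow> 'm set \<Rightarrow> bool" where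
  "riem_bounded M S \<longleftrightarrow> (\<exists>R::real. \<forall>x\<in>S. \<forall>y\<in>S. riem_dist M x y \<le> ennreal R)"

definition riem_diam ::
  "('m::{t2_space,second_countable_topology},'n::finite) riem \<Rightarrow> 'm set \<Rightarrow> ennreal" where
  "riem_diam M E = (SUP x\<in>E. SUP y\<in>E. riem_dist M x y)"

text \<open>Hausdorff measure of integer dimension \<open>d\<close>, normalised by the volume of the unit ball, so that
  for \<open>d = n - 1\<close> it is the Riemannian measure on hypersurfaces (the counting measure if
  \<open>n = 1\<close>).\<close>

definition hausdorff_outer ::
  "('m::{t2_space,second_countable_topology},'n::finite) riem \<Rightarrow> nat \<Rightarrow> 'm set \<Rightarrow> ennreal" where
  "hausdorff_outer M d E =
     (SUP \<delta>\<in>{0<..}. INF B\<in>{B :: nat \<Rightarrow> 'm set. E \<subseteq> (\<Union>i. B i) \<and> (\<forall>i. riem_diam M (B i) \<le> \<delta>)}.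
        (\<Sum>i. if B i = {} then 0
             else ennreal (unit_ball_vol (real d)) * (riem_diam M (B i) / 2) ^ d))"

definition boundary_measure ::
  "('m::{t2_space,second_countable_topology},'n::finite) riem \<Rightarrow> 'm set \<Rightarrow> 'm measure" where
  "boundary_measure M \<Omega> = restrict_space
     (completion (measure_of UNIV (sets borel) (hausdorff_outer M (CARD('n) - 1)))) (frontier \<Omega>)"

definition domain_measure ::
  "('m::{t2_space,second_countable_topology},'n::finite) riem \<Rightarrow> 'm set \<Rightarrow> 'm measure" where
  "domain_measure M \<Omega> = restrict_space (riem_volume M) \<Omega>"

section \<open>Square integrable functions and unbounded operators\<close>

text \<open>Elements of \<open>L\<^sup>2\<close> are represented by functions; the subspaces and operators considered below
  are invariant under modification on null sets.\<close>

definition L2 :: "'a measure \<Rightarrow> ('a \<Rightarrow> complex) set" where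
  "L2 N = {u \<in> borel_measurable N. integrable N (\<lambda>x. (cmod (u x))\<^sup>2)}"

definition ip :: "'a measure \<Rightarrow> ('a \<Rightarrow> complex) \<Rightarrow> ('a \<Rightarrow> complex) \<Rightarrow> complex" where
  "ip N u v = (LINT x|N. u x * cnj (v x))"

definition l2norm :: "'a measure \<Rightarrow> ('a \<Rightarrow> complex) \<Rightarrow> real" where
  "l2norm N u = sqrt (LINT x|N. (cmod (u x))\<^sup>2)"

definition hilbert_subspace :: "'a measure \<Rightarrow> ('a \<Rightarrow> complex) set \<Rightarrow> bool" where
  "hilbert_subspace N X \<longleftrightarrow> X \<subseteq> L2 N \<and> (\<lambda>x. 0) \<in> X \<and>
     (\<forall>u\<in>X. \<forall>v\<in>X. (\<lambda>x. u x + v x) \<in> X) \<and>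
     (\<forall>a. \<forall>u\<in>X. (\<lambda>x. a * u x) \<in> X) \<and>
     (\<forall>u\<in>L2 N. (\<forall>e>0. \<exists>w\<in>X. l2norm N (\<lambda>x. u x - w x) < e) \<longrightarrow> u \<in> X)"

text \<open>Operators are identified with their graphs.\<close>

type_synonym 'a operator = "(('a \<Rightarrow> complex) \<times> ('a \<Rightarrow> complex)) set"

definition adjoint_op :: "'a measure \<Rightarrow> ('a \<Rightarrow> complex) set \<Rightarrow> 'a operator \<Rightarrow> 'a operator" where
  "adjoint_op N X S = {(u,v). u \<in> X \<and> v \<in> X \<and> (\<forall>(f,h)\<in>S. ip N h u = ip N f v)}"

definition selfadjoint_op :: "'a measure \<Rightarrow> ('a \<Rightarrow> complex) set \<Rightarrow> 'a operator \<Rightarrow> bool" where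
  "selfadjoint_op N X S \<longleftrightarrow> hilbert_subspace N X \<and>
     (\<forall>u\<in>X. \<forall>e>0. \<exists>(f,h)\<in>S. l2norm N (\<lambda>x. u x - f x) < e) \<and>
     S = adjoint_op N X S"

definition positive_selfadjoint_op ::
  "'a measure \<Rightarrow> ('a \<Rightarrow> complex) set \<Rightarrow> 'a operator \<Rightarrow> bool" where
  "positive_selfadjoint_op N X S \<longleftrightarrow>
     selfadjoint_op N X S \<and> (\<forall>(u,v)\<in>S. 0 \<le> Re (ip N v u))"

definition sqrt_op :: "'a measure \<Rightarrow> ('a \<Rightarrow> complex) set \<Rightarrow> 'a operator \<Rightarrow> 'a operator" where
  "sqrt_op N X A = (THE S. positive_selfadjoint_op N X S \<and> S O S = A)"

section \<open>First order Sobolev space\<close>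

text \<open>Covector fields on \<open>\<Omega>\<close> are given by their components in each chart, subject to the
  transformation law.\<close>

type_synonym ('m,'n) covector_field = "('m,'n) chart \<Rightarrow> 'm \<Rightarrow> complex^'n"

definition covector_field ::
  "('m::{t2_space,second_countable_topology},'n::finite) riem \<Rightarrow> 'm set
     \<Rightarrow> ('m,'n) covector_field \<Rightarrow> bool" where
  "covector_field M \<Omega> w \<longleftrightarrow>
     (\<forall>C\<in>charts M. \<forall>i. (\<lambda>x. w C x $ i)
        \<in> borel_measurable (restrict_space (riem_volume M) (\<Omega> \<inter> fst C))) \<and>
     (\<forall>C\<in>charts M. \<forall>D\<in>charts M. \<forall>x\<in>\<Omega> \<inter> fst C \<inter> fst D. \<forall>i.
        w C x $ i = (\<Sum>k\<in>UNIV. of_real (transition_matrix C D x $ k $ i) * w D x $ k))"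

definition cometric ::
  "('m,'n::finite) riem \<Rightarrow> 'm \<Rightarrow> ('m,'n) covector_field \<Rightarrow> ('m,'n) covector_field \<Rightarrow> complex" where
  "cometric M x a b =
     (let C = chart_at M x; H = matrix_inv (gram M C (snd C x))
      in \<Sum>i\<in>UNIV. \<Sum>j\<in>UNIV. of_real (H $ i $ j) * a C x $ i * cnj (b C x $ j))"

definition weak_differential ::
  "('m::{t2_space,second_countable_topology},'n::finite) riem \<Rightarrow> 'm set
     \<Rightarrow> ('m \<Rightarrow> complex) \<Rightarrow> ('m,'n) covector_field \<Rightarrow> bool" where
  "weak_differential M \<Omega> u w \<longleftrightarrow> covector_field M \<Omega> w \<and>
     integrable (domain_measure M \<Omega>) (\<lambda>x. Re (cometric M x w w)) \<and>
     (\<forall>C\<in>charts M. \<forall>i. \<forall>\<psi> :: real^'n \<Rightarrow> real.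
        smooth_on \<psi> UNIV \<and> (\<exists>K. compact K \<and> K \<subseteq> snd C ` (fst C \<inter> \<Omega>) \<and> (\<forall>z. z \<notin> K \<longrightarrow> \<psi> z = 0)) \<longrightarrow>
        (LINT z|lebesgue. u (chart_inv C z) * of_real (partial i \<psi> z)) =
        - (LINT z|lebesgue. w C (chart_inv C z) $ i * of_real (\<psi> z)))"

definition H1 ::
  "('m::{t2_space,second_countable_topology},'n::finite) riem \<Rightarrow> 'm set \<Rightarrow> ('m \<Rightarrow> complex) set" where
  "H1 M \<Omega> = {u \<in> L2 (domain_measure M \<Omega>). \<exists>w. weak_differential M \<Omega> u w}"

text \<open>The integral over \<open>\<Omega>\<close> of the scalar product of the gradients; weak differentials are unique
  up to null sets.\<close>

definition grad_ip ::
  "('m::{t2_space,second_countable_topology},'n::finite) riem \<Rightarrow> 'm set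
     \<Rightarrow> ('m \<Rightarrow> complex) \<Rightarrow> ('m \<Rightarrow> complex) \<Rightarrow> complex" where
  "grad_ip M \<Omega> u v =
     (let du = (SOME w. weak_differential M \<Omega> u w); dv = (SOME w. weak_differential M \<Omega> v w)
      in LINT x|domain_measure M \<Omega>. cometric M x du dv)"

definition h1norm ::
  "('m::{t2_space,second_countable_topology},'n::finite) riem \<Rightarrow> 'm set
     \<Rightarrow> ('m \<Rightarrow> complex) \<Rightarrow> real" where
  "h1norm M \<Omega> u = sqrt ((l2norm (domain_measure M \<Omega>) u)\<^sup>2 + Re (grad_ip M \<Omega> u u))"

section \<open>The Laplacian with boundary conditions\<close>

definition test_function ::
  "('m::{t2_space,second_countable_topology},'n::finite) riem \<Rightarrow> 'm set \<Rightarrow> ('m \<Rightarrow> real) \<Rightarrow> bool" where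
  "test_function M \<Omega> \<psi> \<longleftrightarrow>
     (\<forall>C\<in>charts M. smooth_on (\<psi> \<circ> chart_inv C) (chart_image C)) \<and>
     (\<exists>K. compact K \<and> K \<subseteq> \<Omega> \<and> (\<forall>x. x \<notin> K \<longrightarrow> \<psi> x = 0))"

definition laplace_beltrami :: "('m,'n::finite) riem \<Rightarrow> ('m \<Rightarrow> real) \<Rightarrow> 'm \<Rightarrow> real" where
  "laplace_beltrami M \<psi> x =
     (let C = chart_at M x; G = gram M C; f = \<psi> \<circ> chart_inv C; z0 = snd C x
      in (\<Sum>i\<in>UNIV. partial i
            (\<lambda>z. sqrt (det (G z)) * (\<Sum>j\<in>UNIV. matrix_inv (G z) $ i $ j * partial j f z)) z0)
         / sqrt (det (G z0)))"

text \<open>The Laplacian of \<open>y\<close> in the sense of distributions is \<open>f\<close>.\<close>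

definition has_laplacian ::
  "('m::{t2_space,second_countable_topology},'n::finite) riem \<Rightarrow> 'm set
     \<Rightarrow> ('m \<Rightarrow> complex) \<Rightarrow> ('m \<Rightarrow> complex) \<Rightarrow> bool" where
  "has_laplacian M \<Omega> y f \<longleftrightarrow>
     y \<in> L2 (domain_measure M \<Omega>) \<and> f \<in> L2 (domain_measure M \<Omega>) \<and>
     (\<forall>\<psi>. test_function M \<Omega> \<psi> \<longrightarrow>
        (LINT x|domain_measure M \<Omega>. y x * of_real (laplace_beltrami M \<psi> x)) =
        (LINT x|domain_measure M \<Omega>. f x * of_real (\<psi> x)))"

text \<open>Traces are taken in the \<open>H\<^sup>1\<close> sense, by approximation with functions that are continuous
  up to the boundary.\<close>

definition zero_trace_on ::
  "('m::{t2_space,second_countable_topology},'n::finite) riem \<Rightarrow> 'm set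
     \<Rightarrow> 'm set \<Rightarrow> ('m \<Rightarrow> complex) \<Rightarrow> bool" where
  "zero_trace_on M \<Omega> \<Gamma> u \<longleftrightarrow> u \<in> H1 M \<Omega> \<and>
     (\<exists>v :: nat \<Rightarrow> 'm \<Rightarrow> complex.
        (\<forall>k. v k \<in> H1 M \<Omega> \<and> continuous_on (closure \<Omega>) (v k) \<and> (\<forall>x\<in>\<Gamma>. v k x = 0)) \<and>
        (\<lambda>k. h1norm M \<Omega> (\<lambda>x. v k x - u x)) \<longlonglongrightarrow> 0)"

definition has_trace ::
  "('m::{t2_space,second_countable_topology},'n::finite) riem \<Rightarrow> 'm set
     \<Rightarrow> ('m \<Rightarrow> complex) \<Rightarrow> ('m \<Rightarrow> complex) \<Rightarrow> bool" where
  "has_trace M \<Omega> u \<rho> \<longleftrightarrow> u \<in> H1 M \<Omega> \<and> \<rho> \<in> L2 (boundary_measure M \<Omega>) \<and>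
     (\<exists>v :: nat \<Rightarrow> 'm \<Rightarrow> complex.
        (\<forall>k. v k \<in> H1 M \<Omega> \<and> continuous_on (closure \<Omega>) (v k) \<and> v k \<in> L2 (boundary_measure M \<Omega>)) \<and>
        (\<lambda>k. h1norm M \<Omega> (\<lambda>x. v k x - u x)) \<longlonglongrightarrow> 0 \<and>
        (\<lambda>k. l2norm (boundary_measure M \<Omega>) (\<lambda>x. v k x - \<rho> x)) \<longlonglongrightarrow> 0)"

text \<open>For \<open>y\<close> with Laplacian \<open>f\<close> this is, by Green's formula, the boundary integral of the normal
  derivative of \<open>y\<close> against the conjugate of \<open>v\<close>. Normal derivatives are understood in this weak
  sense.\<close>

definition normal_flux ::
  "('m::{t2_space,second_countable_topology},'n::finite) riem \<Rightarrow> 'm set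
     \<Rightarrow> ('m \<Rightarrow> complex) \<Rightarrow> ('m \<Rightarrow> complex) \<Rightarrow> ('m \<Rightarrow> complex) \<Rightarrow> complex" where
  "normal_flux M \<Omega> y f v = ip (domain_measure M \<Omega>) f v + grad_ip M \<Omega> y v"

datatype 'm bc =
  No_Boundary | Dirichlet | Neumann | Mixed "'m set" "'m set" | Robin "'m \<Rightarrow> real"

fun admissible_bc ::
  "('m::{t2_space,second_countable_topology},'n::finite) riem \<Rightarrow> 'm set \<Rightarrow> 'm bc \<Rightarrow> bool" where
  "admissible_bc M \<Omega> No_Boundary \<longleftrightarrow> frontier \<Omega> = {}"
| "admissible_bc M \<Omega> Dirichlet \<longleftrightarrow> frontier \<Omega> \<noteq> {}"
| "admissible_bc M \<Omega> Neumann \<longleftrightarrow> frontier \<Omega> \<noteq> {}"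
| "admissible_bc M \<Omega> (Mixed \<Gamma>\<^sub>0 \<Gamma>\<^sub>1) \<longleftrightarrow>
     frontier \<Omega> \<noteq> {} \<and> \<Gamma>\<^sub>0 \<union> \<Gamma>\<^sub>1 = frontier \<Omega> \<and> \<Gamma>\<^sub>0 \<inter> \<Gamma>\<^sub>1 = {}"
| "admissible_bc M \<Omega> (Robin \<beta>) \<longleftrightarrow>
     frontier \<Omega> \<noteq> {} \<and> \<beta> \<in> borel_measurable (boundary_measure M \<Omega>) \<and>
     (\<forall>x\<in>frontier \<Omega>. 0 \<le> \<beta> x) \<and> (\<exists>K. \<forall>x\<in>frontier \<Omega>. \<beta> x \<le> K) \<and>
     (\<integral>\<^sup>+x. ennreal (\<beta> x) \<partial>boundary_measure M \<Omega>) > 0"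

text \<open>The boundary condition for \<open>y\<close> with Laplacian \<open>f\<close>. In the mixed case, the restriction of the
  normal derivative to \<open>\<Gamma>\<^sub>1\<close> is tested with functions vanishing on \<open>\<Gamma>\<^sub>0\<close>.\<close>

fun bc_holds ::
  "('m::{t2_space,second_countable_topology},'n::finite) riem \<Rightarrow> 'm set \<Rightarrow> 'm bc
     \<Rightarrow> ('m \<Rightarrow> complex) \<Rightarrow> ('m \<Rightarrow> complex) \<Rightarrow> bool" where
  "bc_holds M \<Omega> No_Boundary y f \<longleftrightarrow> True"
| "bc_holds M \<Omega> Dirichlet y f \<longleftrightarrow> zero_trace_on M \<Omega> (frontier \<Omega>) y"
| "bc_holds M \<Omega> Neumann y f \<longleftrightarrow> y \<in> H1 M \<Omega> \<and> (\<forall>v\<in>H1 M \<Omega>. normal_flux M \<Omega> y f v = 0)"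
| "bc_holds M \<Omega> (Mixed \<Gamma>\<^sub>0 \<Gamma>\<^sub>1) y f \<longleftrightarrow> zero_trace_on M \<Omega> \<Gamma>\<^sub>0 y \<and>
     (\<forall>v. zero_trace_on M \<Omega> \<Gamma>\<^sub>0 v \<longrightarrow> normal_flux M \<Omega> y f v = 0)"
| "bc_holds M \<Omega> (Robin \<beta>) y f \<longleftrightarrow> (\<exists>\<rho>. has_trace M \<Omega> y \<rho> \<and>
     (\<forall>v \<tau>. has_trace M \<Omega> v \<tau> \<longrightarrow>
        normal_flux M \<Omega> y f v + ip (boundary_measure M \<Omega>) (\<lambda>x. of_real (\<beta> x) * \<rho> x) \<tau> = 0))"

definition state_space ::
  "('m::{t2_space,second_countable_topology},'n::finite) riem \<Rightarrow> 'm set \<Rightarrow> 'm bc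
     \<Rightarrow> ('m \<Rightarrow> complex) set" where
  "state_space M \<Omega> bc =
     (if bc = Neumann \<or> bc = No_Boundary
      then {y \<in> L2 (domain_measure M \<Omega>).
              integrable (domain_measure M \<Omega>) y \<and> (LINT x|domain_measure M \<Omega>. y x) = 0}
      else L2 (domain_measure M \<Omega>))"

definition neg_laplacian ::
  "('m::{t2_space,second_countable_topology},'n::finite) riem \<Rightarrow> 'm set \<Rightarrow> 'm bc
     \<Rightarrow> 'm operator" where
  "neg_laplacian M \<Omega> bc = {(y,f). y \<in> state_space M \<Omega> bc \<and> f \<in> state_space M \<Omega> bc \<and>
     has_laplacian M \<Omega> y (\<lambda>x. - f x) \<and> bc_holds M \<Omega> bc y (\<lambda>x. - f x)}"

text \<open>Positive indices are shifted: \<open>\<phi> j\<close>, \<open>lam j\<close> with \<open>j \<ge> 0\<close> stand for the (j+1)-st eigenfunction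
  and the square root of its eigenvalue.\<close>

definition real_eigenbasis ::
  "'a measure \<Rightarrow> ('a \<Rightarrow> complex) set \<Rightarrow> 'a operator \<Rightarrow> (nat \<Rightarrow> 'a \<Rightarrow> real) \<Rightarrow> (nat \<Rightarrow> real) \<Rightarrow> bool" where
  "real_eigenbasis N X A \<phi> lam \<longleftrightarrow>
     (\<forall>j. 0 < lam j \<and> ((\<lambda>x. of_real (\<phi> j x)), (\<lambda>x. of_real ((lam j)\<^sup>2 * \<phi> j x))) \<in> A) \<and>
     (\<forall>i j. ip N (\<lambda>x. of_real (\<phi> i x)) (\<lambda>x. of_real (\<phi> j x)) = (if i = j then 1 else 0)) \<and>
     (\<forall>u\<in>X. \<forall>e>0. \<exists>m a. l2norm N (\<lambda>x. u x - (\<Sum>j<m. a j * of_real (\<phi> j x))) < e)"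

section \<open>Solutions and time asymptotic observability constants\<close>

text \<open>In the following, \<open>v t\<close> is the time derivative of \<open>y t\<close> in \<open>L\<^sup>2\<close>.\<close>

definition L2_continuous :: "'a measure \<Rightarrow> (real \<Rightarrow> 'a \<Rightarrow> complex) \<Rightarrow> bool" where
  "L2_continuous N y \<longleftrightarrow>
     (\<forall>t\<ge>0. ((\<lambda>s. l2norm N (\<lambda>x. y s x - y t x)) \<longlongrightarrow> 0) (at t within {0..}))"

definition C1_with_derivative ::
  "'a measure \<Rightarrow> ('a \<Rightarrow> complex) set \<Rightarrow> (real \<Rightarrow> 'a \<Rightarrow> complex) \<Rightarrow> (real \<Rightarrow> 'a \<Rightarrow> complex) \<Rightarrow> bool" where
  "C1_with_derivative N X y v \<longleftrightarrow> (\<forall>t\<ge>0. y t \<in> X \<and> v t \<in> X) \<and>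
     (\<forall>t\<ge>0. ((\<lambda>s. l2norm N (\<lambda>x. (y s x - y t x) / of_real (s - t) - v t x)) \<longlongrightarrow> 0)
        (at t within {0..})) \<and>
     L2_continuous N v"

text \<open>\<open>y\<close> belongs to \<open>C\<^sup>0([0,\<infinity>), D(A\<^sup>1\<^sup>/\<^sup>2)) \<inter> C\<^sup>1([0,\<infinity>), X)\<close>, and the equation holds in the dual space
  of \<open>D(A\<^sup>1\<^sup>/\<^sup>2)\<close>.\<close>

definition wave_solution ::
  "'a measure \<Rightarrow> ('a \<Rightarrow> complex) set \<Rightarrow> 'a operator \<Rightarrow> ('a \<Rightarrow> complex) \<Rightarrow> ('a \<Rightarrow> complex)
     \<Rightarrow> (real \<Rightarrow> 'a \<Rightarrow> complex) \<Rightarrow> (real \<Rightarrow> 'a \<Rightarrow> complex) \<Rightarrow> bool" where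
  "wave_solution N X A y0 y1 y v \<longleftrightarrow>
     C1_with_derivative N X y v \<and>
     (AE x in N. y 0 x = y0 x) \<and> (AE x in N. v 0 x = y1 x) \<and>
     (\<exists>r. (\<forall>t\<ge>0. (y t, r t) \<in> sqrt_op N X A) \<and> L2_continuous N r \<and>
        (\<forall>(w,s)\<in>sqrt_op N X A. \<forall>t\<ge>0.
           ((\<lambda>\<tau>. ip N (v \<tau>) w) has_vector_derivative - ip N (r t) s) (at t within {0..})))"

text \<open>\<open>y\<close> belongs to \<open>C\<^sup>0([0,\<infinity>), D(A)) \<inter> C\<^sup>1([0,\<infinity>), X)\<close>; recall that \<open>A\<close> is the negative
  Laplacian.\<close>

definition schroedinger_solution ::
  "'a measure \<Rightarrow> ('a \<Rightarrow> complex) set \<Rightarrow> 'a operator \<Rightarrow> ('a \<Rightarrow> complex)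
     \<Rightarrow> (real \<Rightarrow> 'a \<Rightarrow> complex) \<Rightarrow> (real \<Rightarrow> 'a \<Rightarrow> complex) \<Rightarrow> bool" where
  "schroedinger_solution N X A y0 y v \<longleftrightarrow>
     C1_with_derivative N X y v \<and>
     (AE x in N. y 0 x = y0 x) \<and>
     (\<exists>f. (\<forall>t\<ge>0. (y t, f t) \<in> A \<and> (AE x in N. \<i> * v t x = - f t x)) \<and> L2_continuous N f)"

definition observed_energy ::
  "'a measure \<Rightarrow> 'a set \<Rightarrow> (real \<Rightarrow> 'a \<Rightarrow> complex) \<Rightarrow> real \<Rightarrow> real" where
  "observed_energy N \<omega> v T = (LINT t:{0..T}|lborel. (LINT x:\<omega>|N. (cmod (v t x))\<^sup>2))"

definition wave_constant ::
  "'a measure \<Rightarrow> ('a \<Rightarrow> complex) set \<Rightarrow> 'a operator \<Rightarrow> 'a set \<Rightarrow> real" where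
  "wave_constant N X A \<omega> = Inf
     {Lim at_top (\<lambda>T. 1 / T * (observed_energy N \<omega> v T / ((l2norm N r0)\<^sup>2 + (l2norm N y1)\<^sup>2)))
      | y0 r0 y1 y v. (y0, r0) \<in> sqrt_op N X A \<and> y1 \<in> X \<and>
          \<not> ((AE x in N. y0 x = 0) \<and> (AE x in N. y1 x = 0)) \<and>
          wave_solution N X A y0 y1 y v}"

definition schroedinger_constant ::
  "'a measure \<Rightarrow> ('a \<Rightarrow> complex) set \<Rightarrow> 'a operator \<Rightarrow> 'a set \<Rightarrow> real" where
  "schroedinger_constant N X A \<omega> = Inf
     {Lim at_top (\<lambda>T. 1 / T * (observed_energy N \<omega> v T / (l2norm N f0)\<^sup>2))
      | y0 f0 y v. (y0, f0) \<in> A \<and> \<not> (AE x in N. y0 x = 0) \<and>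
          schroedinger_solution N X A y0 y v}"

text \<open>The sum of the functions \<open>F k\<close>, \<open>k \<in> I\<close>; over an infinite index set it is the unconditional
  sum in \<open>L\<^sup>2\<close>, which is determined up to null sets.\<close>

definition L2_sum :: "'a measure \<Rightarrow> (nat \<Rightarrow> 'a \<Rightarrow> complex) \<Rightarrow> nat set \<Rightarrow> 'a \<Rightarrow> complex" where
  "L2_sum N F I =
     (if finite I then (\<lambda>x. \<Sum>k\<in>I. F k x)
      else (SOME s. s \<in> L2 N \<and>
        ((\<lambda>J. l2norm N (\<lambda>x. s x - (\<Sum>k\<in>J. F k x))) \<longlongrightarrow> 0) (finite_subsets_at_top I)))"

end

theory Submission
  imports Defs
begin

text \<open>
  In the eigenbasis both evolution equations decouple into scalar equations. A solution of the wave
  equation has the velocity \<open>v(t) = \<Sum>\<^sub>j (p\<^sub>j exp(i \<lambda>\<^sub>j t) + q\<^sub>j exp(- i \<lambda>\<^sub>j t)) \<phi>\<^sub>j\<close>, where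
  \<open>\<Sum>\<^sub>j |p\<^sub>j|\<^sup>2 + |q\<^sub>j|\<^sup>2\<close> is half of the squared norm of the initial data, and a solution of the
  Schroedinger equation has the velocity \<open>v(t) = \<Sum>\<^sub>j p\<^sub>j exp(i \<lambda>\<^sub>j\<^sup>2 t) \<phi>\<^sub>j\<close>, where \<open>\<Sum>\<^sub>j |p\<^sub>j|\<^sup>2\<close> is the
  squared norm of the initial data. The mean over \<open>[0, T]\<close> of a product of oscillations of different
  frequencies tends to \<open>0\<close>. Hence only products within one frequency contribute to the limit of the
  mean energy observed on \<open>\<omega>\<close>, and this limit is the sum over the frequencies of the observed energies
  of the corresponding components of \<open>v\<close>, each of which lies in one eigenspace of the Laplacian.

  Let \<open>m\<close> be the infimum of \<open>\<parallel>u\<parallel>\<^sub>\<omega>\<^sup>2 / \<parallel>u\<parallel>\<^sup>2\<close> over the nonzero finite combinations \<open>u\<close> of basis functions with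
  one common eigenvalue (the set \<open>eigen_ratios\<close>). Every component satisfies \<open>\<parallel>u\<parallel>\<^sub>\<omega>\<^sup>2 \<ge> m \<parallel>u\<parallel>\<^sup>2\<close>, so the
  limit is at least \<open>m (\<Sum>\<^sub>j |p\<^sub>j|\<^sup>2 + |q\<^sub>j|\<^sup>2)\<close>. Conversely the harmonic motion that starts in an
  eigenfunction \<open>u\<close> has a constant observed energy and realises the quotient of \<open>u\<close>. Therefore the
  Schroedinger constant is \<open>m\<close> and the wave constant is \<open>m / 2\<close>. The factor reflects that half of the
  energy of a wave is kinetic in the time mean. The spectral functional has the infimum \<open>m\<close> for the same
  reason: its numerator is the sum over the eigenvalues of the observed energies of the eigencomponents.

  The argument rests on three lemmas. \<open>sqrt_op_diag\<close> identifies the square root of the Laplacian, which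
  is defined as the unique positive root, with multiplication of the coefficients by \<open>\<lambda>\<^sub>j\<close>.
  \<open>asymptotic_energy\<close> provides the existence of the limit of the mean observed energy and its lower
  bound. \<open>spectral_energy_ge\<close> is the corresponding bound for the spectral functional. Both the square
  root and the spectral functional rest on the completeness of \<open>L\<^sup>2\<close> (\<open>L2_complete\<close>), which provides
  functions with prescribed square summable coefficients.\<close>

section \<open>The scalar product on square integrable functions\<close>

lemma L2_measurable: "u \<in> L2 N \<Longrightarrow> u \<in> borel_measurable N"
  by (simp add: L2_def)

lemma L2_integrable: "u \<in> L2 N \<Longrightarrow> integrable N (\<lambda>x. (cmod (u x))\<^sup>2)"
  by (simp add: L2_def)

lemma L2_zero [simp]: "(\<lambda>x. 0) \<in> L2 N"
  by (simp add: L2_def)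

lemma L2_scale [intro]: "u \<in> L2 N \<Longrightarrow> (\<lambda>x. a * u x) \<in> L2 N"
  by (auto simp: L2_def norm_mult power_mult_distrib)

lemma L2_add [intro]:
  assumes "u \<in> L2 N" "v \<in> L2 N"
  shows "(\<lambda>x. u x + v x) \<in> L2 N"
proof -
  note [measurable] = L2_measurable[OF assms(1)] L2_measurable[OF assms(2)]
  have "integrable N (\<lambda>x. (cmod (u x + v x))\<^sup>2)"
  proof (rule Bochner_Integration.integrable_bound)
    show "integrable N (\<lambda>x. 2 * (cmod (u x))\<^sup>2 + 2 * (cmod (v x))\<^sup>2)"
      using assms by (simp add: L2_integrable)
    have "(cmod (a + b))\<^sup>2 \<le> 2 * (cmod a)\<^sup>2 + 2 * (cmod b)\<^sup>2" for a b
    proof -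
      have "(cmod (a + b))\<^sup>2 \<le> (cmod a + cmod b)\<^sup>2"
        by (simp add: norm_triangle_ineq power_mono)
      also have "\<dots> \<le> 2 * (cmod a)\<^sup>2 + 2 * (cmod b)\<^sup>2"
        using zero_le_power2[of "cmod a - cmod b"] by (simp add: power2_eq_square algebra_simps)
      finally show ?thesis .
    qed
    then show "AE x in N. norm ((cmod (u x + v x))\<^sup>2) \<le> norm (2 * (cmod (u x))\<^sup>2 + 2 * (cmod (v x))\<^sup>2)"
      by (auto intro!: AE_I2)
  qed measurable
  then show ?thesis
    by (simp add: L2_def)
qed

lemma L2_diff [intro]:
  assumes "u \<in> L2 N" "v \<in> L2 N"
  shows "(\<lambda>x. u x - v x) \<in> L2 N"
  using L2_add[OF assms(1) L2_scale[OF assms(2), of "- 1"]] by simp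

lemma L2_sum_closed [intro]:
  assumes "\<And>j. j \<in> J \<Longrightarrow> u j \<in> L2 N"
  shows "(\<lambda>x. \<Sum>j\<in>J. u j x) \<in> L2 N"
  using assms by (induction J rule: infinite_finite_induct) (auto intro: L2_add)

lemma cnj_measurable [measurable]: "cnj \<in> borel_measurable borel"
  by (intro borel_measurable_continuous_onI continuous_intros)

lemma integrable_L2_product:
  assumes "u \<in> L2 N" "v \<in> L2 N"
  shows "integrable N (\<lambda>x. u x * cnj (v x))"
proof (rule Bochner_Integration.integrable_bound)
  note [measurable] = L2_measurable[OF assms(1)] L2_measurable[OF assms(2)]
  show "integrable N (\<lambda>x. (cmod (u x))\<^sup>2 + (cmod (v x))\<^sup>2)"
    using assms by (simp add: L2_integrable)
  have "cmod a * cmod b \<le> (cmod a)\<^sup>2 + (cmod b)\<^sup>2" for a b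
  proof -
    have "0 \<le> (cmod a - cmod b)\<^sup>2" "0 \<le> cmod a * cmod b"
      by simp_all
    then show ?thesis
      unfolding power2_diff by linarith
  qed
  then show "AE x in N. norm (u x * cnj (v x)) \<le> norm ((cmod (u x))\<^sup>2 + (cmod (v x))\<^sup>2)"
    by (auto intro!: AE_I2 simp: norm_mult)
  show "(\<lambda>x. u x * cnj (v x)) \<in> borel_measurable N"
    by measurable
qed

lemma ip_diff_left:
  assumes "u \<in> L2 N" "v \<in> L2 N" "w \<in> L2 N"
  shows "ip N (\<lambda>x. u x - v x) w = ip N u w - ip N v w"
  using assms by (simp add: ip_def left_diff_distrib integrable_L2_product)

lemma ip_scale_left: "ip N (\<lambda>x. a * u x) w = a * ip N u w"
  by (simp add: ip_def mult.assoc)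

lemma ip_sum_left:
  assumes "\<And>j. j \<in> J \<Longrightarrow> u j \<in> L2 N" "w \<in> L2 N"
  shows "ip N (\<lambda>x. \<Sum>j\<in>J. u j x) w = (\<Sum>j\<in>J. ip N (u j) w)"
  using assms by (simp add: ip_def sum_distrib_right integrable_L2_product)

lemma ip_commute: "ip N v u = cnj (ip N u v)"
  unfolding ip_def by (subst Bochner_Integration.integral_cnj[symmetric]) (simp add: mult.commute)

lemma ip_scale_right: "ip N u (\<lambda>x. a * w x) = cnj a * ip N u w"
  by (subst (1 2) ip_commute) (simp add: ip_scale_left)

lemma ip_diff_right:
  assumes "u \<in> L2 N" "v \<in> L2 N" "w \<in> L2 N"
  shows "ip N w (\<lambda>x. u x - v x) = ip N w u - ip N w v"
  using assms by (subst (1 2 3) ip_commute) (simp add: ip_diff_left)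

lemma ip_sum_right:
  assumes "\<And>j. j \<in> J \<Longrightarrow> u j \<in> L2 N" "w \<in> L2 N"
  shows "ip N w (\<lambda>x. \<Sum>j\<in>J. u j x) = (\<Sum>j\<in>J. ip N w (u j))"
proof -
  have "ip N w (\<lambda>x. \<Sum>j\<in>J. u j x) = cnj (\<Sum>j\<in>J. ip N (u j) w)"
    by (subst ip_commute) (simp add: ip_sum_left assms)
  also have "\<dots> = (\<Sum>j\<in>J. ip N w (u j))"
    by (simp add: ip_commute[of N w])
  finally show ?thesis .
qed

lemma ip_cong_AE:
  assumes "u \<in> L2 N" "u' \<in> L2 N" "w \<in> L2 N" "AE x in N. u x = u' x"
  shows "ip N u w = ip N u' w"
proof -
  note [measurable] = assms(1-3)[THEN L2_measurable]
  show ?thesis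
    unfolding ip_def
  proof (rule integral_cong_AE)
    show "AE x in N. u x * cnj (w x) = u' x * cnj (w x)"
      using assms(4) by eventually_elim simp
  qed measurable
qed

lemma l2norm_nonneg [simp]: "0 \<le> l2norm N u"
  by (simp add: l2norm_def)

lemma l2norm_sq: "(l2norm N u)\<^sup>2 = (LINT x|N. (cmod (u x))\<^sup>2)"
  by (simp add: l2norm_def)

lemma ip_self: "ip N u u = of_real ((l2norm N u)\<^sup>2)"
  unfolding l2norm_sq ip_def complex_norm_square[symmetric] by (simp only: integral_complex_of_real)

lemma l2norm_scale: "l2norm N (\<lambda>x. a * u x) = cmod a * l2norm N u"
  by (simp add: l2norm_def norm_mult power_mult_distrib real_sqrt_mult)

lemma l2norm_zero [simp]: "l2norm N (\<lambda>x. 0) = 0"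
  by (simp add: l2norm_def)

lemma l2norm_minus_commute: "l2norm N (\<lambda>x. u x - v x) = l2norm N (\<lambda>x. v x - u x)"
  by (simp add: l2norm_def norm_minus_commute)

lemma l2norm_eq_0_iff:
  assumes "u \<in> L2 N"
  shows "l2norm N u = 0 \<longleftrightarrow> (AE x in N. u x = 0)"
  using integral_nonneg_eq_0_iff_AE[OF L2_integrable[OF assms]] by (simp add: l2norm_def)

lemma l2norm_add_sq:
  assumes "u \<in> L2 N" "v \<in> L2 N"
  shows "(l2norm N (\<lambda>x. u x + v x))\<^sup>2 = (l2norm N u)\<^sup>2 + (l2norm N v)\<^sup>2 + 2 * Re (ip N u v)"
proof -
  have "(cmod (u x + v x))\<^sup>2 = (cmod (u x))\<^sup>2 + (cmod (v x))\<^sup>2 + 2 * Re (u x * cnj (v x))" for x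
    by (simp only: cmod_power2) (simp add: power2_eq_square algebra_simps)
  then show ?thesis
    unfolding l2norm_sq ip_def integral_Re[OF integrable_L2_product[OF assms], symmetric]
    using integrable_Re[OF integrable_L2_product[OF assms]]
      L2_integrable[OF assms(1)] L2_integrable[OF assms(2)]
    by (simp del: times_complex.sel)
qed

lemma l2norm_diff_sq:
  assumes "u \<in> L2 N" "v \<in> L2 N"
  shows "(l2norm N (\<lambda>x. u x - v x))\<^sup>2 = (l2norm N u)\<^sup>2 + (l2norm N v)\<^sup>2 - 2 * Re (ip N u v)"
  using l2norm_add_sq[OF assms(1) L2_scale[OF assms(2), of "- 1"]]
    ip_scale_right[of N u "- 1" v] l2norm_scale[of N "- 1" v] by simp

lemma Cauchy_Schwarz_L2:
  assumes "u \<in> L2 N" "v \<in> L2 N"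
  shows "cmod (ip N u v) \<le> l2norm N u * l2norm N v"
proof (cases "l2norm N v = 0")
  case True
  then have "AE x in N. v x = 0"
    using assms by (simp add: l2norm_eq_0_iff)
  then have "ip N v u = ip N (\<lambda>x. 0) u"
    using assms by (intro ip_cong_AE) auto
  then have "ip N u v = 0"
    by (subst ip_commute) (simp add: ip_def)
  then show ?thesis
    by simp
next
  case False
  then have pos: "0 < l2norm N v"
    by (simp add: order_less_le)
  define a where "a = ip N u v / of_real ((l2norm N v)\<^sup>2)"
  have "0 \<le> (l2norm N (\<lambda>x. u x - a * v x))\<^sup>2"
    by simp
  also have "\<dots> = (l2norm N u)\<^sup>2 + (cmod a * l2norm N v)\<^sup>2 - 2 * Re (cnj a * ip N u v)"
    using assms by (subst l2norm_diff_sq) (auto simp: l2norm_scale ip_scale_right)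
  also have "cnj a * ip N u v = of_real ((cmod (ip N u v))\<^sup>2 / (l2norm N v)\<^sup>2)"
    by (simp add: a_def complex_norm_square mult.commute del: of_real_power)
  also have "(cmod a * l2norm N v)\<^sup>2 = (cmod (ip N u v))\<^sup>2 / (l2norm N v)\<^sup>2"
    using pos by (simp add: a_def norm_divide power_divide power_mult_distrib norm_power field_simps)
  finally have "(cmod (ip N u v))\<^sup>2 / (l2norm N v)\<^sup>2 \<le> (l2norm N u)\<^sup>2"
    by simp
  then have "(cmod (ip N u v))\<^sup>2 \<le> (l2norm N u * l2norm N v)\<^sup>2"
    using pos by (simp add: field_simps power_mult_distrib)
  then show ?thesis
    by (rule power2_le_imp_le) simp
qed

lemma l2norm_triangle:
  assumes "u \<in> L2 N" "v \<in> L2 N"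
  shows "l2norm N (\<lambda>x. u x + v x) \<le> l2norm N u + l2norm N v"
proof (rule power2_le_imp_le)
  have "Re (ip N u v) \<le> l2norm N u * l2norm N v"
    using complex_Re_le_cmod[of "ip N u v"] Cauchy_Schwarz_L2[OF assms] by linarith
  then show "(l2norm N (\<lambda>x. u x + v x))\<^sup>2 \<le> (l2norm N u + l2norm N v)\<^sup>2"
    by (simp add: l2norm_add_sq assms power2_sum)
qed simp

lemma l2norm_triangle_diff:
  assumes "u \<in> L2 N" "v \<in> L2 N" "w \<in> L2 N"
  shows "l2norm N (\<lambda>x. u x - w x) \<le> l2norm N (\<lambda>x. u x - v x) + l2norm N (\<lambda>x. v x - w x)"
  using l2norm_triangle[OF L2_diff[OF assms(1,2)] L2_diff[OF assms(2,3)]] by simp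

lemma l2norm_diff_le:
  assumes "u \<in> L2 N" "v \<in> L2 N"
  shows "\<bar>l2norm N u - l2norm N v\<bar> \<le> l2norm N (\<lambda>x. u x - v x)"
  using l2norm_triangle_diff[OF assms(1,2) L2_zero] l2norm_triangle_diff[OF assms(2,1) L2_zero]
  by (simp add: l2norm_minus_commute[of N v u])

lemma nn_integral_L2:
  assumes "u \<in> L2 N"
  shows "(\<integral>\<^sup>+x. ennreal ((cmod (u x))\<^sup>2) \<partial>N) = ennreal ((l2norm N u)\<^sup>2)"
  unfolding l2norm_sq using L2_integrable[OF assms] by (intro nn_integral_eq_integral) auto

text \<open>Observation on \<open>S\<close> is the \<open>L\<^sup>2\<close> seminorm of the measure restricted to \<open>S\<close>, so that the general
  facts about \<open>L\<^sup>2\<close> also apply to the observed energy.\<close>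

lemma L2_restrict_space:
  assumes "S \<in> sets N" "u \<in> L2 N"
  shows "u \<in> L2 (restrict_space N S)"
    and "l2norm (restrict_space N S) u \<le> l2norm N u"
proof -
  have S: "S \<inter> space N \<in> sets N"
    using assms by auto
  have i: "integrable N (\<lambda>x. indicator S x *\<^sub>R (cmod (u x))\<^sup>2)"
    using integrable_mult_indicator[OF assms(1) L2_integrable[OF assms(2)]] .
  then show "u \<in> L2 (restrict_space N S)"
    using L2_measurable[OF assms(2)]
    by (auto simp: L2_def integrable_restrict_space[OF S] intro: measurable_restrict_space1)
  show "l2norm (restrict_space N S) u \<le> l2norm N u"
    unfolding l2norm_def integral_restrict_space[OF S]
    using i L2_integrable[OF assms(2)]
    by (intro real_sqrt_le_mono integral_mono) (auto simp: indicator_def)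
qed

lemma set_lebesgue_integral_eq_l2norm:
  assumes "S \<in> sets N"
  shows "(LINT x:S|N. (cmod (u x))\<^sup>2) = (l2norm (restrict_space N S) u)\<^sup>2"
  using assms by (simp add: l2norm_sq set_lebesgue_integral_def integral_restrict_space)

section \<open>Completeness\<close>

text \<open>The usual argument: along a subsequence with geometrically decreasing increments the functions
  converge almost everywhere, and Fatou's lemma transfers the Cauchy property to the pointwise limit.\<close>

lemma L2_complete:
  assumes u: "\<And>n. u n \<in> L2 N"
    and Cau: "\<And>e. 0 < e \<Longrightarrow> \<exists>n0. \<forall>m\<ge>n0. \<forall>n\<ge>n0. l2norm N (\<lambda>x. u m x - u n x) < e"
  obtains w where "w \<in> L2 N" "(\<lambda>n. l2norm N (\<lambda>x. u n x - w x)) \<longlonglongrightarrow> 0"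
proof -
  note [measurable] = u[THEN L2_measurable]
  obtain n0 where n0: "\<And>i m n. m \<ge> n0 i \<Longrightarrow> n \<ge> n0 i \<Longrightarrow> l2norm N (\<lambda>x. u m x - u n x) < (1/2)^i"
    using Cau[of "(1/2)^i" for i] by (metis zero_less_divide_1_iff zero_less_numeral zero_less_power)
  \<comment> \<open>The summand \<open>i\<close> makes the subsequence tend to infinity, the sum makes it monotone.\<close>
  define k where "k i = (\<Sum>j\<le>i. n0 j) + i" for i
  have k_ge: "n0 i \<le> k i" and k_ge_id: "i \<le> k i" for i
    by (auto simp: k_def intro: trans_le_add1 member_le_sum)
  have k_Suc: "k i \<le> k (Suc i)" for i
    by (simp add: k_def)
  define d where "d i x = cmod (u (k (Suc i)) x - u (k i) x)" for i x
  have [measurable]: "d i \<in> borel_measurable N" for i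
    unfolding d_def by measurable
  have d_int: "(\<integral>\<^sup>+x. ennreal (2^i * (d i x)\<^sup>2) \<partial>N) \<le> ennreal ((1/2)^i)" for i
  proof -
    have "l2norm N (\<lambda>x. u (k (Suc i)) x - u (k i) x) \<le> (1/2)^i"
      using n0[of i "k (Suc i)" "k i"] k_ge[of i] k_Suc[of i] by simp
    then have "(l2norm N (\<lambda>x. u (k (Suc i)) x - u (k i) x))\<^sup>2 \<le> ((1/2)^i)\<^sup>2"
      by (intro power_mono) auto
    then have "2^i * (l2norm N (\<lambda>x. u (k (Suc i)) x - u (k i) x))\<^sup>2 \<le> 2^i * ((1/2)^i)\<^sup>2"
      by simp
    also have "\<dots> = (1/2)^i"
      by (simp add: power2_eq_square power_divide)
    finally have *: "2^i * (l2norm N (\<lambda>x. u (k (Suc i)) x - u (k i) x))\<^sup>2 \<le> (1/2)^i" .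
    have "(\<integral>\<^sup>+x. ennreal (2^i * (d i x)\<^sup>2) \<partial>N)
        = ennreal (2^i) * (\<integral>\<^sup>+x. ennreal ((d i x)\<^sup>2) \<partial>N)"
      by (simp add: ennreal_mult nn_integral_cmult)
    also have "(\<integral>\<^sup>+x. ennreal ((d i x)\<^sup>2) \<partial>N)
        = ennreal ((l2norm N (\<lambda>x. u (k (Suc i)) x - u (k i) x))\<^sup>2)"
      unfolding d_def by (intro nn_integral_L2 L2_diff u)
    finally show ?thesis
      using * by (simp flip: ennreal_mult)
  qed
  have "(\<integral>\<^sup>+x. (\<Sum>i. ennreal (2^i * (d i x)\<^sup>2)) \<partial>N) \<le> (\<Sum>i. ennreal ((1/2)^i))"
    by (subst nn_integral_suminf) (auto intro!: suminf_le d_int)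
  also have "\<dots> = ennreal (\<Sum>i. (1/2)^i)"
    by (intro suminf_ennreal2) (auto intro: summable_geometric)
  finally have "(\<integral>\<^sup>+x. (\<Sum>i. ennreal (2^i * (d i x)\<^sup>2)) \<partial>N) \<noteq> \<infinity>"
    by (auto simp: top_unique)
  then have "AE x in N. (\<Sum>i. ennreal (2^i * (d i x)\<^sup>2)) \<noteq> \<infinity>"
    by (intro nn_integral_PInf_AE) auto
  then have conv: "AE x in N. convergent (\<lambda>i. u (k i) x)"
  proof eventually_elim
    case (elim x)
    then have "summable (\<lambda>i. 2^i * (d i x)\<^sup>2)"
      by (intro summable_suminf_not_top) (auto simp: infinity_ennreal_def)
    then have s: "summable (\<lambda>i. 2^i * (d i x)\<^sup>2 + (1/2)^i)"
      by (intro summable_add summable_geometric) auto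
    \<comment> \<open>The arithmetic-geometric mean inequality turns the weighted square summability into
      absolute summability of the increments.\<close>
    have le: "d i x \<le> 2^i * (d i x)\<^sup>2 + (1/2)^i" for i
    proof -
      define c :: real where "c = 2^i"
      have c: "c > 0" "(1/2)^i = 1 / c"
        by (auto simp: c_def power_divide)
      have "0 \<le> (c * d i x - 1)\<^sup>2 + c * d i x"
        using c by (simp add: d_def)
      then have "c * d i x \<le> c * (c * (d i x)\<^sup>2 + 1 / c)"
        using c by (simp add: power2_eq_square algebra_simps)
      then show ?thesis
        using c by (simp add: c_def)
    qed
    have "summable (\<lambda>i. d i x)"
      by (rule summable_comparison_test[OF _ s]) (use le in \<open>auto simp: d_def intro!: exI[of _ 0]\<close>)
    then have "summable (\<lambda>i. u (k (Suc i)) x - u (k i) x)"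
      unfolding d_def by (rule summable_norm_cancel)
    then have "convergent (\<lambda>n. \<Sum>i<n. u (k (Suc i)) x - u (k i) x)"
      by (simp add: summable_iff_convergent)
    then have "convergent (\<lambda>n. u (k n) x - u (k 0) x)"
      by (simp only: sum_lessThan_telescope[of "\<lambda>n. u (k n) x"])
    then have "convergent (\<lambda>n. (u (k n) x - u (k 0) x) + u (k 0) x)"
      by (intro convergent_add convergent_const)
    then show ?case
      by simp
  qed
  define w where "w x = lim (\<lambda>i. u (k i) x)" for x
  have wm[measurable]: "w \<in> borel_measurable N"
    unfolding w_def by (rule borel_measurable_lim_metric) measurable
  have lim: "AE x in N. (\<lambda>i. u (k i) x) \<longlonglongrightarrow> w x"
    using conv by eventually_elim (simp add: w_def convergent_LIMSEQ_iff)
  have fatou: "(\<integral>\<^sup>+x. ennreal ((cmod (u n x - w x))\<^sup>2) \<partial>N) \<le> ennreal (((1/2)^i)\<^sup>2)"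
    if n: "n \<ge> n0 i" for n i
  proof -
    have "(\<integral>\<^sup>+x. ennreal ((cmod (u n x - w x))\<^sup>2) \<partial>N)
        = (\<integral>\<^sup>+x. liminf (\<lambda>j. ennreal ((cmod (u n x - u (k j) x))\<^sup>2)) \<partial>N)"
    proof (rule nn_integral_cong_AE, use lim in eventually_elim)
      case (elim x)
      then have "(\<lambda>j. ennreal ((cmod (u n x - u (k j) x))\<^sup>2)) \<longlonglongrightarrow> ennreal ((cmod (u n x - w x))\<^sup>2)"
        by (intro tendsto_intros)
      then show ?case
        by (intro lim_imp_Liminf[symmetric]) auto
    qed
    also have "\<dots> \<le> liminf (\<lambda>j. \<integral>\<^sup>+x. ennreal ((cmod (u n x - u (k j) x))\<^sup>2) \<partial>N)"
      by (intro nn_integral_liminf) measurable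
    also have "\<dots> \<le> ennreal (((1/2)^i)\<^sup>2)"
    proof (rule Liminf_le)
      show "\<forall>\<^sub>F j in sequentially. (\<integral>\<^sup>+x. ennreal ((cmod (u n x - u (k j) x))\<^sup>2) \<partial>N) \<le> ennreal (((1/2)^i)\<^sup>2)"
        using eventually_ge_at_top[of "n0 i"]
      proof eventually_elim
        case (elim j)
        then have "l2norm N (\<lambda>x. u n x - u (k j) x) \<le> (1/2)^i"
          using n0[OF n, of "k j"] k_ge_id[of j] by simp
        then show ?case
          by (subst nn_integral_L2) (auto intro!: L2_diff u ennreal_leI power_mono)
      qed
    qed simp
    finally show ?thesis .
  qed
  have diff: "(\<lambda>x. u n x - w x) \<in> L2 N" if n: "n \<ge> n0 i" for n i
  proof -
    have "(\<integral>\<^sup>+x. ennreal ((cmod (u n x - w x))\<^sup>2) \<partial>N) < \<infinity>"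
      using fatou[OF n] by (auto simp: le_less_trans)
    then show ?thesis
      by (auto simp: L2_def intro!: integrableI_bounded)
  qed
  have "w \<in> L2 N"
    using L2_diff[OF u[of "n0 0"] diff[of 0 "n0 0"]] by simp
  moreover have "(\<lambda>n. l2norm N (\<lambda>x. u n x - w x)) \<longlonglongrightarrow> 0"
  proof (rule LIMSEQ_I)
    fix r :: real assume "r > 0"
    then obtain i where i: "(1/2)^i < r"
      using real_arch_pow_inv[of r "1/2"] by auto
    have "l2norm N (\<lambda>x. u n x - w x) < r" if n: "n \<ge> n0 i" for n
    proof -
      have "(l2norm N (\<lambda>x. u n x - w x))\<^sup>2 \<le> ((1/2)^i)\<^sup>2"
        using fatou[OF n] by (subst (asm) nn_integral_L2[OF diff[OF n]]) simp
      then have "l2norm N (\<lambda>x. u n x - w x) \<le> (1/2)^i"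
        by (rule power2_le_imp_le) simp
      then show ?thesis
        using i by simp
    qed
    then show "\<exists>no. \<forall>n\<ge>no. norm (l2norm N (\<lambda>x. u n x - w x) - 0) < r"
      by auto
  qed
  ultimately show ?thesis
    using that by blast
qed

section \<open>Selfadjoint operators\<close>

lemma selfadjoint_op_iff:
  assumes "selfadjoint_op N X S"
  shows "(u, v) \<in> S \<longleftrightarrow> u \<in> X \<and> v \<in> X \<and> (\<forall>(f, h)\<in>S. ip N h u = ip N f v)"
proof -
  have "(u, v) \<in> S \<longleftrightarrow> (u, v) \<in> adjoint_op N X S"
    using assms unfolding selfadjoint_op_def by (elim conjE) (rule arg_cong)
  then show ?thesis
    by (simp only: adjoint_op_def mem_Collect_eq prod.case)
qed

lemma adjoint_op_antimono: "S \<subseteq> T \<Longrightarrow> adjoint_op N X T \<subseteq> adjoint_op N X S"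
  by (auto simp: adjoint_op_def)

section \<open>Orthonormal bases\<close>

locale orthonormal_basis =
  fixes N :: "'a measure" and X :: "('a \<Rightarrow> complex) set" and e :: "nat \<Rightarrow> 'a \<Rightarrow> complex"
  assumes hilbert: "hilbert_subspace N X"
    and basis_in: "e j \<in> X"
    and orthonormal: "ip N (e i) (e j) = (if i = j then 1 else 0)"
    and dense: "u \<in> X \<Longrightarrow> 0 < \<epsilon> \<Longrightarrow> \<exists>m a. l2norm N (\<lambda>x. u x - (\<Sum>j<m. a j * e j x)) < \<epsilon>"
begin

abbreviation coef :: "('a \<Rightarrow> complex) \<Rightarrow> nat \<Rightarrow> complex" where
  "coef u j \<equiv> ip N u (e j)"

lemma X_L2: "u \<in> X \<Longrightarrow> u \<in> L2 N"
  using hilbert by (auto simp: hilbert_subspace_def)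

lemma X_zero: "(\<lambda>x. 0) \<in> X"
  and X_add: "u \<in> X \<Longrightarrow> v \<in> X \<Longrightarrow> (\<lambda>x. u x + v x) \<in> X"
  and X_scale: "u \<in> X \<Longrightarrow> (\<lambda>x. a * u x) \<in> X"
  and X_closed: "u \<in> L2 N \<Longrightarrow> (\<And>\<epsilon>. 0 < \<epsilon> \<Longrightarrow> \<exists>w\<in>X. l2norm N (\<lambda>x. u x - w x) < \<epsilon>) \<Longrightarrow> u \<in> X"
  using hilbert by (simp_all add: hilbert_subspace_def)

lemma X_diff: "u \<in> X \<Longrightarrow> v \<in> X \<Longrightarrow> (\<lambda>x. u x - v x) \<in> X"
  using X_add[OF _ X_scale[of v "- 1"]] by simp

lemma X_sum: "(\<And>j. j \<in> J \<Longrightarrow> u j \<in> X) \<Longrightarrow> (\<lambda>x. \<Sum>j\<in>J. u j x) \<in> X"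
  by (induction J rule: infinite_finite_induct) (auto intro: X_zero X_add)

lemma basis_L2: "e j \<in> L2 N"
  using basis_in X_L2 by blast

lemma comb_in_X: "(\<lambda>x. \<Sum>j\<in>J. a j * e j x) \<in> X"
  by (intro X_sum X_scale basis_in)

lemma coef_comb:
  assumes "finite J"
  shows "coef (\<lambda>x. \<Sum>j\<in>J. a j * e j x) k = (if k \<in> J then a k else 0)"
proof -
  have "coef (\<lambda>x. \<Sum>j\<in>J. a j * e j x) k = (\<Sum>j\<in>J. a j * (if j = k then 1 else 0))"
    by (subst ip_sum_left) (auto intro!: L2_scale basis_L2 simp: ip_scale_left orthonormal)
  then show ?thesis
    using assms by (simp add: if_distrib cong: if_cong)
qed

lemma ip_comb_right:
  assumes "u \<in> L2 N"
  shows "ip N u (\<lambda>x. \<Sum>j\<in>J. a j * e j x) = (\<Sum>j\<in>J. coef u j * cnj (a j))"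
  using assms by (subst ip_sum_right) (auto intro!: L2_scale basis_L2 simp: ip_scale_right mult.commute)

lemma l2norm_comb:
  assumes "finite J"
  shows "(l2norm N (\<lambda>x. \<Sum>j\<in>J. a j * e j x))\<^sup>2 = (\<Sum>j\<in>J. (cmod (a j))\<^sup>2)"
proof -
  have "complex_of_real ((l2norm N (\<lambda>x. \<Sum>j\<in>J. a j * e j x))\<^sup>2) = (\<Sum>j\<in>J. a j * cnj (a j))"
    unfolding ip_self[symmetric] using assms
    by (subst ip_comb_right) (auto simp: coef_comb intro!: X_L2 comb_in_X)
  also have "\<dots> = complex_of_real (\<Sum>j\<in>J. (cmod (a j))\<^sup>2)"
    by (simp add: complex_norm_square flip: of_real_power)
  finally show ?thesis
    by (simp only: of_real_eq_iff)
qed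

text \<open>Completing the square: the Fourier coefficients give the best approximation among the combinations
  of the \<open>e j\<close> with \<open>j \<in> J\<close>.\<close>

lemma l2norm_diff_comb:
  assumes "finite J" "u \<in> L2 N"
  shows "(l2norm N (\<lambda>x. u x - (\<Sum>j\<in>J. a j * e j x)))\<^sup>2
    = (l2norm N u)\<^sup>2 - (\<Sum>j\<in>J. (cmod (coef u j))\<^sup>2) + (\<Sum>j\<in>J. (cmod (coef u j - a j))\<^sup>2)"
proof -
  have "(cmod (z - w))\<^sup>2 = (cmod z)\<^sup>2 + (cmod w)\<^sup>2 - 2 * Re (z * cnj w)" for z w
    by (simp only: cmod_power2) (simp add: power2_eq_square algebra_simps)
  then have "(\<Sum>j\<in>J. (cmod (coef u j - a j))\<^sup>2)
      = (\<Sum>j\<in>J. (cmod (coef u j))\<^sup>2) + (\<Sum>j\<in>J. (cmod (a j))\<^sup>2) - 2 * Re (\<Sum>j\<in>J. coef u j * cnj (a j))"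
    by (simp add: sum.distrib sum_subtractf sum_distrib_left del: times_complex.sel)
  moreover have "(\<lambda>x. \<Sum>j\<in>J. a j * e j x) \<in> L2 N"
    by (intro X_L2 comb_in_X)
  ultimately show ?thesis
    using assms by (simp add: l2norm_diff_sq l2norm_comb ip_comb_right del: times_complex.sel)
qed

lemma l2norm_diff_partial:
  assumes "finite J" "u \<in> L2 N"
  shows "(l2norm N (\<lambda>x. u x - (\<Sum>j\<in>J. coef u j * e j x)))\<^sup>2
    = (l2norm N u)\<^sup>2 - (\<Sum>j\<in>J. (cmod (coef u j))\<^sup>2)"
  using l2norm_diff_comb[OF assms, of "coef u"] by simp

lemma Parseval:
  assumes "u \<in> X"
  shows "(\<lambda>j. (cmod (coef u j))\<^sup>2) sums (l2norm N u)\<^sup>2"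
  unfolding sums_def
proof (rule LIMSEQ_I)
  fix r :: real assume "0 < r"
  then obtain m a where ma: "l2norm N (\<lambda>x. u x - (\<Sum>j<m. a j * e j x)) < sqrt r"
    using dense[OF assms, of "sqrt r"] by auto
  have "(l2norm N u)\<^sup>2 - (\<Sum>j<m. (cmod (coef u j))\<^sup>2) \<le> (l2norm N (\<lambda>x. u x - (\<Sum>j<m. a j * e j x)))\<^sup>2"
    using assms by (subst l2norm_diff_comb) (auto simp: X_L2 intro!: sum_nonneg)
  also have "\<dots> < (sqrt r)\<^sup>2"
    using ma by (intro power_strict_mono) auto
  finally have m: "(l2norm N u)\<^sup>2 - (\<Sum>j<m. (cmod (coef u j))\<^sup>2) < r"
    using \<open>0 < r\<close> by simp
  have "norm ((\<Sum>j<n. (cmod (coef u j))\<^sup>2) - (l2norm N u)\<^sup>2) < r" if "n \<ge> m" for n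
  proof -
    have "(\<Sum>j<m. (cmod (coef u j))\<^sup>2) \<le> (\<Sum>j<n. (cmod (coef u j))\<^sup>2)"
      using that by (intro sum_mono2) auto
    moreover have "0 \<le> (l2norm N u)\<^sup>2 - (\<Sum>j<n. (cmod (coef u j))\<^sup>2)"
      using assms by (subst l2norm_diff_partial[symmetric]) (auto simp: X_L2)
    ultimately show ?thesis
      using m by simp
  qed
  then show "\<exists>no. \<forall>n\<ge>no. norm ((\<Sum>j<n. (cmod (coef u j))\<^sup>2) - (l2norm N u)\<^sup>2) < r"
    by blast
qed

lemma Parseval_ip:
  assumes "u \<in> X" "v \<in> X"
  shows "(\<lambda>j. coef u j * cnj (coef v j)) sums ip N u v"
proof -
  define P where "P n = (\<lambda>x. \<Sum>j<n. coef v j * e j x)" for n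
  have P: "P n \<in> L2 N" for n
    unfolding P_def by (intro X_L2 comb_in_X)
  have "(\<lambda>n. (l2norm N v)\<^sup>2 - (\<Sum>j<n. (cmod (coef v j))\<^sup>2)) \<longlonglongrightarrow> (l2norm N v)\<^sup>2 - (l2norm N v)\<^sup>2"
    using Parseval[OF assms(2)] by (intro tendsto_intros) (simp add: sums_def)
  moreover have "(l2norm N (\<lambda>x. v x - P n x))\<^sup>2 = (l2norm N v)\<^sup>2 - (\<Sum>j<n. (cmod (coef v j))\<^sup>2)" for n
    unfolding P_def using assms by (intro l2norm_diff_partial) (auto simp: X_L2)
  ultimately have "(\<lambda>n. (l2norm N (\<lambda>x. v x - P n x))\<^sup>2) \<longlonglongrightarrow> 0"
    by simp
  then have "(\<lambda>n. l2norm N (\<lambda>x. v x - P n x)) \<longlonglongrightarrow> 0"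
    by simp
  then have lim: "(\<lambda>n. l2norm N u * l2norm N (\<lambda>x. v x - P n x)) \<longlonglongrightarrow> 0"
    by (rule tendsto_mult_right_zero)
  have "(\<lambda>n. (\<Sum>j<n. coef u j * cnj (coef v j)) - ip N u v) \<longlonglongrightarrow> 0"
  proof (rule Lim_null_comparison[OF _ lim], rule always_eventually, rule allI)
    fix n
    have "(\<Sum>j<n. coef u j * cnj (coef v j)) - ip N u v = - ip N u (\<lambda>x. v x - P n x)"
      using assms P unfolding P_def
      by (subst ip_diff_right) (auto simp: ip_comb_right X_L2)
    also have "norm \<dots> \<le> l2norm N u * l2norm N (\<lambda>x. v x - P n x)"
      using assms P by (simp add: Cauchy_Schwarz_L2 X_L2 L2_diff)
    finally show "norm ((\<Sum>j<n. coef u j * cnj (coef v j)) - ip N u v)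
        \<le> l2norm N u * l2norm N (\<lambda>x. v x - P n x)" .
  qed
  then show ?thesis
    unfolding sums_def by (simp add: LIM_zero_iff)
qed

lemma coef_eq_imp_AE:
  assumes "u \<in> X" "v \<in> X" "\<And>j. coef u j = coef v j"
  shows "AE x in N. u x = v x"
proof -
  have "coef (\<lambda>x. u x - v x) j = 0" for j
    using assms by (subst ip_diff_left) (auto simp: X_L2 basis_L2)
  then have "(\<lambda>j. 0) sums (l2norm N (\<lambda>x. u x - v x))\<^sup>2"
    using Parseval[OF X_diff[OF assms(1,2)]] by simp
  then have "l2norm N (\<lambda>x. u x - v x) = 0"
    using sums_unique2[OF _ sums_zero] by fastforce
  then have "AE x in N. u x - v x = 0"
    using assms by (subst (asm) l2norm_eq_0_iff) (auto simp: X_L2)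
  then show ?thesis
    by eventually_elim simp
qed

lemma Riesz_Fischer:
  assumes c: "summable (\<lambda>j. (cmod (c j))\<^sup>2)"
  shows "\<exists>u\<in>X. \<forall>j. coef u j = c j"
proof -
  define P where "P n = (\<lambda>x. \<Sum>j<n. c j * e j x)" for n
  have P: "P n \<in> L2 N" "P n \<in> X" for n
    unfolding P_def by (auto intro!: X_L2 comb_in_X)
  have diff: "(l2norm N (\<lambda>x. P m x - P n x))\<^sup>2 = (\<Sum>j\<in>{n..<m}. (cmod (c j))\<^sup>2)" if "n \<le> m" for m n
  proof -
    have "P m x - P n x = (\<Sum>j\<in>{n..<m}. c j * e j x)" for x
      using that unfolding P_def lessThan_atLeast0 by (subst sum_diff_nat_ivl) auto
    then show ?thesis
      by (simp add: l2norm_comb)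
  qed
  have small: "\<exists>n0. \<forall>m\<ge>n0. \<forall>n\<ge>n0. l2norm N (\<lambda>x. P m x - P n x) < \<epsilon>" if "0 < \<epsilon>" for \<epsilon>
  proof -
    have "0 < \<epsilon>\<^sup>2"
      using that by simp
    with c obtain n0 where n0: "\<And>m n. m \<ge> n0 \<Longrightarrow> norm (\<Sum>j\<in>{m..<n}. (cmod (c j))\<^sup>2) < \<epsilon>\<^sup>2"
      unfolding summable_Cauchy by blast
    have *: "l2norm N (\<lambda>x. P m x - P n x) < \<epsilon>" if "n0 \<le> n" "n \<le> m" for m n
    proof (rule power2_less_imp_less)
      show "(l2norm N (\<lambda>x. P m x - P n x))\<^sup>2 < \<epsilon>\<^sup>2"
        using n0[of n m] that by (simp add: diff sum_nonneg)
    qed (use \<open>0 < \<epsilon>\<close> in simp)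
    show ?thesis
    proof (intro exI[of _ n0] allI impI)
      fix m n assume "n0 \<le> m" "n0 \<le> n"
      then show "l2norm N (\<lambda>x. P m x - P n x) < \<epsilon>"
        using *[of n m] *[of m n] by (cases "n \<le> m") (auto simp: l2norm_minus_commute[of N "P m"])
    qed
  qed
  obtain w where w: "w \<in> L2 N" "(\<lambda>n. l2norm N (\<lambda>x. P n x - w x)) \<longlonglongrightarrow> 0"
    by (rule L2_complete[of P N, OF P(1) small])
  have "w \<in> X"
  proof (rule X_closed[OF w(1)])
    fix \<epsilon> :: real assume "0 < \<epsilon>"
    then have "\<forall>\<^sub>F n in sequentially. l2norm N (\<lambda>x. P n x - w x) < \<epsilon>"
      by (rule order_tendstoD(2)[OF w(2)])
    then obtain n where "l2norm N (\<lambda>x. P n x - w x) < \<epsilon>"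
      by (auto simp: eventually_sequentially)
    then show "\<exists>v\<in>X. l2norm N (\<lambda>x. w x - v x) < \<epsilon>"
      using P(2)[of n] by (auto simp: l2norm_minus_commute[of N w])
  qed
  moreover have "coef w j = c j" for j
  proof -
    have "(\<lambda>n. coef (P n) j - coef w j) \<longlonglongrightarrow> 0"
    proof (rule Lim_null_comparison[OF _ w(2)], rule always_eventually, rule allI)
      fix n
      have "norm (coef (P n) j - coef w j) \<le> l2norm N (\<lambda>x. P n x - w x) * l2norm N (e j)"
        using Cauchy_Schwarz_L2[OF L2_diff[OF P(1)[of n] w(1)] basis_L2[of j]]
          ip_diff_left[OF P(1)[of n] w(1) basis_L2[of j]] by simp
      also have "l2norm N (e j) = 1"
        using l2norm_comb[of "{j}" "\<lambda>_. 1"] l2norm_nonneg[of N "e j"]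
        by (simp add: power2_eq_1_iff)
      finally show "norm (coef (P n) j - coef w j) \<le> l2norm N (\<lambda>x. P n x - w x)"
        by simp
    qed
    then have "(\<lambda>n. coef (P n) j) \<longlonglongrightarrow> coef w j"
      by (simp add: LIM_zero_iff)
    moreover have "(\<lambda>n. coef (P n) j) \<longlonglongrightarrow> c j"
      by (rule tendsto_eventually)
        (use eventually_gt_at_top[of j] in eventually_elim, simp add: P_def coef_comb)
    ultimately show ?thesis
      by (rule LIMSEQ_unique[where X="\<lambda>n. coef (P n) j"])
  qed
  ultimately show ?thesis
    by blast
qed

section \<open>Operators that are diagonal in an orthonormal basis\<close>

definition diag :: "(nat \<Rightarrow> real) \<Rightarrow> 'a operator" where
  "diag d = {(u, v). u \<in> X \<and> v \<in> X \<and> (\<forall>j. coef v j = of_real (d j) * coef u j)}"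

lemma diagI: "u \<in> X \<Longrightarrow> v \<in> X \<Longrightarrow> (\<And>j. coef v j = of_real (d j) * coef u j) \<Longrightarrow> (u, v) \<in> diag d"
  by (simp add: diag_def)

lemma diagD:
  assumes "(u, v) \<in> diag d"
  shows "u \<in> X" "v \<in> X" "coef v j = of_real (d j) * coef u j"
  using assms by (auto simp: diag_def)

lemma comb_in_diag:
  assumes "finite J"
  shows "((\<lambda>x. \<Sum>j\<in>J. a j * e j x), (\<lambda>x. \<Sum>j\<in>J. of_real (d j) * a j * e j x)) \<in> diag d"
  using assms by (auto intro!: diagI comb_in_X simp: coef_comb)

lemma basis_in_diag: "(e j, \<lambda>x. of_real (d j) * e j x) \<in> diag d"
  using comb_in_diag[of "{j}" "\<lambda>_. 1" d] by simp

lemma diag_selfadjoint: "selfadjoint_op N X (diag d)"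
  unfolding selfadjoint_op_def
proof (intro conjI ballI allI impI)
  show "hilbert_subspace N X"
    by (rule hilbert)
next
  fix u and \<epsilon> :: real
  assume "u \<in> X" "0 < \<epsilon>"
  then obtain m a where "l2norm N (\<lambda>x. u x - (\<Sum>j<m. a j * e j x)) < \<epsilon>"
    using dense by blast
  then show "\<exists>(f, h)\<in>diag d. l2norm N (\<lambda>x. u x - f x) < \<epsilon>"
    using comb_in_diag[of "{..<m}" a d] by (intro bexI) auto
next
  show "diag d = adjoint_op N X (diag d)"
  proof (intro set_eqI iffI; clarify)
    fix u v assume uv: "(u, v) \<in> diag d"
    have "ip N h u = ip N f v" if fh: "(f, h) \<in> diag d" for f h
    proof -
      have "(\<lambda>j. coef h j * cnj (coef u j)) = (\<lambda>j. coef f j * cnj (coef v j))"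
        by (simp add: diagD(3)[OF uv] diagD(3)[OF fh] mult_ac)
      then show ?thesis
        using Parseval_ip[OF diagD(2)[OF fh] diagD(1)[OF uv]]
          Parseval_ip[OF diagD(1)[OF fh] diagD(2)[OF uv]] by (simp add: sums_unique2)
    qed
    then show "(u, v) \<in> adjoint_op N X (diag d)"
      using diagD(1,2)[OF uv] by (auto simp: adjoint_op_def)
  next
    fix u v assume "(u, v) \<in> adjoint_op N X (diag d)"
    then have uv: "u \<in> X" "v \<in> X" "\<And>f h. (f, h) \<in> diag d \<Longrightarrow> ip N h u = ip N f v"
      by (auto simp: adjoint_op_def)
    have "coef v j = of_real (d j) * coef u j" for j
    proof -
      have "of_real (d j) * ip N (e j) u = ip N (e j) v"
        using uv(3)[OF basis_in_diag, of j] by (simp add: ip_scale_left)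
      then have "cnj (ip N (e j) v) = of_real (d j) * cnj (ip N (e j) u)"
        by (metis complex_cnj_complex_of_real complex_cnj_mult)
      then show ?thesis
        by (simp add: ip_commute[of N _ "e j"])
    qed
    then show "(u, v) \<in> diag d"
      using uv by (intro diagI)
  qed
qed

text \<open>A selfadjoint operator has no proper selfadjoint extension. Testing the adjoint relation with the
  eigenvectors gives one inclusion, and passing to adjoints gives the other.\<close>

lemma selfadjoint_op_eq_diag:
  assumes S: "selfadjoint_op N X S" and eig: "\<And>j. (e j, \<lambda>x. of_real (d j) * e j x) \<in> S"
  shows "S = diag d"
proof
  show *: "S \<subseteq> diag d"
  proof clarify
    fix u v assume "(u, v) \<in> S"
    then have uv: "u \<in> X" "v \<in> X" "\<And>f h. (f, h) \<in> S \<Longrightarrow> ip N h u = ip N f v"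
      using selfadjoint_op_iff[OF S, of u v] by blast+
    have "coef v j = of_real (d j) * coef u j" for j
    proof -
      have "of_real (d j) * ip N (e j) u = ip N (e j) v"
        using uv(3)[OF eig, of j] by (simp add: ip_scale_left)
      then have "cnj (ip N (e j) v) = of_real (d j) * cnj (ip N (e j) u)"
        by (metis complex_cnj_complex_of_real complex_cnj_mult)
      then show ?thesis
        by (simp add: ip_commute[of N _ "e j"])
    qed
    then show "(u, v) \<in> diag d"
      using uv by (intro diagI)
  qed
  have "S = adjoint_op N X S"
    using S unfolding selfadjoint_op_def by (elim conjE)
  moreover have "diag d = adjoint_op N X (diag d)"
    using diag_selfadjoint[of d] unfolding selfadjoint_op_def by (elim conjE)
  ultimately show "diag d \<subseteq> S"
    using adjoint_op_antimono[OF *] by blast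
qed

text \<open>The composition has the right domain because \<open>(d j)\<^sup>2 \<le> 1 + (d j)\<^sup>4\<close>: if the coefficients of \<open>u\<close> are
  square summable with and without the weight \<open>(d j)\<^sup>2\<close>, then also with the weight \<open>d j\<close>, and they belong
  to an element of \<open>X\<close>.\<close>

lemma diag_square:
  assumes "\<And>j. 0 \<le> d j"
  shows "diag d O diag d = diag (\<lambda>j. (d j)\<^sup>2)"
proof (intro set_eqI iffI; clarify)
  fix u v w assume uv: "(u, v) \<in> diag d" and vw: "(v, w) \<in> diag d"
  show "(u, w) \<in> diag (\<lambda>j. (d j)\<^sup>2)"
    using diagD(1,2)[OF uv] diagD(2)[OF vw]
    by (intro diagI) (auto simp: diagD(3)[OF uv] diagD(3)[OF vw] power2_eq_square)
next
  fix u w assume uw: "(u, w) \<in> diag (\<lambda>j. (d j)\<^sup>2)"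
  have "summable (\<lambda>j. (cmod (coef u j))\<^sup>2 + (cmod (coef w j))\<^sup>2)"
    using Parseval[OF diagD(1)[OF uw]] Parseval[OF diagD(2)[OF uw]]
    by (intro summable_add) (auto dest: sums_summable)
  then have "summable (\<lambda>j. (cmod (of_real (d j) * coef u j))\<^sup>2)"
  proof (rule summable_comparison_test[rotated], intro exI[of _ 0] allI impI)
    fix j
    define s where "s = (d j)\<^sup>2"
    have "s \<le> 1 + s\<^sup>2"
    proof -
      have "0 \<le> (s - 1)\<^sup>2" "0 \<le> s"
        by (simp_all add: s_def)
      then show ?thesis
        unfolding power2_diff power_one mult_1_right by linarith
    qed
    then have "s * (cmod (coef u j))\<^sup>2 \<le> (1 + s\<^sup>2) * (cmod (coef u j))\<^sup>2"
      by (rule mult_right_mono) simp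
    then show "norm ((cmod (of_real (d j) * coef u j))\<^sup>2) \<le> (cmod (coef u j))\<^sup>2 + (cmod (coef w j))\<^sup>2"
      by (simp add: diagD(3)[OF uw] norm_mult power_mult_distrib s_def distrib_right norm_power)
  qed
  from Riesz_Fischer[OF this] obtain v
    where v: "v \<in> X" "\<And>j. coef v j = of_real (d j) * coef u j"
    by blast
  have "(u, v) \<in> diag d"
    using v diagD(1)[OF uw] by (intro diagI)
  moreover have "(v, w) \<in> diag d"
    using v diagD(2)[OF uw] by (intro diagI) (auto simp: diagD(3)[OF uw] power2_eq_square)
  ultimately show "(u, w) \<in> diag d O diag d"
    by blast
qed

lemma diag_positive:
  assumes "\<And>j. 0 \<le> d j"
  shows "positive_selfadjoint_op N X (diag d)"
  unfolding positive_selfadjoint_op_def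
proof (intro conjI diag_selfadjoint ballI, clarify)
  fix u v assume uv: "(u, v) \<in> diag d"
  have *: "Re (coef v j * cnj (coef u j)) = d j * (cmod (coef u j))\<^sup>2" for j
  proof -
    have "coef v j * cnj (coef u j) = of_real (d j) * (coef u j * cnj (coef u j))"
      by (simp only: diagD(3)[OF uv] mult.assoc)
    also have "\<dots> = of_real (d j * (cmod (coef u j))\<^sup>2)"
      by (simp only: complex_norm_square of_real_mult)
    finally show ?thesis
      by (simp only: Re_complex_of_real)
  qed
  have "(\<lambda>j. d j * (cmod (coef u j))\<^sup>2) sums Re (ip N v u)"
    using sums_Re[OF Parseval_ip[OF diagD(2)[OF uv] diagD(1)[OF uv]]] by (simp only: *)
  then show "0 \<le> Re (ip N v u)"
    by (rule sums_le[where f="\<lambda>_. 0" and s=0, rotated 2]) (use assms in auto)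
qed

text \<open>Uniqueness of the positive root \<open>S\<close>: it suffices that \<open>S\<close> has the eigenvectors \<open>e j\<close>. If
  \<open>g = S e\<^sub>j\<close>, then \<open>S g = d\<^sub>j\<^sup>2 e\<^sub>j\<close>, so \<open>S\<close> maps \<open>g - d\<^sub>j e\<^sub>j\<close> to \<open>- d\<^sub>j (g - d\<^sub>j e\<^sub>j)\<close>, and positivity
  forces \<open>g = d\<^sub>j e\<^sub>j\<close>.\<close>

lemma sqrt_op_diag:
  assumes d: "\<And>j. 0 < d j"
  shows "sqrt_op N X (diag (\<lambda>j. (d j)\<^sup>2)) = diag d"
  unfolding sqrt_op_def
proof (rule the_equality)
  show "positive_selfadjoint_op N X (diag d) \<and> diag d O diag d = diag (\<lambda>j. (d j)\<^sup>2)"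
    using d by (simp add: diag_positive diag_square less_imp_le)
next
  fix S assume "positive_selfadjoint_op N X S \<and> S O S = diag (\<lambda>j. (d j)\<^sup>2)"
  then have sa: "selfadjoint_op N X S" and pos: "\<And>u v. (u, v) \<in> S \<Longrightarrow> 0 \<le> Re (ip N v u)"
    and sq: "S O S = diag (\<lambda>j. (d j)\<^sup>2)"
    by (auto simp: positive_selfadjoint_op_def)
  have SI: "(u, v) \<in> S" if "u \<in> X" "v \<in> X" "\<And>f h. (f, h) \<in> S \<Longrightarrow> ip N h u = ip N f v" for u v
    using that selfadjoint_op_iff[OF sa, of u v] by blast
  have SD: "u \<in> X" "v \<in> X" "(f, h) \<in> S \<Longrightarrow> ip N h u = ip N f v" if "(u, v) \<in> S" for u v f h
    using that selfadjoint_op_iff[OF sa, of u v] by blast+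
  show "S = diag d"
  proof (rule selfadjoint_op_eq_diag[OF sa])
    fix j
    define l where "l = complex_of_real (d j)"
    have "(e j, \<lambda>x. of_real ((d j)\<^sup>2) * e j x) \<in> S O S"
      unfolding sq by (rule basis_in_diag)
    then obtain g where g: "(e j, g) \<in> S" "(g, \<lambda>x. of_real ((d j)\<^sup>2) * e j x) \<in> S"
      by auto
    \<comment> \<open>The defect \<open>g - d\<^sub>j e\<^sub>j\<close> is an eigenvector for the negative eigenvalue \<open>- d\<^sub>j\<close>.\<close>
    define h where "h = (\<lambda>x. g x - l * e j x)"
    have gX: "g \<in> X"
      using SD(2)[OF g(1)] .
    have hX: "h \<in> X"
      unfolding h_def by (intro X_diff X_scale gX basis_in)
    have Sh: "(h, \<lambda>x. - l * h x) \<in> S"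
    proof (rule SI[OF hX X_scale[OF hX]])
      fix f k assume fk: "(f, k) \<in> S"
      have L: "f \<in> L2 N" "k \<in> L2 N" "g \<in> L2 N"
        using fk gX SD(1,2)[OF fk] X_L2 by auto
      have "ip N k h = ip N k g - cnj l * ip N k (e j)"
        unfolding h_def using L by (subst ip_diff_right) (auto intro: L2_scale basis_L2 simp: ip_scale_right)
      also have "\<dots> = cnj (of_real ((d j)\<^sup>2)) * ip N f (e j) - cnj l * ip N f g"
        using SD(3)[OF g(1) fk] SD(3)[OF g(2) fk] by (simp only: ip_scale_right)
      also have "\<dots> = cnj (- l) * (ip N f g - cnj l * ip N f (e j))"
        by (simp add: l_def power2_eq_square algebra_simps)
      also have "ip N f g - cnj l * ip N f (e j) = ip N f h"
        unfolding h_def using L by (subst ip_diff_right) (auto intro: L2_scale basis_L2 simp: ip_scale_right)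
      also have "cnj (- l) * ip N f h = ip N f (\<lambda>x. - l * h x)"
        by (subst ip_scale_right) simp
      finally show "ip N k h = ip N f (\<lambda>x. - l * h x)" .
    qed
    have "0 \<le> Re (ip N (\<lambda>x. - l * h x) h)"
      by (rule pos[OF Sh])
    also have "ip N (\<lambda>x. - l * h x) h = of_real (- d j * (l2norm N h)\<^sup>2)"
      by (subst ip_scale_left) (simp add: ip_self l_def)
    finally have "(l2norm N h)\<^sup>2 \<le> 0"
      using d[of j] by (simp add: mult_le_0_iff)
    then have "AE x in N. h x = 0"
      using l2norm_eq_0_iff[OF X_L2[OF hX]] by simp
    then have AE: "AE x in N. g x = l * e j x"
      by eventually_elim (simp add: h_def)
    have "(e j, \<lambda>x. l * e j x) \<in> S"
    proof (rule SI[OF basis_in X_scale[OF basis_in]])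
      fix f k assume fk: "(f, k) \<in> S"
      have L: "f \<in> L2 N" "g \<in> L2 N" "(\<lambda>x. l * e j x) \<in> L2 N"
        using gX SD(1)[OF fk] X_L2 basis_L2 by auto
      have "ip N k (e j) = ip N f g"
        by (rule SD(3)[OF g(1) fk])
      also have "\<dots> = cnj (ip N g f)"
        by (rule ip_commute)
      also have "ip N g f = ip N (\<lambda>x. l * e j x) f"
        using AE L by (intro ip_cong_AE)
      also have "cnj \<dots> = ip N f (\<lambda>x. l * e j x)"
        by (rule ip_commute[symmetric])
      finally show "ip N k (e j) = ip N f (\<lambda>x. l * e j x)" .
    qed
    then show "(e j, \<lambda>x. of_real (d j) * e j x) \<in> S"
      by (simp add: l_def)
  qed
qed

end

section \<open>Time means\<close>

definition time_mean :: "(real \<Rightarrow> 'b::banach) \<Rightarrow> real \<Rightarrow> 'b" where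
  "time_mean h T = (1 / T) *\<^sub>R integral {0..T} h"

lemma time_mean_sum:
  assumes "finite K" "\<And>k. k \<in> K \<Longrightarrow> continuous_on {0..T} (h k)"
  shows "time_mean (\<lambda>t. \<Sum>k\<in>K. h k t) T = (\<Sum>k\<in>K. time_mean (h k) T)"
  unfolding time_mean_def using assms
  by (subst integral_sum) (auto intro: integrable_continuous_real simp: scaleR_sum_right)

lemma time_mean_mult_left:
  fixes h :: "real \<Rightarrow> complex"
  shows "time_mean (\<lambda>t. c * h t) T = c * time_mean h T"
  unfolding time_mean_def by (simp add: integral_mult_right)

lemma time_mean_const:
  assumes "0 < T"
  shows "time_mean (\<lambda>t. c) T = c"
  using assms by (simp add: time_mean_def)

lemma time_mean_bound:
  assumes "0 < T" "continuous_on {0..T} h" "\<And>t. 0 \<le> t \<Longrightarrow> norm (h t) \<le> B"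
  shows "norm (time_mean h T) \<le> B"
proof -
  have "norm (integral {0..T} h) \<le> B * (T - 0)"
    using assms by (intro integral_bound) auto
  then show ?thesis
    using assms(1) by (simp add: time_mean_def field_simps)
qed

lemma time_mean_diff:
  assumes "continuous_on {0..T} g" "continuous_on {0..T} h"
  shows "time_mean (\<lambda>t. g t - h t) T = time_mean g T - time_mean h T"
  unfolding time_mean_def using assms
  by (subst integral_diff) (auto intro: integrable_continuous_real simp: scaleR_diff_right)

lemma tendsto_time_mean_cis:
  "(time_mean (\<lambda>t. cis (\<theta> * t)) \<longlongrightarrow> (if \<theta> = 0 then 1 else 0)) at_top"
proof (cases "\<theta> = 0")
  case True
  have "\<forall>\<^sub>F T in at_top. time_mean (\<lambda>t. cis (\<theta> * t)) T = 1"
    using eventually_gt_at_top[of 0] by eventually_elim (simp add: True time_mean_const)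
  then show ?thesis
    using True by (simp add: tendsto_eventually)
next
  case False
  have "((\<lambda>T. (2 / \<bar>\<theta>\<bar>) * inverse T) \<longlongrightarrow> 0) at_top"
    by (intro tendsto_mult_right_zero tendsto_inverse_0_at_top filterlim_ident)
  moreover have "\<forall>\<^sub>F T in at_top. norm (time_mean (\<lambda>t. cis (\<theta> * t)) T) \<le> (2 / \<bar>\<theta>\<bar>) * inverse T"
    using eventually_gt_at_top[of 0]
  proof eventually_elim
    case (elim T)
    have "((\<lambda>t. cis (\<theta> * t)) has_integral
        cis (\<theta> * T) / (\<i> * of_real \<theta>) - cis (\<theta> * 0) / (\<i> * of_real \<theta>)) {0..T}"
      using elim False
      by (intro fundamental_theorem_of_calculus)
        (auto intro!: derivative_eq_intros simp: has_vector_derivative_def scaleR_conv_of_real field_simps)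
    then have "integral {0..T} (\<lambda>t. cis (\<theta> * t)) = (cis (\<theta> * T) - 1) / (\<i> * of_real \<theta>)"
      by (simp add: integral_unique diff_divide_distrib)
    moreover have "norm (cis (\<theta> * T) - 1) \<le> 2"
      using norm_triangle_ineq4[of "cis (\<theta> * T)" 1] by simp
    ultimately show ?case
      using elim by (simp add: time_mean_def norm_divide norm_mult field_simps divide_right_mono)
  qed
  ultimately show ?thesis
    using False by (simp add: Lim_null_comparison)
qed

lemma l2norm_trig_sum_sq:
  assumes "finite K" "\<And>k. k \<in> K \<Longrightarrow> \<psi> k \<in> L2 R"
  shows "complex_of_real ((l2norm R (\<lambda>x. \<Sum>k\<in>K. d k * cis (\<nu> k * t) * \<psi> k x))\<^sup>2)
    = (\<Sum>k\<in>K. \<Sum>l\<in>K. (d k * cnj (d l) * ip R (\<psi> k) (\<psi> l)) * cis ((\<nu> k - \<nu> l) * t))"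
proof -
  let ?f = "\<lambda>k x. d k * cis (\<nu> k * t) * \<psi> k x"
  have L: "?f k \<in> L2 R" if "k \<in> K" for k
    using assms that by (intro L2_scale)
  have "complex_of_real ((l2norm R (\<lambda>x. \<Sum>k\<in>K. ?f k x))\<^sup>2) = (\<Sum>k\<in>K. \<Sum>l\<in>K. ip R (?f k) (?f l))"
    unfolding ip_self[symmetric] using L by (simp add: ip_sum_left ip_sum_right L2_sum_closed)
  moreover have "ip R (?f k) (?f l) = (d k * cnj (d l) * ip R (\<psi> k) (\<psi> l)) * cis ((\<nu> k - \<nu> l) * t)" for k l
  proof -
    have "cis ((\<nu> k - \<nu> l) * t) = cis (\<nu> k * t) * cnj (cis (\<nu> l * t))"
      by (simp add: cis_cnj cis_mult algebra_simps)
    then show ?thesis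
      unfolding ip_scale_left ip_scale_right by (simp only: complex_cnj_mult mult_ac)
  qed
  ultimately show ?thesis
    by (simp only:)
qed

lemma continuous_l2norm_trig_sum:
  assumes "finite K" "\<And>k. k \<in> K \<Longrightarrow> \<psi> k \<in> L2 R"
  shows "continuous_on A (\<lambda>t. (l2norm R (\<lambda>x. \<Sum>k\<in>K. d k * cis (\<nu> k * t) * \<psi> k x))\<^sup>2)"
proof -
  have "(\<lambda>t. (l2norm R (\<lambda>x. \<Sum>k\<in>K. d k * cis (\<nu> k * t) * \<psi> k x))\<^sup>2)
    = (\<lambda>t. Re (\<Sum>k\<in>K. \<Sum>l\<in>K. (d k * cnj (d l) * ip R (\<psi> k) (\<psi> l)) * cis ((\<nu> k - \<nu> l) * t)))"
    by (simp only: l2norm_trig_sum_sq[where d=d and \<nu>=\<nu>, OF assms, symmetric] Re_complex_of_real)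
  then show ?thesis
    by (simp only:) (intro continuous_intros)
qed

text \<open>Expanding the square gives the oscillations \<open>exp(i (\<nu>\<^sub>k - \<nu>\<^sub>l) t)\<close>, whose time means tend to \<open>0\<close>
  unless \<open>\<nu>\<^sub>k = \<nu>\<^sub>l\<close>. The surviving products are those within one frequency class.\<close>

lemma tendsto_time_mean_trig_sum:
  assumes K: "finite K" and \<psi>: "\<And>k. k \<in> K \<Longrightarrow> \<psi> k \<in> L2 R"
  shows "(time_mean (\<lambda>t. (l2norm R (\<lambda>x. \<Sum>k\<in>K. d k * cis (\<nu> k * t) * \<psi> k x))\<^sup>2)
    \<longlongrightarrow> (\<Sum>\<theta>\<in>\<nu> ` K. (l2norm R (\<lambda>x. \<Sum>k | k \<in> K \<and> \<nu> k = \<theta>. d k * \<psi> k x))\<^sup>2)) at_top"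
    (is "(time_mean ?g \<longlongrightarrow> ?L) at_top")
proof -
  let ?a = "\<lambda>k l. d k * cnj (d l) * ip R (\<psi> k) (\<psi> l)"
  have cont: "continuous_on A ?g" for A
    using assms by (rule continuous_l2norm_trig_sum)
  have eq: "complex_of_real (time_mean ?g T)
      = (\<Sum>k\<in>K. \<Sum>l\<in>K. ?a k l * time_mean (\<lambda>t. cis ((\<nu> k - \<nu> l) * t)) T)" for T
  proof -
    have "integral {0..T} (complex_of_real \<circ> ?g) = complex_of_real (integral {0..T} ?g)"
      by (intro integral_linear integrable_continuous_real cont bounded_linear_of_real)
    then have "complex_of_real (time_mean ?g T) = time_mean (\<lambda>t. complex_of_real (?g t)) T"
      by (simp add: time_mean_def o_def scaleR_conv_of_real)
    also have "\<dots> = (\<Sum>k\<in>K. \<Sum>l\<in>K. ?a k l * time_mean (\<lambda>t. cis ((\<nu> k - \<nu> l) * t)) T)"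
      by (simp only: l2norm_trig_sum_sq[where d=d and \<nu>=\<nu>, OF assms])
        (simp add: time_mean_sum time_mean_mult_left K continuous_intros)
    finally show ?thesis .
  qed
  have "((\<lambda>T. complex_of_real (time_mean ?g T))
      \<longlongrightarrow> (\<Sum>k\<in>K. \<Sum>l\<in>K. ?a k l * (if \<nu> k - \<nu> l = 0 then 1 else 0))) at_top"
    unfolding eq by (intro tendsto_intros tendsto_time_mean_cis)
  also have "(\<Sum>k\<in>K. \<Sum>l\<in>K. ?a k l * (if \<nu> k - \<nu> l = 0 then 1 else 0))
      = (\<Sum>k\<in>K. \<Sum>l | l \<in> K \<and> \<nu> l = \<nu> k. ?a k l)"
    unfolding sum.inter_filter[OF K] by (intro sum.cong refl) auto
  also have "\<dots> = (\<Sum>\<theta>\<in>\<nu> ` K. \<Sum>k | k \<in> K \<and> \<nu> k = \<theta>. \<Sum>l | l \<in> K \<and> \<nu> l = \<theta>. ?a k l)"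
    using K by (subst sum.image_gen[where g=\<nu>]) (auto intro!: sum.cong)
  also have "\<dots> = (\<Sum>\<theta>\<in>\<nu> ` K. complex_of_real ((l2norm R (\<lambda>x. \<Sum>k | k \<in> K \<and> \<nu> k = \<theta>. d k * \<psi> k x))\<^sup>2))"
  proof (intro sum.cong refl)
    fix \<theta>
    have "complex_of_real ((l2norm R (\<lambda>x. \<Sum>k | k \<in> K \<and> \<nu> k = \<theta>. d k * cis (\<nu> k * 0) * \<psi> k x))\<^sup>2)
      = (\<Sum>k | k \<in> K \<and> \<nu> k = \<theta>. \<Sum>l | l \<in> K \<and> \<nu> l = \<theta>. ?a k l * cis ((\<nu> k - \<nu> l) * 0))"
      using K \<psi> by (intro l2norm_trig_sum_sq) auto
    then show "(\<Sum>k | k \<in> K \<and> \<nu> k = \<theta>. \<Sum>l | l \<in> K \<and> \<nu> l = \<theta>. ?a k l)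
      = complex_of_real ((l2norm R (\<lambda>x. \<Sum>k | k \<in> K \<and> \<nu> k = \<theta>. d k * \<psi> k x))\<^sup>2)"
      by simp
  qed
  also have "\<dots> = complex_of_real ?L"
    by simp
  finally show ?thesis
    by (simp only: tendsto_of_real_iff)
qed

text \<open>Time means do not increase the supremum norm. Hence a uniform limit may be exchanged with the limit
  of the time means, which in particular exists.\<close>

lemma time_mean_uniform_limit:
  fixes G :: "nat \<Rightarrow> real \<Rightarrow> real"
  assumes contG: "\<And>n. continuous_on {0..} (G n)" and contg: "continuous_on {0..} g"
    and unif: "\<And>n t. 0 \<le> t \<Longrightarrow> \<bar>G n t - g t\<bar> \<le> \<delta> n" and \<delta>: "\<delta> \<longlonglongrightarrow> 0"
    and lim: "\<And>n. (time_mean (G n) \<longlongrightarrow> L n) at_top"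
  obtains l where "L \<longlonglongrightarrow> l" "(time_mean g \<longlongrightarrow> l) at_top"
proof -
  have cG: "continuous_on {0..T} (G n)" and cg: "continuous_on {0..T} g" for n T
    using continuous_on_subset[OF contG[of n], of "{0..T}"] continuous_on_subset[OF contg, of "{0..T}"]
    by auto
  have bound: "\<forall>\<^sub>F T in at_top. \<bar>time_mean (G n) T - time_mean g T\<bar> \<le> \<delta> n" for n
    using eventually_gt_at_top[of 0]
  proof eventually_elim
    case (elim T)
    then show ?case
      using time_mean_bound[OF elim, of "\<lambda>t. G n t - g t" "\<delta> n"] unif
      by (simp add: time_mean_diff cG cg continuous_intros)
  qed
  have LL: "\<bar>L m - L n\<bar> \<le> \<delta> m + \<delta> n" for m n
  proof (rule tendsto_upperbound)
    show "((\<lambda>T. \<bar>time_mean (G m) T - time_mean (G n) T\<bar>) \<longlongrightarrow> \<bar>L m - L n\<bar>) at_top"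
      by (intro tendsto_intros lim)
    show "\<forall>\<^sub>F T in at_top. \<bar>time_mean (G m) T - time_mean (G n) T\<bar> \<le> \<delta> m + \<delta> n"
      using bound[of m] bound[of n] by eventually_elim linarith
  qed simp
  have "Cauchy L"
  proof (rule metric_CauchyI)
    fix r :: real assume "0 < r"
    then have "\<forall>\<^sub>F n in sequentially. \<delta> n < r / 2"
      using order_tendstoD(2)[OF \<delta>, of "r / 2"] by simp
    then obtain M where M: "\<And>n. n \<ge> M \<Longrightarrow> \<delta> n < r / 2"
      by (auto simp: eventually_sequentially)
    have "dist (L m) (L n) < r" if "m \<ge> M" "n \<ge> M" for m n
      using LL[of m n] M[OF that(1)] M[OF that(2)] by (simp add: dist_real_def)
    then show "\<exists>M. \<forall>m\<ge>M. \<forall>n\<ge>M. dist (L m) (L n) < r"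
      by blast
  qed
  then obtain l where l: "L \<longlonglongrightarrow> l"
    using convergent_eq_Cauchy by (metis convergent_def)
  moreover have "(time_mean g \<longlongrightarrow> l) at_top"
  proof (rule tendstoI)
    fix r :: real assume "0 < r"
    then have "\<forall>\<^sub>F n in sequentially. \<delta> n < r / 3" "\<forall>\<^sub>F n in sequentially. dist (L n) l < r / 3"
      using order_tendstoD(2)[OF \<delta>, of "r / 3"] tendstoD[OF l, of "r / 3"] by simp_all
    then have "\<forall>\<^sub>F n in sequentially. \<delta> n < r / 3 \<and> dist (L n) l < r / 3"
      by eventually_elim simp
    then obtain n where n: "\<delta> n < r / 3" "dist (L n) l < r / 3"
      by (auto simp: eventually_sequentially)
    have "\<forall>\<^sub>F T in at_top. dist (time_mean (G n) T) (L n) < r / 3"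
      using tendstoD[OF lim[of n], of "r / 3"] \<open>0 < r\<close> by simp
    then show "\<forall>\<^sub>F T in at_top. dist (time_mean g T) l < r"
      using bound[of n]
    proof eventually_elim
      case (elim T)
      then show ?case
        using n unfolding dist_real_def by linarith
    qed
  qed
  ultimately show ?thesis
    by (rule that)
qed

lemma L2_continuous_imp_continuous_on:
  assumes S: "S \<in> sets N" and v: "\<And>t. 0 \<le> t \<Longrightarrow> v t \<in> L2 N" and c: "L2_continuous N v"
  shows "continuous_on {0..} (\<lambda>t. l2norm (restrict_space N S) (v t))"
  unfolding continuous_on_def
proof (intro ballI)
  let ?R = "restrict_space N S"
  fix t :: real assume t: "t \<in> {0..}"
  have "((\<lambda>s. l2norm ?R (v s) - l2norm ?R (v t)) \<longlongrightarrow> 0) (at t within {0..})"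
  proof (rule Lim_null_comparison)
    show "((\<lambda>s. l2norm N (\<lambda>x. v s x - v t x)) \<longlongrightarrow> 0) (at t within {0..})"
      using c t by (simp add: L2_continuous_def)
    have "norm (l2norm ?R (v s) - l2norm ?R (v t)) \<le> l2norm N (\<lambda>x. v s x - v t x)" if "0 \<le> s" for s
    proof -
      have L: "v s \<in> L2 N" "v t \<in> L2 N"
        using v that t by auto
      have "norm (l2norm ?R (v s) - l2norm ?R (v t)) \<le> l2norm ?R (\<lambda>x. v s x - v t x)"
        using l2norm_diff_le[OF L2_restrict_space(1)[OF S L(1)] L2_restrict_space(1)[OF S L(2)]]
        by simp
      also have "\<dots> \<le> l2norm N (\<lambda>x. v s x - v t x)"
        using L2_restrict_space(2)[OF S L2_diff[OF L]] .
      finally show ?thesis .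
    qed
    then show "\<forall>\<^sub>F s in at t within {0..}.
        norm (l2norm ?R (v s) - l2norm ?R (v t)) \<le> l2norm N (\<lambda>x. v s x - v t x)"
      by (auto simp: eventually_at_filter)
  qed
  then show "((\<lambda>s. l2norm ?R (v s)) \<longlongrightarrow> l2norm ?R (v t)) (at t within {0..})"
    by (simp add: LIM_zero_iff)
qed

lemma observed_energy_eq_time_mean:
  assumes S: "S \<in> sets N" and v: "\<And>t. 0 \<le> t \<Longrightarrow> v t \<in> L2 N" and c: "L2_continuous N v"
  shows "1 / T * observed_energy N S v T = time_mean (\<lambda>t. (l2norm (restrict_space N S) (v t))\<^sup>2) T"
proof -
  have "continuous_on {0..T} (\<lambda>t. (l2norm (restrict_space N S) (v t))\<^sup>2)"
    using continuous_on_subset[OF L2_continuous_imp_continuous_on[OF assms], of "{0..T}"]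
    by (intro continuous_intros) auto
  then have "set_integrable lborel {0..T} (\<lambda>t. (l2norm (restrict_space N S) (v t))\<^sup>2)"
    by (rule borel_integrable_atLeastAtMost')
  then show ?thesis
    unfolding observed_energy_def set_lebesgue_integral_eq_l2norm[OF S] time_mean_def
    by (simp add: set_borel_integral_eq_integral)
qed

section \<open>Mean observed energy of an almost periodic motion\<close>

context orthonormal_basis
begin

text \<open>The motion \<open>v\<close> is approximated by the trigonometric sums over the first \<open>n\<close> basis functions. The
  error is bounded by the tail of \<open>\<Sum>\<^sub>j |p\<^sub>j|\<^sup>2 + |q\<^sub>j|\<^sup>2\<close>, hence uniformly in time, so the limit of the mean
  observed energy exists and is the limit of the explicit values for the sums. The assumption
  \<open>lower\<close> bounds these values frequency by frequency.\<close>

lemma asymptotic_energy: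
  assumes S: "S \<in> sets N"
    and v: "\<And>t. 0 \<le> t \<Longrightarrow> v t \<in> X" and cont: "L2_continuous N v"
    and coef: "\<And>t j. 0 \<le> t \<Longrightarrow> coef (v t) j = p j * cis (\<kappa> j * t) + q j * cis (- \<kappa> j * t)"
    and \<kappa>: "\<And>j. 0 < \<kappa> j"
    and p: "(\<lambda>j. (cmod (p j))\<^sup>2) sums P" and q: "(\<lambda>j. (cmod (q j))\<^sup>2) sums Q"
    and lower: "\<And>J c. finite J \<Longrightarrow> (\<And>i j. i \<in> J \<Longrightarrow> j \<in> J \<Longrightarrow> \<kappa> i = \<kappa> j) \<Longrightarrow>
      m * (\<Sum>j\<in>J. (cmod (c j))\<^sup>2) \<le> (l2norm (restrict_space N S) (\<lambda>x. \<Sum>j\<in>J. c j * e j x))\<^sup>2"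
  obtains L where "((\<lambda>T. 1 / T * observed_energy N S v T) \<longlongrightarrow> L) at_top" "m * (P + Q) \<le> L"
proof -
  let ?R = "restrict_space N S"
  \<comment> \<open>The Boolean distinguishes the frequencies \<open>\<kappa> j\<close> and \<open>- \<kappa> j\<close>.\<close>
  define K :: "nat \<Rightarrow> (nat \<times> bool) set" where "K n = {..<n} \<times> UNIV" for n
  define d where "d k = (case k of (j, b) \<Rightarrow> if b then p j else q j)" for k :: "nat \<times> bool"
  define \<nu> where "\<nu> k = (case k of (j, b) \<Rightarrow> if b then \<kappa> j else - \<kappa> j)" for k :: "nat \<times> bool"
  define \<psi> where "\<psi> k = e (fst k)" for k :: "nat \<times> bool"
  define V where "V n t = (\<lambda>x. \<Sum>k\<in>K n. d k * cis (\<nu> k * t) * \<psi> k x)" for n t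
  \<comment> \<open>Twice the tail of the energy; the factor comes from \<open>(a + b)\<^sup>2 \<le> 2 (a\<^sup>2 + b\<^sup>2)\<close>.\<close>
  define \<tau> where "\<tau> n = 2 * ((P - (\<Sum>j<n. (cmod (p j))\<^sup>2)) + (Q - (\<Sum>j<n. (cmod (q j))\<^sup>2)))" for n
  have finK: "finite (K n)" for n
    by (simp add: K_def)
  have sumK: "(\<Sum>k\<in>K n. h k) = (\<Sum>j<n. h (j, True) + h (j, False))"
    for n and h :: "nat \<times> bool \<Rightarrow> 'c::comm_monoid_add"
    unfolding K_def sum.cartesian_product' by (simp add: UNIV_bool add.commute)
  have V_eq: "V n t = (\<lambda>x. \<Sum>j<n. coef (v t) j * e j x)" if "0 \<le> t" for n t
    using that unfolding V_def sumK by (simp add: d_def \<nu>_def \<psi>_def coef distrib_right)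
  have V_L2: "V n t \<in> L2 N" for n t
    unfolding V_def \<psi>_def by (intro L2_sum_closed L2_scale basis_L2)
  have \<psi>R: "\<psi> k \<in> L2 ?R" for k
    unfolding \<psi>_def by (intro L2_restrict_space(1)[OF S] basis_L2)
  have v_L2: "v t \<in> L2 N" if "0 \<le> t" for t
    using v[OF that] by (rule X_L2)
  have \<tau>_lim: "\<tau> \<longlonglongrightarrow> 2 * ((P - P) + (Q - Q))"
    unfolding \<tau>_def using p q by (intro tendsto_intros) (auto simp: sums_def)
  have tail: "(l2norm N (\<lambda>x. v t x - V n t x))\<^sup>2 \<le> \<tau> n" if t: "0 \<le> t" for n t
  proof -
    have pq: "(\<lambda>j. (cmod (p (j + n)))\<^sup>2) sums (P - (\<Sum>j<n. (cmod (p j))\<^sup>2))"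
      "(\<lambda>j. (cmod (q (j + n)))\<^sup>2) sums (Q - (\<Sum>j<n. (cmod (q j))\<^sup>2))"
      using p q by (auto intro: sums_split_initial_segment)
    have sum_pq: "(\<lambda>j. 2 * ((cmod (p (j + n)))\<^sup>2 + (cmod (q (j + n)))\<^sup>2)) sums \<tau> n"
      unfolding \<tau>_def by (intro sums_mult sums_add pq)
    have sum_coef: "(\<lambda>j. (cmod (coef (v t) (j + n)))\<^sup>2) sums
        ((l2norm N (v t))\<^sup>2 - (\<Sum>j<n. (cmod (coef (v t) j))\<^sup>2))"
      by (intro sums_split_initial_segment Parseval v t)
    have le: "(cmod (coef (v t) j))\<^sup>2 \<le> 2 * ((cmod (p j))\<^sup>2 + (cmod (q j))\<^sup>2)" for j
    proof -
      have "cmod (coef (v t) j) \<le> cmod (p j) + cmod (q j)"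
        unfolding coef[OF t] by (rule order_trans[OF norm_triangle_ineq]) (simp add: norm_mult)
      then have "(cmod (coef (v t) j))\<^sup>2 \<le> (cmod (p j) + cmod (q j))\<^sup>2"
        by (intro power_mono) auto
      moreover have "0 \<le> (cmod (p j) - cmod (q j))\<^sup>2"
        by simp
      ultimately show ?thesis
        by (simp add: power2_sum power2_diff)
    qed
    have "(l2norm N (v t))\<^sup>2 - (\<Sum>j<n. (cmod (coef (v t) j))\<^sup>2) \<le> \<tau> n"
      by (rule sums_le[OF _ sum_coef sum_pq]) (rule le)
    then show ?thesis
      unfolding V_eq[OF t] by (subst l2norm_diff_partial) (auto simp: v_L2 t)
  qed
  have \<tau>_nonneg: "0 \<le> \<tau> n" for n
    using tail[of 0 n] zero_le_power2[of "l2norm N (\<lambda>x. v 0 x - V n 0 x)"] by linarith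
  define B where "B = sqrt (\<tau> 0)"
  have v_B: "l2norm N (v t) \<le> B" if t: "0 \<le> t" for t
    using tail[OF t, of 0] by (simp add: V_def K_def B_def real_le_rsqrt)
  have V_B: "l2norm N (V n t) \<le> B" if t: "0 \<le> t" for n t
  proof -
    have "(l2norm N (V n t))\<^sup>2 = (l2norm N (v t))\<^sup>2 - (l2norm N (\<lambda>x. v t x - V n t x))\<^sup>2"
      unfolding V_eq[OF t] by (subst l2norm_diff_partial) (auto simp: v_L2 t l2norm_comb)
    then have "(l2norm N (V n t))\<^sup>2 \<le> (l2norm N (v t))\<^sup>2"
      using zero_le_power2[of "l2norm N (\<lambda>x. v t x - V n t x)"] by linarith
    then have "l2norm N (V n t) \<le> l2norm N (v t)"
      by (rule power2_le_imp_le) simp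
    then show ?thesis
      using v_B[OF t] by linarith
  qed
  define E where "E n = (\<Sum>\<theta>\<in>\<nu> ` K n. (l2norm ?R (\<lambda>x. \<Sum>k | k \<in> K n \<and> \<nu> k = \<theta>. d k * \<psi> k x))\<^sup>2)" for n
  have unif: "\<bar>(l2norm ?R (V n t))\<^sup>2 - (l2norm ?R (v t))\<^sup>2\<bar> \<le> 2 * B * sqrt (\<tau> n)"
    if t: "0 \<le> t" for n t
  proof -
    let ?a = "l2norm ?R (V n t)" and ?b = "l2norm ?R (v t)"
    have "\<bar>?a - ?b\<bar> \<le> l2norm ?R (\<lambda>x. V n t x - v t x)"
      by (intro l2norm_diff_le L2_restrict_space(1)[OF S] V_L2 v_L2 t)
    also have "\<dots> \<le> l2norm N (\<lambda>x. V n t x - v t x)"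
      by (intro L2_restrict_space(2)[OF S] L2_diff V_L2 v_L2 t)
    also have "\<dots> = l2norm N (\<lambda>x. v t x - V n t x)"
      by (rule l2norm_minus_commute)
    also have "\<dots> \<le> sqrt (\<tau> n)"
      using tail[OF t] by (rule real_le_rsqrt)
    finally have ab: "\<bar>?a - ?b\<bar> \<le> sqrt (\<tau> n)" .
    have "?a \<le> B" "?b \<le> B"
      using L2_restrict_space(2)[OF S V_L2[of n t]] L2_restrict_space(2)[OF S v_L2[OF t]]
        V_B[OF t, of n] v_B[OF t] by linarith+
    then have "\<bar>?a + ?b\<bar> \<le> 2 * B"
      using l2norm_nonneg[of ?R "V n t"] l2norm_nonneg[of ?R "v t"] by linarith
    then have "\<bar>?a + ?b\<bar> * \<bar>?a - ?b\<bar> \<le> 2 * B * sqrt (\<tau> n)"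
      using ab \<tau>_nonneg[of 0] by (intro mult_mono) (auto simp: B_def)
    moreover have "?a\<^sup>2 - ?b\<^sup>2 = (?a + ?b) * (?a - ?b)"
      by (simp add: power2_eq_square algebra_simps)
    ultimately show ?thesis
      by (simp add: abs_mult)
  qed
  obtain L where L: "E \<longlonglongrightarrow> L" "(time_mean (\<lambda>t. (l2norm ?R (v t))\<^sup>2) \<longlongrightarrow> L) at_top"
  proof (rule time_mean_uniform_limit)
    show "continuous_on {0..} (\<lambda>t. (l2norm ?R (V n t))\<^sup>2)" for n
      unfolding V_def by (intro continuous_l2norm_trig_sum finK \<psi>R)
    show "continuous_on {0..} (\<lambda>t. (l2norm ?R (v t))\<^sup>2)"
      by (intro continuous_intros L2_continuous_imp_continuous_on S v_L2 cont)
    show "(time_mean (\<lambda>t. (l2norm ?R (V n t))\<^sup>2) \<longlongrightarrow> E n) at_top" for n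
      unfolding V_def E_def by (intro tendsto_time_mean_trig_sum finK \<psi>R)
    show "(\<lambda>n. 2 * B * sqrt (\<tau> n)) \<longlonglongrightarrow> 0"
      using \<tau>_lim by (intro tendsto_mult_right_zero) (auto dest: tendsto_real_sqrt)
  qed (use unif in auto)
  have "m * (\<Sum>j<n. (cmod (p j))\<^sup>2 + (cmod (q j))\<^sup>2) \<le> E n" for n
  proof -
    \<comment> \<open>All frequencies \<open>\<kappa> j\<close> are positive, so indices of equal signed frequency carry equal signs.\<close>
    have group: "m * (\<Sum>k | k \<in> K n \<and> \<nu> k = \<theta>. (cmod (d k))\<^sup>2)
        \<le> (l2norm ?R (\<lambda>x. \<Sum>k | k \<in> K n \<and> \<nu> k = \<theta>. d k * \<psi> k x))\<^sup>2" for \<theta>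
    proof -
      define J where "J = {j. j < n \<and> \<kappa> j = \<bar>\<theta>\<bar>}"
      have "k \<in> K n \<and> \<nu> k = \<theta> \<longleftrightarrow> k \<in> (\<lambda>j. (j, 0 < \<theta>)) ` J" for k
        using \<kappa>[of "fst k"] by (cases k) (auto simp: K_def \<nu>_def J_def image_iff)
      then have set: "{k. k \<in> K n \<and> \<nu> k = \<theta>} = (\<lambda>j. (j, 0 < \<theta>)) ` J"
        by blast
      have inj: "inj_on (\<lambda>j. (j, 0 < \<theta>)) J"
        by (auto intro: inj_onI)
      have "m * (\<Sum>j\<in>J. (cmod (d (j, 0 < \<theta>)))\<^sup>2)
          \<le> (l2norm ?R (\<lambda>x. \<Sum>j\<in>J. d (j, 0 < \<theta>) * e j x))\<^sup>2"
        by (rule lower) (auto simp: J_def)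
      then show ?thesis
        unfolding set sum.reindex[OF inj] by (simp add: \<psi>_def)
    qed
    have "m * (\<Sum>j<n. (cmod (p j))\<^sup>2 + (cmod (q j))\<^sup>2) = m * (\<Sum>k\<in>K n. (cmod (d k))\<^sup>2)"
      by (simp add: sumK d_def)
    also have "\<dots> = (\<Sum>\<theta>\<in>\<nu> ` K n. m * (\<Sum>k | k \<in> K n \<and> \<nu> k = \<theta>. (cmod (d k))\<^sup>2))"
      by (subst sum.image_gen[where g=\<nu>]) (auto simp: finK sum_distrib_left)
    also have "\<dots> \<le> E n"
      unfolding E_def by (intro sum_mono group)
    finally show ?thesis .
  qed
  moreover have "(\<lambda>n. m * (\<Sum>j<n. (cmod (p j))\<^sup>2 + (cmod (q j))\<^sup>2)) \<longlonglongrightarrow> m * (P + Q)"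
    using sums_add[OF p q] by (intro tendsto_intros) (simp add: sums_def)
  ultimately have "m * (P + Q) \<le> L"
    by (intro LIMSEQ_le[OF _ L(1)]) auto
  moreover have "((\<lambda>T. 1 / T * observed_energy N S v T) \<longlongrightarrow> L) at_top"
    using L(2) by (simp only: observed_energy_eq_time_mean[OF S v_L2 cont])
  ultimately show ?thesis
    by (rule that[rotated])
qed

end

section \<open>Harmonic motions\<close>

text \<open>The function \<open>f t * cis (- k * t)\<close> has derivative zero.\<close>

lemma oscillation_unique:
  fixes f :: "real \<Rightarrow> complex"
  assumes "\<And>t. 0 \<le> t \<Longrightarrow> (f has_vector_derivative \<i> * of_real k * f t) (at t within {0..})"
    and t: "0 \<le> t"
  shows "f t = f 0 * cis (k * t)"
proof -
  have "((\<lambda>t. f t * cis (- k * t)) has_vector_derivative 0) (at s within {0..})" if "s \<in> {0..}" for s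
  proof -
    have "((\<lambda>t. cis (- k * t)) has_vector_derivative - \<i> * of_real k * cis (- k * s)) (at s within {0..})"
      unfolding has_vector_derivative_def
      by (auto intro!: derivative_eq_intros simp: scaleR_conv_of_real algebra_simps)
    from has_vector_derivative_mult[OF assms(1)[of s] this] that
    show ?thesis
      by (simp add: algebra_simps)
  qed
  then have "\<exists>c. \<forall>s\<in>{0..}. f s * cis (- k * s) = c"
    by (intro has_derivative_zero_constant) (simp_all add: has_vector_derivative_def)
  then obtain c where c: "\<And>t. t \<in> {0..} \<Longrightarrow> f t * cis (- k * t) = c"
    by blast
  have "f t = f t * (cis (- k * t) * cis (k * t))"
    by (simp add: cis_mult)
  also have "\<dots> = c * cis (k * t)"
    using c[of t] t by (simp only: mult.assoc[symmetric] atLeast_iff)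
  also have "c = f 0"
    using c[of 0] by simp
  finally show ?thesis .
qed

text \<open>The combinations \<open>b + i l a\<close> and \<open>b - i l a\<close> diagonalise the first order system of \<open>a\<close> and \<open>b\<close>:
  they oscillate with the frequencies \<open>l\<close> and \<open>- l\<close>.\<close>

lemma harmonic_oscillator:
  fixes a b :: "real \<Rightarrow> complex"
  assumes a: "\<And>t. 0 \<le> t \<Longrightarrow> (a has_vector_derivative b t) (at t within {0..})"
    and b: "\<And>t. 0 \<le> t \<Longrightarrow> (b has_vector_derivative - (of_real (l\<^sup>2) * a t)) (at t within {0..})"
    and t: "0 \<le> t"
  shows "b t = (b 0 + \<i> * of_real l * a 0) / 2 * cis (l * t) + (b 0 - \<i> * of_real l * a 0) / 2 * cis (- l * t)"
proof -
  have plus: "b t + \<i> * of_real l * a t = (b 0 + \<i> * of_real l * a 0) * cis (l * t)"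
  proof (rule oscillation_unique[OF _ t])
    fix s :: real assume "0 \<le> s"
    then have "((\<lambda>s. b s + (\<i> * of_real l) * a s) has_vector_derivative
        - (of_real (l\<^sup>2) * a s) + (\<i> * of_real l) * b s) (at s within {0..})"
      by (intro has_vector_derivative_add has_vector_derivative_mult_right a b)
    moreover have "- (of_real (l\<^sup>2) * a s) + (\<i> * of_real l) * b s
        = \<i> * of_real l * (b s + \<i> * of_real l * a s)"
      by (simp add: algebra_simps power2_eq_square)
    ultimately show "((\<lambda>s. b s + \<i> * of_real l * a s) has_vector_derivative
        \<i> * of_real l * (b s + \<i> * of_real l * a s)) (at s within {0..})"
      by (simp only:)
  qed
  have minus: "b t - \<i> * of_real l * a t = (b 0 - \<i> * of_real l * a 0) * cis (- l * t)"
  proof (rule oscillation_unique[OF _ t])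
    fix s :: real assume "0 \<le> s"
    then have "((\<lambda>s. b s - (\<i> * of_real l) * a s) has_vector_derivative
        - (of_real (l\<^sup>2) * a s) - (\<i> * of_real l) * b s) (at s within {0..})"
      by (intro has_vector_derivative_diff has_vector_derivative_mult_right a b)
    moreover have "- (of_real (l\<^sup>2) * a s) - (\<i> * of_real l) * b s
        = \<i> * of_real (- l) * (b s - \<i> * of_real l * a s)"
      by (simp add: algebra_simps power2_eq_square)
    ultimately show "((\<lambda>s. b s - \<i> * of_real l * a s) has_vector_derivative
        \<i> * of_real (- l) * (b s - \<i> * of_real l * a s)) (at s within {0..})"
      by (simp only:)
  qed
  have "b t = ((b t + \<i> * of_real l * a t) + (b t - \<i> * of_real l * a t)) / 2"
    by simp
  then show ?thesis
    unfolding plus minus by (simp only: add_divide_distrib[of "_ * _"] times_divide_eq_left)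
qed

lemma harmonic_L2_continuous:
  "L2_continuous N (\<lambda>t x. a * cis (k * t) * u x)"
  unfolding L2_continuous_def
proof (intro allI impI)
  fix t :: real assume "0 \<le> t"
  have "continuous_on {0..} (\<lambda>s. cmod (a * cis (k * s) - a * cis (k * t)) * l2norm N u)"
    by (intro continuous_intros)
  then have "((\<lambda>s. cmod (a * cis (k * s) - a * cis (k * t)) * l2norm N u)
      \<longlongrightarrow> cmod (a * cis (k * t) - a * cis (k * t)) * l2norm N u) (at t within {0..})"
    unfolding continuous_on_def by (rule bspec) (use \<open>0 \<le> t\<close> in simp)
  then show "((\<lambda>s. l2norm N (\<lambda>x. a * cis (k * s) * u x - a * cis (k * t) * u x)) \<longlongrightarrow> 0) (at t within {0..})"
    by (simp add: left_diff_distrib[symmetric] l2norm_scale)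
qed

lemma harmonic_observed_energy:
  assumes S: "S \<in> sets N" and u: "u \<in> L2 N" and T: "0 < T"
  shows "1 / T * observed_energy N S (\<lambda>t x. a * cis (k * t) * u x) T
    = (cmod a)\<^sup>2 * (l2norm (restrict_space N S) u)\<^sup>2"
proof -
  have "1 / T * observed_energy N S (\<lambda>t x. a * cis (k * t) * u x) T
      = time_mean (\<lambda>t. (l2norm (restrict_space N S) (\<lambda>x. a * cis (k * t) * u x))\<^sup>2) T"
    using u by (intro observed_energy_eq_time_mean S harmonic_L2_continuous L2_scale)
  also have "\<dots> = time_mean (\<lambda>t. (cmod a)\<^sup>2 * (l2norm (restrict_space N S) u)\<^sup>2) T"
    by (simp add: l2norm_scale norm_mult power_mult_distrib)
  finally show ?thesis
    by (simp only: time_mean_const[OF T])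
qed

context orthonormal_basis
begin

section \<open>Solutions of the evolution equations\<close>

lemma coef_has_vector_derivative:
  assumes C1: "C1_with_derivative N X y v" and t: "0 \<le> t"
  shows "((\<lambda>s. coef (y s) j) has_vector_derivative coef (v t) j) (at t within {0..})"
  unfolding has_vector_derivative_def has_derivative_iff_norm
proof (intro conjI bounded_linear_scaleR_left)
  have X: "y s \<in> X" "v s \<in> X" if "0 \<le> s" for s
    using C1 that by (auto simp: C1_with_derivative_def)
  have lim: "((\<lambda>s. l2norm N (\<lambda>x. (y s x - y t x) / of_real (s - t) - v t x)) \<longlongrightarrow> 0) (at t within {0..})"
    using C1 t by (auto simp: C1_with_derivative_def)
  show "((\<lambda>s. norm (coef (y s) j - coef (y t) j - (s - t) *\<^sub>R coef (v t) j) / norm (s - t)) \<longlongrightarrow> 0)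
      (at t within {0..})"
  proof (rule Lim_null_comparison[OF _ lim])
    have "norm (norm (coef (y s) j - coef (y t) j - (s - t) *\<^sub>R coef (v t) j) / norm (s - t))
        \<le> l2norm N (\<lambda>x. (y s x - y t x) / of_real (s - t) - v t x)" if s: "0 \<le> s" "s \<noteq> t" for s
    proof -
      let ?w = "\<lambda>x. (1 / of_real (s - t)) * (y s x - y t x) - v t x"
      have L: "(\<lambda>x. y s x - y t x) \<in> L2 N" "v t \<in> L2 N" "y s \<in> L2 N" "y t \<in> L2 N"
        using X t s by (auto intro: X_L2 L2_diff)
      have "coef ?w j = (1 / of_real (s - t)) * (coef (y s) j - coef (y t) j) - coef (v t) j"
        by (simp only: ip_diff_left ip_scale_left L L2_scale basis_L2)
      also have "\<dots> = (coef (y s) j - coef (y t) j - (s - t) *\<^sub>R coef (v t) j) / of_real (s - t)"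
        using s by (simp add: scaleR_conv_of_real field_simps)
      finally have "norm (norm (coef (y s) j - coef (y t) j - (s - t) *\<^sub>R coef (v t) j) / norm (s - t))
          = norm (coef ?w j)"
        by (simp add: norm_divide flip: of_real_diff)
      also have "\<dots> \<le> l2norm N ?w * l2norm N (e j)"
        by (intro Cauchy_Schwarz_L2 L2_diff L2_scale L basis_L2)
      also have "l2norm N (e j) = 1"
        using ip_self[of N "e j"] l2norm_nonneg[of N "e j"]
        by (simp add: orthonormal power2_eq_1_iff flip: of_real_power)
      finally show ?thesis
        by simp
    qed
    then show "\<forall>\<^sub>F s in at t within {0..}.
        norm (norm (coef (y s) j - coef (y t) j - (s - t) *\<^sub>R coef (v t) j) / norm (s - t))
        \<le> l2norm N (\<lambda>x. (y s x - y t x) / of_real (s - t) - v t x)"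
      by (auto simp: eventually_at_filter)
  qed
qed

text \<open>Taking \<open>e j\<close> as the test function in the weak form of the equation shows that the coefficients of the
  solution and of its velocity solve the equation of a harmonic oscillator.\<close>

lemma wave_velocity_coef:
  assumes lam: "\<And>j. 0 < lam j" and y0: "y0 \<in> X" and y1: "y1 \<in> X"
    and sol: "wave_solution N X (diag (\<lambda>j. (lam j)\<^sup>2)) y0 y1 y v" and t: "0 \<le> t"
  shows "coef (v t) j = (coef y1 j + \<i> * of_real (lam j) * coef y0 j) / 2 * cis (lam j * t)
    + (coef y1 j - \<i> * of_real (lam j) * coef y0 j) / 2 * cis (- lam j * t)"
proof -
  have C1: "C1_with_derivative N X y v" and y_init: "AE x in N. y 0 x = y0 x"
    and v_init: "AE x in N. v 0 x = y1 x"
    using sol by (auto simp: wave_solution_def)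
  from sol obtain r where r: "\<And>t. 0 \<le> t \<Longrightarrow> (y t, r t) \<in> diag lam"
    and weak: "\<And>w s t. (w, s) \<in> diag lam \<Longrightarrow> 0 \<le> t \<Longrightarrow>
      ((\<lambda>\<tau>. ip N (v \<tau>) w) has_vector_derivative - ip N (r t) s) (at t within {0..})"
    unfolding wave_solution_def sqrt_op_diag[of lam, OF lam] by fast
  have "((\<lambda>s. coef (v s) j) has_vector_derivative - (of_real ((lam j)\<^sup>2) * coef (y t) j)) (at t within {0..})"
    if "0 \<le> t" for t
    using weak[OF basis_in_diag that, of j]
    by (simp add: ip_scale_right diagD(3)[OF r[OF that]] power2_eq_square mult.assoc)
  from harmonic_oscillator[OF coef_has_vector_derivative[OF C1] this t]
  have "coef (v t) j = (coef (v 0) j + \<i> * of_real (lam j) * coef (y 0) j) / 2 * cis (lam j * t)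
    + (coef (v 0) j - \<i> * of_real (lam j) * coef (y 0) j) / 2 * cis (- lam j * t)" .
  moreover have "y 0 \<in> X" "v 0 \<in> X"
    using C1 by (auto simp: C1_with_derivative_def)
  then have "coef (y 0) j = coef y0 j" "coef (v 0) j = coef y1 j"
    using y0 y1 y_init v_init by (auto intro!: ip_cong_AE X_L2 basis_L2)
  ultimately show ?thesis
    by simp
qed

lemma schroedinger_velocity_coef:
  assumes y0: "(y0, f0) \<in> diag (\<lambda>j. (lam j)\<^sup>2)"
    and sol: "schroedinger_solution N X (diag (\<lambda>j. (lam j)\<^sup>2)) y0 y v" and t: "0 \<le> t"
  shows "coef (v t) j = \<i> * coef f0 j * cis ((lam j)\<^sup>2 * t)"
proof -
  have C1: "C1_with_derivative N X y v" and y_init: "AE x in N. y 0 x = y0 x"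
    using sol by (auto simp: schroedinger_solution_def)
  from sol obtain f where f: "\<And>t. 0 \<le> t \<Longrightarrow> (y t, f t) \<in> diag (\<lambda>j. (lam j)\<^sup>2)"
    and eq: "\<And>t. 0 \<le> t \<Longrightarrow> AE x in N. \<i> * v t x = - f t x"
    unfolding schroedinger_solution_def by fast
  have v: "coef (v t) j = \<i> * of_real ((lam j)\<^sup>2) * coef (y t) j" if t: "0 \<le> t" for t
  proof -
    have L: "v t \<in> L2 N" "f t \<in> L2 N"
      using C1 t f[OF t] by (auto simp: C1_with_derivative_def diag_def intro: X_L2)
    have "AE x in N. v t x = \<i> * f t x"
      using eq[OF t]
    proof eventually_elim
      case (elim x)
      have "v t x = - \<i> * (\<i> * v t x)"
        by simp
      then show ?case
        by (simp only: elim) simp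
    qed
    then have "coef (v t) j = coef (\<lambda>x. \<i> * f t x) j"
      using L by (intro ip_cong_AE basis_L2 L2_scale)
    then show ?thesis
      by (simp add: ip_scale_left diagD(3)[OF f[OF t]])
  qed
  have "((\<lambda>s. coef (y s) j) has_vector_derivative \<i> * of_real ((lam j)\<^sup>2) * coef (y s) j) (at s within {0..})"
    if "0 \<le> s" for s
    using coef_has_vector_derivative[OF C1 that, of j] unfolding v[OF that] .
  from oscillation_unique[OF this t]
  have "coef (y t) j = coef (y 0) j * cis ((lam j)\<^sup>2 * t)" .
  moreover have "y 0 \<in> X"
    using C1 by (auto simp: C1_with_derivative_def)
  then have "coef (y 0) j = coef y0 j"
    using y_init diagD(1)[OF y0] by (intro ip_cong_AE X_L2 basis_L2)
  ultimately show ?thesis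
    using v[OF t] diagD(3)[OF y0, of j] by (simp add: mult_ac)
qed

text \<open>In the following \<open>u\<close> will be an eigenfunction, so that \<open>t \<mapsto> cis (k * t) * u\<close> solves the wave equation if
  \<open>k\<close> is the root of its eigenvalue and the Schroedinger equation if \<open>k\<close> is the eigenvalue.\<close>

lemma harmonic_C1:
  assumes "u \<in> X"
  shows "C1_with_derivative N X (\<lambda>t x. cis (k * t) * u x) (\<lambda>t x. (\<i> * of_real k) * cis (k * t) * u x)"
  unfolding C1_with_derivative_def
proof (intro conjI allI impI harmonic_L2_continuous X_scale assms)
  fix t :: real
  have "((\<lambda>t. cis (k * t)) has_vector_derivative (\<i> * of_real k) * cis (k * t)) (at t within {0..})"
    unfolding has_vector_derivative_def
    by (auto intro!: derivative_eq_intros simp: scaleR_conv_of_real algebra_simps)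
  then have "((\<lambda>s. norm (cis (k * s) - cis (k * t) - (s - t) *\<^sub>R ((\<i> * of_real k) * cis (k * t))) / norm (s - t))
      \<longlongrightarrow> 0) (at t within {0..})"
    unfolding has_vector_derivative_def has_derivative_iff_norm by blast
  then have lim: "((\<lambda>s. norm (cis (k * s) - cis (k * t) - (s - t) *\<^sub>R ((\<i> * of_real k) * cis (k * t))) / norm (s - t)
      * l2norm N u) \<longlongrightarrow> 0) (at t within {0..})"
    by (rule tendsto_mult_left_zero)
  have "l2norm N (\<lambda>x. (cis (k * s) * u x - cis (k * t) * u x) / of_real (s - t) - (\<i> * of_real k) * cis (k * t) * u x)
     = norm (cis (k * s) - cis (k * t) - (s - t) *\<^sub>R ((\<i> * of_real k) * cis (k * t))) / norm (s - t) * l2norm N u"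
    if "s \<noteq> t" for s
  proof -
    let ?c = "(cis (k * s) - cis (k * t) - (s - t) *\<^sub>R ((\<i> * of_real k) * cis (k * t))) / of_real (s - t)"
    have "(cis (k * s) * u x - cis (k * t) * u x) / of_real (s - t) - (\<i> * of_real k) * cis (k * t) * u x
        = ?c * u x" for x
      using that by (simp add: scaleR_conv_of_real field_simps)
    then show ?thesis
      by (simp only: l2norm_scale) (simp add: norm_divide flip: of_real_diff)
  qed
  then show "((\<lambda>s. l2norm N (\<lambda>x. (cis (k * s) * u x - cis (k * t) * u x) / of_real (s - t)
      - (\<i> * of_real k) * cis (k * t) * u x)) \<longlongrightarrow> 0) (at t within {0..})"
    by (intro Lim_transform_eventually[OF lim]) (auto simp: eventually_at_filter)
qed

section \<open>Observation of eigenfunctions\<close>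

text \<open>The weights \<open>\<kappa>\<close> enter only through their level sets, which are the same for the roots of the
  eigenvalues and for the eigenvalues. Finite sums suffice since they are dense in each eigenspace.\<close>

definition eigen_ratios :: "(nat \<Rightarrow> real) \<Rightarrow> 'a set \<Rightarrow> real set" where
  "eigen_ratios \<kappa> S =
     {(l2norm (restrict_space N S) (\<lambda>x. \<Sum>j\<in>J. c j * e j x))\<^sup>2 / (\<Sum>j\<in>J. (cmod (c j))\<^sup>2)
      | J c. finite J \<and> (\<forall>i\<in>J. \<forall>j\<in>J. \<kappa> i = \<kappa> j) \<and> (\<exists>j\<in>J. c j \<noteq> 0)}"

lemma eigen_ratiosI:
  assumes "finite J" "\<And>i j. i \<in> J \<Longrightarrow> j \<in> J \<Longrightarrow> \<kappa> i = \<kappa> j" "\<exists>j\<in>J. c j \<noteq> 0"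
  shows "(l2norm (restrict_space N S) (\<lambda>x. \<Sum>j\<in>J. c j * e j x))\<^sup>2 / (\<Sum>j\<in>J. (cmod (c j))\<^sup>2)
    \<in> eigen_ratios \<kappa> S"
  unfolding eigen_ratios_def mem_Collect_eq
  using assms by (intro exI[of _ J] exI[of _ c] conjI refl ballI)

lemma eigen_ratios_nonneg: "r \<in> eigen_ratios \<kappa> S \<Longrightarrow> 0 \<le> r"
  by (auto simp: eigen_ratios_def intro!: divide_nonneg_nonneg sum_nonneg)

lemma eigen_ratios_nonempty: "eigen_ratios \<kappa> S \<noteq> {}"
  using eigen_ratiosI[of "{0}" \<kappa> "\<lambda>_. 1" S] by auto

lemma Inf_eigen_ratios_nonneg: "0 \<le> Inf (eigen_ratios \<kappa> S)"
  using eigen_ratios_nonempty eigen_ratios_nonneg by (rule cInf_greatest)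

lemma Inf_eigen_ratios_le:
  assumes "finite J" "\<And>i j. i \<in> J \<Longrightarrow> j \<in> J \<Longrightarrow> \<kappa> i = \<kappa> j"
  shows "Inf (eigen_ratios \<kappa> S) * (\<Sum>j\<in>J. (cmod (c j))\<^sup>2)
    \<le> (l2norm (restrict_space N S) (\<lambda>x. \<Sum>j\<in>J. c j * e j x))\<^sup>2"
proof (cases "\<exists>j\<in>J. c j \<noteq> 0")
  case True
  then obtain j where "j \<in> J" "c j \<noteq> 0"
    by blast
  then have "0 < (\<Sum>j\<in>J. (cmod (c j))\<^sup>2)"
    using assms(1) by (intro sum_pos2[of J j]) auto
  moreover have "Inf (eigen_ratios \<kappa> S)
      \<le> (l2norm (restrict_space N S) (\<lambda>x. \<Sum>j\<in>J. c j * e j x))\<^sup>2 / (\<Sum>j\<in>J. (cmod (c j))\<^sup>2)"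
  proof (rule cInf_lower)
    show "(l2norm (restrict_space N S) (\<lambda>x. \<Sum>j\<in>J. c j * e j x))\<^sup>2 / (\<Sum>j\<in>J. (cmod (c j))\<^sup>2)
        \<in> eigen_ratios \<kappa> S"
      using assms True by (intro eigen_ratiosI)
    show "bdd_below (eigen_ratios \<kappa> S)"
      using eigen_ratios_nonneg by (rule bdd_belowI)
  qed
  ultimately show ?thesis
    by (simp add: field_simps)
next
  case False
  then have "(\<Sum>j\<in>J. (cmod (c j))\<^sup>2) = 0"
    by (intro sum.neutral) auto
  then show ?thesis
    by simp
qed

section \<open>The time asymptotic observability constants\<close>

text \<open>The three infima are compared with \<open>eigen_ratios\<close> in this form: each of the three sets contains
  the scaled quotients of eigenfunctions, and none of its elements is below the scaled infimum of these
  quotients.\<close>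

lemma Inf_scaled_subset:
  fixes S R :: "real set"
  assumes R: "R \<noteq> {}" and h: "0 < h"
    and sub: "\<And>r. r \<in> R \<Longrightarrow> h * r \<in> S" and lower: "\<And>s. s \<in> S \<Longrightarrow> h * Inf R \<le> s"
  shows "Inf S = h * Inf R"
proof (rule antisym)
  have bdd: "bdd_below S"
    using lower by (rule bdd_belowI)
  have "Inf S / h \<le> Inf R"
  proof (rule cInf_greatest[OF R])
    fix r assume "r \<in> R"
    then have "Inf S \<le> h * r"
      using sub bdd by (intro cInf_lower) auto
    then show "Inf S / h \<le> r"
      using h by (simp add: field_simps)
  qed
  then show "Inf S \<le> h * Inf R"
    using h by (simp add: field_simps)
  have "S \<noteq> {}"
    using R sub by blast
  then show "h * Inf R \<le> Inf S"
    using lower by (rule cInf_greatest)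
qed

text \<open>By the parallelogram identity the amplitudes of the positive and the negative frequencies satisfy
  \<open>|p\<^sub>j|\<^sup>2 + |q\<^sub>j|\<^sup>2 = (\<lambda>\<^sub>j\<^sup>2 |a\<^sub>j|\<^sup>2 + |b\<^sub>j|\<^sup>2) / 2\<close>, where \<open>a\<^sub>j\<close> and \<open>b\<^sub>j\<close> are the coefficients of the initial
  position and velocity. This is the origin of the factor \<open>1 / 2\<close>.\<close>

lemma wave_ratio_ge:
  assumes S: "S \<in> sets N" and lam: "\<And>j. 0 < lam j"
    and y0: "(y0, r0) \<in> diag lam" and y1: "y1 \<in> X"
    and nz: "\<not> ((AE x in N. y0 x = 0) \<and> (AE x in N. y1 x = 0))"
    and sol: "wave_solution N X (diag (\<lambda>j. (lam j)\<^sup>2)) y0 y1 y v"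
  shows "1 / 2 * Inf (eigen_ratios lam S)
    \<le> Lim at_top (\<lambda>T. 1 / T * (observed_energy N S v T / ((l2norm N r0)\<^sup>2 + (l2norm N y1)\<^sup>2)))"
proof -
  let ?m = "Inf (eigen_ratios lam S)"
  define E where "E = (l2norm N r0)\<^sup>2 + (l2norm N y1)\<^sup>2"
  have X: "y0 \<in> X" "r0 \<in> X"
    using diagD(1,2)[OF y0] .
  have E: "0 < E"
  proof (rule ccontr)
    assume "\<not> 0 < E"
    then have "l2norm N r0 = 0" "l2norm N y1 = 0"
      using zero_le_power2[of "l2norm N r0"] zero_le_power2[of "l2norm N y1"]
      by (auto simp: E_def not_less sum_power2_le_zero_iff)
    then have AE0: "AE x in N. r0 x = 0" and AE1: "AE x in N. y1 x = 0"
      using l2norm_eq_0_iff[OF X_L2[OF X(2)]] l2norm_eq_0_iff[OF X_L2[OF y1]] by auto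
    have "AE x in N. y0 x = 0"
    proof (rule coef_eq_imp_AE[OF X(1) X_zero])
      fix j
      have "coef r0 j = coef (\<lambda>x. 0) j"
        using AE0 X by (intro ip_cong_AE X_L2 X_zero basis_L2)
      then show "coef y0 j = coef (\<lambda>x. 0) j"
        using diagD(3)[OF y0, of j] lam[of j] by (simp add: ip_def)
    qed
    then show False
      using nz AE1 by blast
  qed
  define p where "p j = (coef y1 j + \<i> * of_real (lam j) * coef y0 j) / 2" for j
  define q where "q j = (coef y1 j - \<i> * of_real (lam j) * coef y0 j) / 2" for j
  have pq: "(cmod (p j))\<^sup>2 + (cmod (q j))\<^sup>2 = 1 / 2 * ((cmod (coef r0 j))\<^sup>2 + (cmod (coef y1 j))\<^sup>2)" for j
  proof -
    have "(cmod ((b + \<i> * a) / 2))\<^sup>2 + (cmod ((b - \<i> * a) / 2))\<^sup>2 = 1 / 2 * ((cmod a)\<^sup>2 + (cmod b)\<^sup>2)" for a b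
      unfolding cmod_power2 by (simp add: power2_eq_square field_simps)
    then show ?thesis
      unfolding p_def q_def diagD(3)[OF y0, of j] mult.assoc .
  qed
  have pq_sums: "(\<lambda>j. (cmod (p j))\<^sup>2 + (cmod (q j))\<^sup>2) sums (1 / 2 * E)"
    unfolding pq E_def by (intro sums_mult sums_add Parseval X y1)
  have "summable (\<lambda>j. (cmod (p j))\<^sup>2)" "summable (\<lambda>j. (cmod (q j))\<^sup>2)"
    by (rule summable_comparison_test'[OF sums_summable[OF pq_sums], of 0], simp)+
  then obtain P Q where P: "(\<lambda>j. (cmod (p j))\<^sup>2) sums P" and Q: "(\<lambda>j. (cmod (q j))\<^sup>2) sums Q"
    by (auto simp: summable_def)
  have PQ: "P + Q = 1 / 2 * E"
    using sums_unique2[OF sums_add[OF P Q] pq_sums] .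
  have C1: "C1_with_derivative N X y v"
    using sol by (simp add: wave_solution_def)
  obtain L where L: "((\<lambda>T. 1 / T * observed_energy N S v T) \<longlongrightarrow> L) at_top" "?m * (P + Q) \<le> L"
  proof (rule asymptotic_energy[OF S _ _ _ lam P Q])
    show "v t \<in> X" if "0 \<le> t" for t
      using C1 that by (simp add: C1_with_derivative_def)
    show "L2_continuous N v"
      using C1 by (simp add: C1_with_derivative_def)
    show "coef (v t) j = p j * cis (lam j * t) + q j * cis (- lam j * t)" if "0 \<le> t" for t j
      unfolding p_def q_def by (rule wave_velocity_coef[OF lam X(1) y1 sol that])
    show "?m * (\<Sum>j\<in>J. (cmod (c j))\<^sup>2) \<le> (l2norm (restrict_space N S) (\<lambda>x. \<Sum>j\<in>J. c j * e j x))\<^sup>2"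
      if "finite J" "\<And>i j. i \<in> J \<Longrightarrow> j \<in> J \<Longrightarrow> lam i = lam j" for J c
      using that by (rule Inf_eigen_ratios_le)
  qed
  have "((\<lambda>T. 1 / T * observed_energy N S v T / E) \<longlongrightarrow> L / E) at_top"
    using E by (intro tendsto_divide L tendsto_const) auto
  then have "Lim at_top (\<lambda>T. 1 / T * (observed_energy N S v T / E)) = L / E"
    by (intro tendsto_Lim) auto
  moreover have "1 / 2 * ?m \<le> L / E"
    using L(2) E unfolding PQ by (simp add: field_simps)
  ultimately show ?thesis
    unfolding E_def by simp
qed

lemma schroedinger_ratio_ge:
  assumes S: "S \<in> sets N" and lam: "\<And>j. 0 < lam j"
    and y0: "(y0, f0) \<in> diag (\<lambda>j. (lam j)\<^sup>2)" and nz: "\<not> (AE x in N. y0 x = 0)"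
    and sol: "schroedinger_solution N X (diag (\<lambda>j. (lam j)\<^sup>2)) y0 y v"
  shows "Inf (eigen_ratios lam S)
    \<le> Lim at_top (\<lambda>T. 1 / T * (observed_energy N S v T / (l2norm N f0)\<^sup>2))"
proof -
  let ?m = "Inf (eigen_ratios lam S)"
  define E where "E = (l2norm N f0)\<^sup>2"
  have X: "y0 \<in> X" "f0 \<in> X"
    using diagD(1,2)[OF y0] .
  have E: "0 < E"
  proof (rule ccontr)
    assume "\<not> 0 < E"
    then have "l2norm N f0 = 0"
      by (simp add: E_def)
    then have AE0: "AE x in N. f0 x = 0"
      using l2norm_eq_0_iff[OF X_L2[OF X(2)]] by auto
    have "AE x in N. y0 x = 0"
    proof (rule coef_eq_imp_AE[OF X(1) X_zero])
      fix j
      have "coef f0 j = coef (\<lambda>x. 0) j"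
        using AE0 X by (intro ip_cong_AE X_L2 X_zero basis_L2)
      then show "coef y0 j = coef (\<lambda>x. 0) j"
        using diagD(3)[OF y0, of j] lam[of j] by (simp add: ip_def)
    qed
    then show False
      using nz by blast
  qed
  have C1: "C1_with_derivative N X y v"
    using sol by (simp add: schroedinger_solution_def)
  have P: "(\<lambda>j. (cmod (\<i> * coef f0 j))\<^sup>2) sums E"
    using Parseval[OF X(2)] by (simp add: norm_mult E_def)
  have Q: "(\<lambda>j. (cmod (0::complex))\<^sup>2) sums 0"
    by simp
  have lam2: "0 < (lam j)\<^sup>2" for j
    using lam[of j] by simp
  obtain L where L: "((\<lambda>T. 1 / T * observed_energy N S v T) \<longlongrightarrow> L) at_top" "?m * (E + 0) \<le> L"
  proof (rule asymptotic_energy[OF S _ _ _ lam2 P Q])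
    show "v t \<in> X" if "0 \<le> t" for t
      using C1 that by (simp add: C1_with_derivative_def)
    show "L2_continuous N v"
      using C1 by (simp add: C1_with_derivative_def)
    show "coef (v t) j = \<i> * coef f0 j * cis ((lam j)\<^sup>2 * t) + 0 * cis (- (lam j)\<^sup>2 * t)" if "0 \<le> t" for t j
      using schroedinger_velocity_coef[OF y0 sol that] by simp
    show "?m * (\<Sum>j\<in>J. (cmod (c j))\<^sup>2) \<le> (l2norm (restrict_space N S) (\<lambda>x. \<Sum>j\<in>J. c j * e j x))\<^sup>2"
      if "finite J" "\<And>i j. i \<in> J \<Longrightarrow> j \<in> J \<Longrightarrow> (lam i)\<^sup>2 = (lam j)\<^sup>2" for J c
    proof (rule Inf_eigen_ratios_le[OF that(1)])
      fix i j assume "i \<in> J" "j \<in> J"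
      then show "lam i = lam j"
        using that(2)[of i j] lam[of i] lam[of j] by (simp add: power2_eq_iff_nonneg)
    qed
  qed
  have "((\<lambda>T. 1 / T * observed_energy N S v T / E) \<longlongrightarrow> L / E) at_top"
    using E by (intro tendsto_divide L tendsto_const) auto
  then have "Lim at_top (\<lambda>T. 1 / T * (observed_energy N S v T / E)) = L / E"
    by (intro tendsto_Lim) auto
  moreover have "?m \<le> L / E"
    using L(2) E by (simp add: field_simps)
  ultimately show ?thesis
    unfolding E_def by simp
qed

lemma eigen_combination:
  assumes "finite J" "\<And>i j. i \<in> J \<Longrightarrow> j \<in> J \<Longrightarrow> lam i = lam j" "k \<in> J" "c k \<noteq> 0"
  defines "u \<equiv> \<lambda>x. \<Sum>j\<in>J. c j * e j x"
  shows "(u, \<lambda>x. of_real (lam k) * u x) \<in> diag lam" and "\<not> (AE x in N. u x = 0)"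
proof -
  have uX: "u \<in> X"
    unfolding u_def by (rule comb_in_X)
  show "(u, \<lambda>x. of_real (lam k) * u x) \<in> diag lam"
  proof (rule diagI[OF uX X_scale[OF uX]])
    fix j
    show "coef (\<lambda>x. of_real (lam k) * u x) j = of_real (lam j) * coef u j"
      using assms(2)[of k j] assms(1,3) by (auto simp: ip_scale_left u_def coef_comb)
  qed
  have eq: "(l2norm N u)\<^sup>2 = (\<Sum>j\<in>J. (cmod (c j))\<^sup>2)"
    unfolding u_def using assms(1) by (rule l2norm_comb)
  have "0 < (\<Sum>j\<in>J. (cmod (c j))\<^sup>2)"
    using assms by (intro sum_pos2[of J k]) auto
  then have "0 < (l2norm N u)\<^sup>2"
    unfolding eq .
  then show "\<not> (AE x in N. u x = 0)"
    using l2norm_eq_0_iff[OF X_L2[OF uX]] by auto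
qed

lemma diag_scale: "(u, w) \<in> diag d \<Longrightarrow> (\<lambda>x. a * u x, \<lambda>x. a * w x) \<in> diag d"
  by (auto simp: diag_def ip_scale_left intro: X_scale)

text \<open>An eigenfunction \<open>u\<close> for \<open>\<mu>\<^sup>2\<close> moves as \<open>exp(i \<mu> t) u\<close>. Its velocity and its position each contribute
  \<open>\<mu>\<^sup>2 \<parallel>u\<parallel>\<^sup>2\<close> to the squared norm of the data, and only the velocity is observed.\<close>

lemma wave_constant_diag:
  assumes S: "S \<in> sets N" and lam: "\<And>j. 0 < lam j"
  shows "wave_constant N X (diag (\<lambda>j. (lam j)\<^sup>2)) S = 1 / 2 * Inf (eigen_ratios lam S)"
  unfolding wave_constant_def sqrt_op_diag[of lam, OF lam]
proof (rule Inf_scaled_subset[OF eigen_ratios_nonempty])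
  fix r assume "r \<in> eigen_ratios lam S"
  then obtain J c k where J: "finite J" "\<And>i j. i \<in> J \<Longrightarrow> j \<in> J \<Longrightarrow> lam i = lam j" "k \<in> J" "c k \<noteq> 0"
    and r: "r = (l2norm (restrict_space N S) (\<lambda>x. \<Sum>j\<in>J. c j * e j x))\<^sup>2 / (\<Sum>j\<in>J. (cmod (c j))\<^sup>2)"
    unfolding eigen_ratios_def by blast
  define u where "u = (\<lambda>x. \<Sum>j\<in>J. c j * e j x)"
  have uX: "u \<in> X"
    unfolding u_def by (rule comb_in_X)
  have u_nz: "\<not> (AE x in N. u x = 0)"
    unfolding u_def by (rule eigen_combination(2)[where lam=lam and c=c and k=k, OF J])
  let ?\<mu> = "lam k"
  have Su: "(u, \<lambda>x. of_real ?\<mu> * u x) \<in> diag lam"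
    unfolding u_def by (rule eigen_combination(1)[where lam=lam and c=c and k=k, OF J])
  let ?y = "\<lambda>t x. cis (?\<mu> * t) * u x" and ?v = "\<lambda>t x. (\<i> * of_real ?\<mu>) * cis (?\<mu> * t) * u x"
  let ?r0 = "\<lambda>x. of_real ?\<mu> * u x" and ?y1 = "\<lambda>x. (\<i> * of_real ?\<mu>) * u x"
  have sol: "wave_solution N X (diag (\<lambda>j. (lam j)\<^sup>2)) u ?y1 ?y ?v"
    unfolding wave_solution_def sqrt_op_diag[of lam, OF lam]
  proof (intro conjI exI[of _ "\<lambda>t x. of_real ?\<mu> * cis (?\<mu> * t) * u x"] allI impI ballI harmonic_C1
      harmonic_L2_continuous uX; clarsimp?)
    fix t
    show "(\<lambda>x. cis (?\<mu> * t) * u x, \<lambda>x. of_real ?\<mu> * cis (?\<mu> * t) * u x) \<in> diag lam"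
      using diag_scale[OF Su, of "cis (?\<mu> * t)"] by (simp only: mult.assoc mult.left_commute)
  next
    fix w s t assume ws: "(w, s) \<in> diag lam"
    have "(w, s) \<in> diag lam \<longleftrightarrow> w \<in> X \<and> s \<in> X \<and> (\<forall>(f, h)\<in>diag lam. ip N h w = ip N f s)"
      by (rule selfadjoint_op_iff[OF diag_selfadjoint])
    with ws Su have sym: "ip N ?r0 w = ip N u s"
      by fast
    have "((\<lambda>t. cis (?\<mu> * t)) has_vector_derivative (\<i> * of_real ?\<mu>) * cis (?\<mu> * t)) (at t within {0..})"
      unfolding has_vector_derivative_def
      by (auto intro!: derivative_eq_intros simp: scaleR_conv_of_real algebra_simps)
    then have "((\<lambda>t. cis (?\<mu> * t) * (\<i> * ip N ?r0 w)) has_vector_derivative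
        (\<i> * of_real ?\<mu>) * cis (?\<mu> * t) * (\<i> * ip N ?r0 w)) (at t within {0..})"
      by (rule has_vector_derivative_mult_left)
    also have "(\<i> * of_real ?\<mu>) * cis (?\<mu> * t) * (\<i> * ip N ?r0 w)
        = (\<i> * \<i>) * (of_real ?\<mu> * cis (?\<mu> * t) * ip N u s)"
      unfolding sym by (simp only: mult_ac)
    also have "\<dots> = - ip N (\<lambda>x. of_real ?\<mu> * cis (?\<mu> * t) * u x) s"
      unfolding ip_scale_left by simp
    also have "(\<lambda>t. cis (?\<mu> * t) * (\<i> * ip N ?r0 w)) = (\<lambda>\<tau>. ip N (?v \<tau>) w)"
      unfolding ip_scale_left by (simp add: mult_ac)
    finally show "((\<lambda>\<tau>. ip N (?v \<tau>) w) has_vector_derivative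
        - ip N (\<lambda>x. of_real ?\<mu> * cis (?\<mu> * t) * u x) s) (at t within {0..})" .
  qed
  have "\<forall>\<^sub>F T in at_top. 1 / T * (observed_energy N S ?v T / ((l2norm N ?r0)\<^sup>2 + (l2norm N ?y1)\<^sup>2)) = 1 / 2 * r"
    using eventually_gt_at_top[of 0]
  proof eventually_elim
    case (elim T)
    have h: "1 / T * observed_energy N S ?v T
        = (cmod (\<i> * of_real ?\<mu>))\<^sup>2 * (l2norm (restrict_space N S) u)\<^sup>2"
      by (rule harmonic_observed_energy[OF S X_L2[OF uX] elim])
    have "1 / T * (observed_energy N S ?v T / ((l2norm N ?r0)\<^sup>2 + (l2norm N ?y1)\<^sup>2))
      = (1 / T * observed_energy N S ?v T) / ((l2norm N ?r0)\<^sup>2 + (l2norm N ?y1)\<^sup>2)"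
      by simp
    also have "\<dots> = (?\<mu>\<^sup>2 * (l2norm (restrict_space N S) u)\<^sup>2) / (2 * (?\<mu>\<^sup>2 * (l2norm N u)\<^sup>2))"
      using h by (simp only: l2norm_scale norm_mult power_mult_distrib norm_of_real norm_ii) simp
    also have "\<dots> = 1 / 2 * r"
      using lam[of k] unfolding r u_def l2norm_comb[OF J(1)] by simp
    finally show ?case .
  qed
  then have eq: "Lim at_top (\<lambda>T. 1 / T * (observed_energy N S ?v T / ((l2norm N ?r0)\<^sup>2 + (l2norm N ?y1)\<^sup>2))) = 1 / 2 * r"
    by (intro tendsto_Lim tendsto_eventually) auto
  show "1 / 2 * r \<in> {Lim at_top (\<lambda>T. 1 / T * (observed_energy N S v T / ((l2norm N r0)\<^sup>2 + (l2norm N y1)\<^sup>2)))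
      | y0 r0 y1 y v. (y0, r0) \<in> diag lam \<and> y1 \<in> X \<and>
          \<not> ((AE x in N. y0 x = 0) \<and> (AE x in N. y1 x = 0)) \<and>
          wave_solution N X (diag (\<lambda>j. (lam j)\<^sup>2)) y0 y1 y v}"
    by (rule CollectI, rule exI[of _ u], rule exI[of _ ?r0], rule exI[of _ ?y1], rule exI[of _ ?y],
        rule exI[of _ ?v], intro conjI eq[symmetric] Su X_scale uX sol) (use u_nz in blast)
qed (use wave_ratio_ge[OF S lam] in auto)

lemma schroedinger_constant_diag:
  assumes S: "S \<in> sets N" and lam: "\<And>j. 0 < lam j"
  shows "schroedinger_constant N X (diag (\<lambda>j. (lam j)\<^sup>2)) S = 1 * Inf (eigen_ratios lam S)"
  unfolding schroedinger_constant_def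
proof (rule Inf_scaled_subset[OF eigen_ratios_nonempty])
  fix r assume "r \<in> eigen_ratios lam S"
  then obtain J c k where J: "finite J" "\<And>i j. i \<in> J \<Longrightarrow> j \<in> J \<Longrightarrow> lam i = lam j" "k \<in> J" "c k \<noteq> 0"
    and r: "r = (l2norm (restrict_space N S) (\<lambda>x. \<Sum>j\<in>J. c j * e j x))\<^sup>2 / (\<Sum>j\<in>J. (cmod (c j))\<^sup>2)"
    unfolding eigen_ratios_def by blast
  define u where "u = (\<lambda>x. \<Sum>j\<in>J. c j * e j x)"
  have uX: "u \<in> X"
    unfolding u_def by (rule comb_in_X)
  have u_nz: "\<not> (AE x in N. u x = 0)"
    unfolding u_def by (rule eigen_combination(2)[where lam=lam and c=c and k=k, OF J])
  let ?\<mu> = "(lam k)\<^sup>2"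
  have J2: "(lam i)\<^sup>2 = (lam j)\<^sup>2" if "i \<in> J" "j \<in> J" for i j
    using J(2)[OF that] by simp
  have Au: "(u, \<lambda>x. of_real ?\<mu> * u x) \<in> diag (\<lambda>j. (lam j)\<^sup>2)"
    unfolding u_def
    by (rule eigen_combination(1)[where lam="\<lambda>j. (lam j)\<^sup>2" and c=c and k=k, OF J(1) J2 J(3,4)])
  let ?y = "\<lambda>t x. cis (?\<mu> * t) * u x" and ?v = "\<lambda>t x. (\<i> * of_real ?\<mu>) * cis (?\<mu> * t) * u x"
  let ?f0 = "\<lambda>x. of_real ?\<mu> * u x"
  have sol: "schroedinger_solution N X (diag (\<lambda>j. (lam j)\<^sup>2)) u ?y ?v"
    unfolding schroedinger_solution_def
  proof (intro conjI exI[of _ "\<lambda>t x. of_real ?\<mu> * cis (?\<mu> * t) * u x"] allI impI harmonic_C1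
      harmonic_L2_continuous uX; (intro AE_I2)?)
    fix t
    show "(\<lambda>x. cis (?\<mu> * t) * u x, \<lambda>x. of_real ?\<mu> * cis (?\<mu> * t) * u x) \<in> diag (\<lambda>j. (lam j)\<^sup>2)"
      using diag_scale[OF Au, of "cis (?\<mu> * t)"] by (simp only: mult.assoc mult.left_commute)
  qed (simp_all add: mult.assoc)
  have "\<forall>\<^sub>F T in at_top. 1 / T * (observed_energy N S ?v T / (l2norm N ?f0)\<^sup>2) = 1 * r"
    using eventually_gt_at_top[of 0]
  proof eventually_elim
    case (elim T)
    have h: "1 / T * observed_energy N S ?v T
        = (cmod (\<i> * of_real ?\<mu>))\<^sup>2 * (l2norm (restrict_space N S) u)\<^sup>2"
      by (rule harmonic_observed_energy[OF S X_L2[OF uX] elim])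
    have "1 / T * (observed_energy N S ?v T / (l2norm N ?f0)\<^sup>2)
      = (1 / T * observed_energy N S ?v T) / (l2norm N ?f0)\<^sup>2"
      by simp
    also have "\<dots> = (?\<mu>\<^sup>2 * (l2norm (restrict_space N S) u)\<^sup>2) / (?\<mu>\<^sup>2 * (l2norm N u)\<^sup>2)"
      using h by (simp only: l2norm_scale norm_mult power_mult_distrib norm_of_real norm_ii) simp
    also have "\<dots> = 1 * r"
      using lam[of k] unfolding r u_def l2norm_comb[OF J(1)] by simp
    finally show ?case .
  qed
  then have eq: "Lim at_top (\<lambda>T. 1 / T * (observed_energy N S ?v T / (l2norm N ?f0)\<^sup>2)) = 1 * r"
    by (intro tendsto_Lim tendsto_eventually) auto
  show "1 * r \<in> {Lim at_top (\<lambda>T. 1 / T * (observed_energy N S v T / (l2norm N f0)\<^sup>2))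
      | y0 f0 y v. (y0, f0) \<in> diag (\<lambda>j. (lam j)\<^sup>2) \<and> \<not> (AE x in N. y0 x = 0) \<and>
          schroedinger_solution N X (diag (\<lambda>j. (lam j)\<^sup>2)) y0 y v}"
    by (rule CollectI, rule exI[of _ u], rule exI[of _ ?f0], rule exI[of _ ?y],
        rule exI[of _ ?v], intro conjI eq[symmetric] Au u_nz sol)
qed (use schroedinger_ratio_ge[OF S lam] in auto)

section \<open>The spectral functional\<close>

lemma L2_sum_exists:
  assumes c: "summable (\<lambda>j. (cmod (c j))\<^sup>2)"
  obtains s where "s \<in> L2 N"
    "((\<lambda>J. l2norm N (\<lambda>x. s x - (\<Sum>k\<in>J. c k * e k x))) \<longlongrightarrow> 0) (finite_subsets_at_top I)"
proof -
  define c' where "c' j = (if j \<in> I then c j else 0)" for j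
  have "summable (\<lambda>j. (cmod (c' j))\<^sup>2)"
    by (rule summable_comparison_test'[OF c, of 0]) (simp add: c'_def)
  from Riesz_Fischer[OF this] obtain u where u: "u \<in> X" "\<And>j. coef u j = c' j"
    by blast
  have "((\<lambda>j. (cmod (c' j))\<^sup>2) has_sum (l2norm N u)\<^sup>2) UNIV"
    using Parseval[OF u(1)] by (intro sums_nonneg_imp_has_sum) (auto simp: u(2))
  also have "?this \<longleftrightarrow> ((\<lambda>j. (cmod (c j))\<^sup>2) has_sum (l2norm N u)\<^sup>2) I"
    by (rule has_sum_cong_neutral) (auto simp: c'_def)
  finally have lim: "((\<lambda>J. sqrt ((l2norm N u)\<^sup>2 - (\<Sum>j\<in>J. (cmod (c j))\<^sup>2)))
      \<longlongrightarrow> sqrt ((l2norm N u)\<^sup>2 - (l2norm N u)\<^sup>2)) (finite_subsets_at_top I)"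
    unfolding has_sum_def by (intro tendsto_intros)
  have eq: "sqrt ((l2norm N u)\<^sup>2 - (\<Sum>j\<in>J. (cmod (c j))\<^sup>2)) = l2norm N (\<lambda>x. u x - (\<Sum>k\<in>J. c k * e k x))"
    if J: "finite J" "J \<subseteq> I" for J
  proof -
    have c: "coef u j = c j" if "j \<in> J" for j
      using that J by (auto simp: u(2) c'_def)
    have "(l2norm N (\<lambda>x. u x - (\<Sum>k\<in>J. c k * e k x)))\<^sup>2 = (l2norm N u)\<^sup>2 - (\<Sum>j\<in>J. (cmod (c j))\<^sup>2)"
      using l2norm_diff_comb[OF J(1) X_L2[OF u(1)], of c] by (simp add: c)
    then show ?thesis
      by (simp flip: \<open>_ = (l2norm N u)\<^sup>2 - (\<Sum>j\<in>J. (cmod (c j))\<^sup>2)\<close>)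
  qed
  have "((\<lambda>J. l2norm N (\<lambda>x. u x - (\<Sum>k\<in>J. c k * e k x))) \<longlongrightarrow> 0) (finite_subsets_at_top I)"
    by (rule Lim_transform_eventually[where f="\<lambda>J. sqrt ((l2norm N u)\<^sup>2 - (\<Sum>j\<in>J. (cmod (c j))\<^sup>2))"])
      (use lim in simp, auto intro!: eventually_finite_subsets_at_top_weakI eq)
  then show ?thesis
    using X_L2[OF u(1)] that by blast
qed

text \<open>For infinite \<open>I\<close> the sum is a representative picked by the choice operator; the Riesz-Fischer theorem
  shows that there is one.\<close>

lemma L2_sum_works:
  fixes I :: "nat set"
  assumes "summable (\<lambda>j. (cmod (c j))\<^sup>2)"
  defines "s \<equiv> L2_sum N (\<lambda>k x. c k * e k x) I"
  shows "s \<in> L2 N"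
    and "((\<lambda>J. l2norm N (\<lambda>x. s x - (\<Sum>k\<in>J. c k * e k x))) \<longlongrightarrow> 0) (finite_subsets_at_top I)"
proof -
  have "s \<in> L2 N \<and> ((\<lambda>J. l2norm N (\<lambda>x. s x - (\<Sum>k\<in>J. c k * e k x))) \<longlongrightarrow> 0) (finite_subsets_at_top I)"
  proof (cases "finite I")
    case True
    then have "s = (\<lambda>x. \<Sum>k\<in>I. c k * e k x)"
      by (simp add: s_def L2_sum_def)
    then show ?thesis
      using True X_L2[OF comb_in_X]
      by (auto simp: finite_subsets_at_top_finite eventually_principal intro!: tendsto_eventually)
  next
    case False
    have "\<exists>s. s \<in> L2 N \<and>
        ((\<lambda>J. l2norm N (\<lambda>x. s x - (\<Sum>k\<in>J. c k * e k x))) \<longlongrightarrow> 0) (finite_subsets_at_top I)"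
      by (rule L2_sum_exists[OF assms(1), of I]) (intro exI conjI)
    from someI_ex[OF this] show ?thesis
      using False by (simp add: s_def L2_sum_def)
  qed
  then show "s \<in> L2 N"
    "((\<lambda>J. l2norm N (\<lambda>x. s x - (\<Sum>k\<in>J. c k * e k x))) \<longlongrightarrow> 0) (finite_subsets_at_top I)"
    by blast+
qed

text \<open>With \<open>S = space N\<close> this yields Parseval's identity for \<open>L2_sum\<close>; for general \<open>S\<close> it carries the bound
  by the eigenfunction quotients from finite to infinite sums.\<close>

lemma tendsto_l2norm_L2_sum:
  assumes c: "summable (\<lambda>j. (cmod (c j))\<^sup>2)" and S: "S \<in> sets N"
  shows "((\<lambda>J. l2norm (restrict_space N S) (\<lambda>x. \<Sum>k\<in>J. c k * e k x))
    \<longlongrightarrow> l2norm (restrict_space N S) (L2_sum N (\<lambda>k x. c k * e k x) I)) (finite_subsets_at_top I)"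
proof -
  let ?R = "restrict_space N S"
  define s where "s = L2_sum N (\<lambda>k x. c k * e k x) I"
  define P where "P J = (\<lambda>x. \<Sum>k\<in>J. c k * e k x)" for J
  note s = L2_sum_works[OF c, of I, folded s_def]
  have P: "P J \<in> L2 N" for J
    unfolding P_def by (intro X_L2 comb_in_X)
  have "((\<lambda>J. l2norm ?R (P J) - l2norm ?R s) \<longlongrightarrow> 0) (finite_subsets_at_top I)"
  proof (rule Lim_null_comparison)
    show "((\<lambda>J. l2norm N (\<lambda>x. s x - P J x)) \<longlongrightarrow> 0) (finite_subsets_at_top I)"
      using s(2) unfolding P_def .
    have "norm (l2norm ?R (P J) - l2norm ?R s) \<le> l2norm N (\<lambda>x. s x - P J x)" for J
    proof -
      have "norm (l2norm ?R (P J) - l2norm ?R s) \<le> l2norm ?R (\<lambda>x. P J x - s x)"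
        using l2norm_diff_le[OF L2_restrict_space(1)[OF S P[of J]] L2_restrict_space(1)[OF S s(1)]]
        by simp
      also have "\<dots> \<le> l2norm N (\<lambda>x. P J x - s x)"
        using L2_restrict_space(2)[OF S L2_diff[OF P[of J] s(1)]] .
      finally show ?thesis
        by (simp only: l2norm_minus_commute[of N s])
    qed
    then show "\<forall>\<^sub>F J in finite_subsets_at_top I. norm (l2norm ?R (P J) - l2norm ?R s) \<le> l2norm N (\<lambda>x. s x - P J x)"
      by simp
  qed
  then show ?thesis
    unfolding P_def s_def by (simp add: LIM_zero_iff)
qed

lemma has_sum_l2norm_L2_sum:
  assumes c: "summable (\<lambda>j. (cmod (c j))\<^sup>2)"
  shows "((\<lambda>j. (cmod (c j))\<^sup>2) has_sum (l2norm N (L2_sum N (\<lambda>k x. c k * e k x) I))\<^sup>2) I"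
proof -
  have "((\<lambda>J. (l2norm (restrict_space N (space N)) (\<lambda>x. \<Sum>k\<in>J. c k * e k x))\<^sup>2)
    \<longlongrightarrow> (l2norm (restrict_space N (space N)) (L2_sum N (\<lambda>k x. c k * e k x) I))\<^sup>2) (finite_subsets_at_top I)"
    by (intro tendsto_intros tendsto_l2norm_L2_sum c) simp
  moreover have "l2norm (restrict_space N (space N)) u = l2norm N u" for u
    unfolding l2norm_def by (subst integral_restrict_space)
      (auto intro!: arg_cong[where f=sqrt] Bochner_Integration.integral_cong)
  ultimately have "((\<lambda>J. (l2norm N (\<lambda>x. \<Sum>k\<in>J. c k * e k x))\<^sup>2)
    \<longlongrightarrow> (l2norm N (L2_sum N (\<lambda>k x. c k * e k x) I))\<^sup>2) (finite_subsets_at_top I)"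
    by simp
  then show ?thesis
    unfolding has_sum_def
    by (rule Lim_transform_eventually) (auto intro!: eventually_finite_subsets_at_top_weakI l2norm_comb)
qed

lemma Inf_eigen_ratios_le_L2_sum:
  assumes c: "summable (\<lambda>j. (cmod (c j))\<^sup>2)" and S: "S \<in> sets N"
  shows "Inf (eigen_ratios lam S) * (l2norm N (L2_sum N (\<lambda>k x. c k * e k x) {j. lam j = \<mu>}))\<^sup>2
    \<le> (l2norm (restrict_space N S) (L2_sum N (\<lambda>k x. c k * e k x) {j. lam j = \<mu>}))\<^sup>2"
proof (rule tendsto_le)
  let ?I = "{j. lam j = \<mu>}"
  show "finite_subsets_at_top ?I \<noteq> bot"
    by simp
  show "((\<lambda>J. (l2norm (restrict_space N S) (\<lambda>x. \<Sum>k\<in>J. c k * e k x))\<^sup>2)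
      \<longlongrightarrow> (l2norm (restrict_space N S) (L2_sum N (\<lambda>k x. c k * e k x) ?I))\<^sup>2) (finite_subsets_at_top ?I)"
    by (intro tendsto_intros tendsto_l2norm_L2_sum c S)
  show "((\<lambda>J. Inf (eigen_ratios lam S) * (\<Sum>j\<in>J. (cmod (c j))\<^sup>2))
      \<longlongrightarrow> Inf (eigen_ratios lam S) * (l2norm N (L2_sum N (\<lambda>k x. c k * e k x) ?I))\<^sup>2) (finite_subsets_at_top ?I)"
    using has_sum_l2norm_L2_sum[OF c, of ?I] unfolding has_sum_def by (intro tendsto_intros)
  show "\<forall>\<^sub>F J in finite_subsets_at_top ?I. Inf (eigen_ratios lam S) * (\<Sum>j\<in>J. (cmod (c j))\<^sup>2)
      \<le> (l2norm (restrict_space N S) (\<lambda>x. \<Sum>k\<in>J. c k * e k x))\<^sup>2"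
  proof (rule eventually_finite_subsets_at_top_weakI)
    fix J assume "finite J" "J \<subseteq> ?I"
    then show "Inf (eigen_ratios lam S) * (\<Sum>j\<in>J. (cmod (c j))\<^sup>2)
      \<le> (l2norm (restrict_space N S) (\<lambda>x. \<Sum>k\<in>J. c k * e k x))\<^sup>2"
      by (intro Inf_eigen_ratios_le) auto
  qed
qed

text \<open>The numerator of the spectral functional, for a general orthonormal basis in place of real
  eigenfunctions.\<close>

definition spectral_energy :: "(nat \<Rightarrow> real) \<Rightarrow> 'a set \<Rightarrow> (nat \<Rightarrow> complex) \<Rightarrow> ennreal" where
  "spectral_energy lam S c = (\<integral>\<^sup>+x\<in>S. (\<Sum>\<^sub>\<infinity>\<mu>\<in>range lam.
     ennreal ((cmod (L2_sum N (\<lambda>k x. c k * e k x) {j. lam j = \<mu>} x))\<^sup>2)) \<partial>N)"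

lemma infsum_ennreal_eq_nn_integral:
  fixes f :: "'b \<Rightarrow> ennreal"
  assumes "countable A"
  shows "infsum f A = (\<integral>\<^sup>+x. f x \<partial>count_space A)"
proof (cases "finite A")
  case True
  then show ?thesis
    by (simp add: nn_integral_count_space_finite)
next
  case False
  with assms have bij: "bij_betw (from_nat_into A) UNIV A"
    by (rule bij_betw_from_nat_into)
  have SUP: "infsum f A = (SUP F\<in>{F. finite F \<and> F \<subseteq> A}. sum f F)"
    by (rule nonneg_infsum_complete) simp
  have nn: "(\<integral>\<^sup>+x. f x \<partial>count_space A) = (SUP n. \<Sum>i<n. f (from_nat_into A i))"
    using nn_integral_bij_count_space[OF bij, of f]
    by (simp add: nn_integral_count_space_nat suminf_eq_SUP)
  show ?thesis
    unfolding SUP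
  proof (rule antisym)
    show "(SUP F\<in>{F. finite F \<and> F \<subseteq> A}. sum f F) \<le> (\<integral>\<^sup>+x. f x \<partial>count_space A)"
    proof (rule SUP_least)
      fix F assume F: "F \<in> {F. finite F \<and> F \<subseteq> A}"
      have "sum f F = (\<integral>\<^sup>+x. f x \<partial>count_space F)"
        using F by (simp add: nn_integral_count_space_finite)
      also have "\<dots> \<le> (\<integral>\<^sup>+x. f x \<partial>count_space A)"
        using F by (simp add: nn_integral_count_space_indicator[of F] nn_integral_count_space_indicator[of A])
          (auto intro!: nn_integral_mono simp: indicator_def)
      finally show "sum f F \<le> (\<integral>\<^sup>+x. f x \<partial>count_space A)" .
    qed
    show "(\<integral>\<^sup>+x. f x \<partial>count_space A) \<le> (SUP F\<in>{F. finite F \<and> F \<subseteq> A}. sum f F)"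
      unfolding nn
    proof (rule SUP_least)
      fix n
      have "inj_on (from_nat_into A) {..<n}"
        using bij by (auto simp: bij_betw_def intro: inj_on_subset)
      then have "(\<Sum>i<n. f (from_nat_into A i)) = sum f (from_nat_into A ` {..<n})"
        by (simp add: sum.reindex)
      also have "\<dots> \<le> (SUP F\<in>{F. finite F \<and> F \<subseteq> A}. sum f F)"
        using bij by (intro SUP_upper) (auto simp: bij_betw_def)
      finally show "(\<Sum>i<n. f (from_nat_into A i)) \<le> (SUP F\<in>{F. finite F \<and> F \<subseteq> A}. sum f F)" .
    qed
  qed
qed

text \<open>Integral and sum are exchanged by regarding the sum over the countable set of eigenvalues as an
  integral with respect to the counting measure.\<close>

lemma spectral_energy_eq:
  assumes c: "summable (\<lambda>j. (cmod (c j))\<^sup>2)" and S: "S \<in> sets N"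
  shows "spectral_energy lam S c = (\<integral>\<^sup>+\<mu>. ennreal ((l2norm (restrict_space N S)
    (L2_sum N (\<lambda>k x. c k * e k x) {j. lam j = \<mu>}))\<^sup>2) \<partial>count_space (range lam))"
proof -
  define s where "s \<mu> = L2_sum N (\<lambda>k x. c k * e k x) {j. lam j = \<mu>}" for \<mu>
  have s: "s \<mu> \<in> L2 (restrict_space N S)" for \<mu>
    unfolding s_def by (intro L2_restrict_space(1)[OF S] L2_sum_works(1) c)
  note [measurable] = s[THEN L2_measurable]
  have "spectral_energy lam S c
      = (\<integral>\<^sup>+x. (\<integral>\<^sup>+\<mu>. ennreal ((cmod (s \<mu> x))\<^sup>2) \<partial>count_space (range lam)) \<partial>restrict_space N S)"
    using S unfolding spectral_energy_def s_def
    by (simp add: nn_integral_restrict_space infsum_ennreal_eq_nn_integral)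
  also have "\<dots> = (\<integral>\<^sup>+\<mu>. (\<integral>\<^sup>+x. ennreal ((cmod (s \<mu> x))\<^sup>2) \<partial>restrict_space N S) \<partial>count_space (range lam))"
    by (intro nn_integral_count_space_nn_integral) auto
  also have "\<dots> = (\<integral>\<^sup>+\<mu>. ennreal ((l2norm (restrict_space N S) (s \<mu>))\<^sup>2) \<partial>count_space (range lam))"
    by (simp add: nn_integral_L2 s)
  finally show ?thesis
    unfolding s_def .
qed

text \<open>Parseval's identity in each eigenspace, followed by regrouping the double sum by the basis index.\<close>

lemma spectral_norm_eq:
  assumes c: "summable (\<lambda>j. (cmod (c j))\<^sup>2)"
  shows "(\<integral>\<^sup>+\<mu>. ennreal ((l2norm N (L2_sum N (\<lambda>k x. c k * e k x) {j. lam j = \<mu>}))\<^sup>2) \<partial>count_space (range lam))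
    = ennreal (\<Sum>j. (cmod (c j))\<^sup>2)"
proof -
  have "ennreal ((l2norm N (L2_sum N (\<lambda>k x. c k * e k x) {j. lam j = \<mu>}))\<^sup>2)
      = (\<integral>\<^sup>+j. (if lam j = \<mu> then ennreal ((cmod (c j))\<^sup>2) else 0) \<partial>count_space UNIV)" for \<mu>
  proof -
    let ?g = "\<lambda>j. if lam j = \<mu> then (cmod (c j))\<^sup>2 else 0"
    have "((\<lambda>j. (cmod (c j))\<^sup>2) has_sum (l2norm N (L2_sum N (\<lambda>k x. c k * e k x) {j. lam j = \<mu>}))\<^sup>2)
        {j. lam j = \<mu>}"
      by (rule has_sum_l2norm_L2_sum[OF c])
    also have "?this \<longleftrightarrow> (?g has_sum (l2norm N (L2_sum N (\<lambda>k x. c k * e k x) {j. lam j = \<mu>}))\<^sup>2) UNIV"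
      by (rule has_sum_cong_neutral) auto
    finally have g: "?g sums (l2norm N (L2_sum N (\<lambda>k x. c k * e k x) {j. lam j = \<mu>}))\<^sup>2"
      by (rule has_sum_imp_sums)
    have "(\<Sum>j. ennreal (?g j)) = ennreal (\<Sum>j. ?g j)"
      by (rule suminf_ennreal2) (use sums_summable[OF g] in auto)
    then have "ennreal ((l2norm N (L2_sum N (\<lambda>k x. c k * e k x) {j. lam j = \<mu>}))\<^sup>2) = (\<Sum>j. ennreal (?g j))"
      by (simp only: sums_unique[OF g])
    then show ?thesis
      by (simp add: nn_integral_count_space_nat if_distrib cong: if_cong)
  qed
  then have "(\<integral>\<^sup>+\<mu>. ennreal ((l2norm N (L2_sum N (\<lambda>k x. c k * e k x) {j. lam j = \<mu>}))\<^sup>2) \<partial>count_space (range lam))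
      = (\<integral>\<^sup>+\<mu>. (\<integral>\<^sup>+j. (if lam j = \<mu> then ennreal ((cmod (c j))\<^sup>2) else 0) \<partial>count_space UNIV) \<partial>count_space (range lam))"
    by simp
  also have "\<dots> = (\<integral>\<^sup>+j. (\<integral>\<^sup>+\<mu>. (if lam j = \<mu> then ennreal ((cmod (c j))\<^sup>2) else 0) \<partial>count_space (range lam)) \<partial>count_space UNIV)"
    by (intro nn_integral_count_space_nn_integral[symmetric]) auto
  also have "\<dots> = (\<integral>\<^sup>+j. ennreal ((cmod (c j))\<^sup>2) \<partial>count_space UNIV)"
    by (intro nn_integral_cong, subst nn_integral_count_space'[of "{lam j}" for j]) auto
  also have "\<dots> = ennreal (\<Sum>j. (cmod (c j))\<^sup>2)"
    using c by (simp add: nn_integral_count_space_nat suminf_ennreal2)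
  finally show ?thesis .
qed

lemma spectral_energy_ge:
  assumes c: "summable (\<lambda>j. (cmod (c j))\<^sup>2)" and S: "S \<in> sets N"
  shows "Inf (eigen_ratios lam S) * (\<Sum>j. (cmod (c j))\<^sup>2) \<le> enn2real (spectral_energy lam S c)"
proof -
  let ?m = "Inf (eigen_ratios lam S)"
  define s where "s \<mu> = L2_sum N (\<lambda>k x. c k * e k x) {j. lam j = \<mu>}" for \<mu>
  have "spectral_energy lam S c \<le> (\<integral>\<^sup>+\<mu>. ennreal ((l2norm N (s \<mu>))\<^sup>2) \<partial>count_space (range lam))"
    unfolding spectral_energy_eq[OF assms] s_def
    by (intro nn_integral_mono ennreal_leI power_mono L2_restrict_space(2)[OF S] L2_sum_works(1) c) simp
  also have "\<dots> < \<infinity>"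
    unfolding s_def spectral_norm_eq[OF c] by simp
  finally have fin: "spectral_energy lam S c < \<infinity>" .
  have "ennreal (?m * (\<Sum>j. (cmod (c j))\<^sup>2)) = ennreal ?m * ennreal (\<Sum>j. (cmod (c j))\<^sup>2)"
    by (intro ennreal_mult Inf_eigen_ratios_nonneg suminf_nonneg c) simp
  also have "\<dots> = (\<integral>\<^sup>+\<mu>. ennreal ?m * ennreal ((l2norm N (s \<mu>))\<^sup>2) \<partial>count_space (range lam))"
    by (subst nn_integral_cmult) (simp_all add: s_def spectral_norm_eq[OF c])
  also have "\<dots> \<le> spectral_energy lam S c"
    unfolding spectral_energy_eq[OF assms] s_def
  proof (intro nn_integral_mono)
    fix \<mu>
    show "ennreal ?m * ennreal ((l2norm N (L2_sum N (\<lambda>k x. c k * e k x) {j. lam j = \<mu>}))\<^sup>2)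
      \<le> ennreal ((l2norm (restrict_space N S) (L2_sum N (\<lambda>k x. c k * e k x) {j. lam j = \<mu>}))\<^sup>2)"
      using Inf_eigen_ratios_le_L2_sum[OF assms, of lam \<mu>] Inf_eigen_ratios_nonneg[of lam S]
      by (subst ennreal_mult[symmetric]) (auto intro: ennreal_leI)
  qed
  finally have "enn2real (ennreal (?m * (\<Sum>j. (cmod (c j))\<^sup>2))) \<le> enn2real (spectral_energy lam S c)"
    using fin by (intro enn2real_mono) auto
  moreover have "0 \<le> ?m * (\<Sum>j. (cmod (c j))\<^sup>2)"
    by (intro mult_nonneg_nonneg Inf_eigen_ratios_nonneg suminf_nonneg c) simp
  ultimately show "?m * (\<Sum>j. (cmod (c j))\<^sup>2) \<le> enn2real (spectral_energy lam S c)"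
    by simp
qed

text \<open>The components for the eigenvalues other than \<open>\<mu>\<close> are zero only up to null sets, so all components are
  identified by their norms.\<close>

lemma spectral_energy_single:
  assumes S: "S \<in> sets N" and J: "finite J" "\<And>j. j \<in> J \<Longrightarrow> lam j = \<mu>" "k \<in> J"
    and supp: "\<And>j. j \<notin> J \<Longrightarrow> c j = 0"
  shows "spectral_energy lam S c = ennreal ((l2norm (restrict_space N S) (\<lambda>x. \<Sum>j\<in>J. c j * e j x))\<^sup>2)"
proof -
  let ?R = "restrict_space N S"
  define s where "s \<mu> = L2_sum N (\<lambda>k x. c k * e k x) {j. lam j = \<mu>}" for \<mu>
  have c: "summable (\<lambda>j. (cmod (c j))\<^sup>2)"
    using J(1) supp by (intro summable_finite[of J]) auto
  have s_L2: "s \<nu> \<in> L2 N" for \<nu>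
    unfolding s_def using c by (rule L2_sum_works(1))
  have other: "l2norm ?R (s \<nu>) = 0" if "\<nu> \<noteq> \<mu>" for \<nu>
  proof -
    have "((\<lambda>j. (cmod (c j))\<^sup>2) has_sum (l2norm N (s \<nu>))\<^sup>2) {j. lam j = \<nu>}"
      unfolding s_def using c by (rule has_sum_l2norm_L2_sum)
    moreover have "((\<lambda>j. (cmod (c j))\<^sup>2) has_sum 0) {j. lam j = \<nu>}"
      using that J(2) supp by (intro has_sum_0) force
    ultimately have "(l2norm N (s \<nu>))\<^sup>2 = 0"
      by (rule has_sum_unique)
    then show ?thesis
      using L2_restrict_space(2)[OF S s_L2[of \<nu>]] l2norm_nonneg[of ?R "s \<nu>"] by simp
  qed
  have "((\<lambda>F. l2norm ?R (\<lambda>x. \<Sum>k\<in>F. c k * e k x)) \<longlongrightarrow> l2norm ?R (s \<mu>)) (finite_subsets_at_top {j. lam j = \<mu>})"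
    unfolding s_def using c S by (rule tendsto_l2norm_L2_sum)
  moreover have "((\<lambda>F. l2norm ?R (\<lambda>x. \<Sum>k\<in>F. c k * e k x)) \<longlongrightarrow> l2norm ?R (\<lambda>x. \<Sum>k\<in>J. c k * e k x))
      (finite_subsets_at_top {j. lam j = \<mu>})"
  proof (rule tendsto_eventually, unfold eventually_finite_subsets_at_top, intro exI[of _ J] conjI allI impI)
    fix F assume F: "finite F \<and> J \<subseteq> F \<and> F \<subseteq> {j. lam j = \<mu>}"
    have "(\<Sum>k\<in>F. c k * e k x) = (\<Sum>k\<in>J. c k * e k x)" for x
      using F supp by (intro sum.mono_neutral_right) auto
    then show "l2norm ?R (\<lambda>x. \<Sum>k\<in>F. c k * e k x) = l2norm ?R (\<lambda>x. \<Sum>k\<in>J. c k * e k x)"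
      by simp
  qed (use J in auto)
  ultimately have same: "l2norm ?R (s \<mu>) = l2norm ?R (\<lambda>x. \<Sum>k\<in>J. c k * e k x)"
    by (rule tendsto_unique[rotated]) simp
  have "\<mu> \<in> range lam"
    using J(2)[OF J(3)] by auto
  then have "(\<integral>\<^sup>+\<nu>. ennreal ((l2norm ?R (s \<nu>))\<^sup>2) \<partial>count_space (range lam)) = ennreal ((l2norm ?R (s \<mu>))\<^sup>2)"
    by (subst nn_integral_count_space'[of "{\<mu>}"]) (auto simp: other)
  then show ?thesis
    unfolding spectral_energy_eq[OF c S] same[symmetric] s_def .
qed

lemma spectral_constant_eq:
  assumes S: "S \<in> sets N"
  shows "Inf {enn2real (spectral_energy lam S c) / (\<Sum>k. (cmod (c k))\<^sup>2)
      | c. summable (\<lambda>k. (cmod (c k))\<^sup>2) \<and> c \<noteq> (\<lambda>k. 0)} = 1 * Inf (eigen_ratios lam S)"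
proof (rule Inf_scaled_subset[OF eigen_ratios_nonempty])
  fix r assume "r \<in> eigen_ratios lam S"
  then obtain J c k where J: "finite J" "\<And>i j. i \<in> J \<Longrightarrow> j \<in> J \<Longrightarrow> lam i = lam j" "k \<in> J" "c k \<noteq> 0"
    and r: "r = (l2norm (restrict_space N S) (\<lambda>x. \<Sum>j\<in>J. c j * e j x))\<^sup>2 / (\<Sum>j\<in>J. (cmod (c j))\<^sup>2)"
    unfolding eigen_ratios_def by blast
  define c' where "c' j = (if j \<in> J then c j else 0)" for j
  have lamJ: "lam j = lam k" if "j \<in> J" for j
    using J(2)[OF that J(3)] .
  have "summable (\<lambda>j. (cmod (c' j))\<^sup>2)"
    using J(1) by (intro summable_finite[of J]) (auto simp: c'_def)
  moreover have "c' \<noteq> (\<lambda>j. 0)"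
    using J(3,4) by (auto simp: c'_def fun_eq_iff)
  moreover have "1 * r = enn2real (spectral_energy lam S c') / (\<Sum>k. (cmod (c' k))\<^sup>2)"
  proof -
    have "spectral_energy lam S c' = ennreal ((l2norm (restrict_space N S) (\<lambda>x. \<Sum>j\<in>J. c' j * e j x))\<^sup>2)"
      by (rule spectral_energy_single[where k=k, OF S J(1) lamJ J(3)]) (auto simp: c'_def)
    also have "(\<lambda>x. \<Sum>j\<in>J. c' j * e j x) = (\<lambda>x. \<Sum>j\<in>J. c j * e j x)"
      by (intro ext sum.cong) (auto simp: c'_def)
    finally have "enn2real (spectral_energy lam S c')
        = (l2norm (restrict_space N S) (\<lambda>x. \<Sum>j\<in>J. c j * e j x))\<^sup>2"
      by simp
    moreover have "(\<Sum>k. (cmod (c' k))\<^sup>2) = (\<Sum>j\<in>J. (cmod (c' j))\<^sup>2)"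
      using J(1) by (intro suminf_finite) (auto simp: c'_def)
    moreover have "\<dots> = (\<Sum>j\<in>J. (cmod (c j))\<^sup>2)"
      by (intro sum.cong) (auto simp: c'_def)
    ultimately show ?thesis
      by (simp add: r)
  qed
  ultimately show "1 * r \<in> {enn2real (spectral_energy lam S c) / (\<Sum>k. (cmod (c k))\<^sup>2)
      | c. summable (\<lambda>k. (cmod (c k))\<^sup>2) \<and> c \<noteq> (\<lambda>k. 0)}"
    by (intro CollectI exI[of _ c'] conjI)
next
  fix q assume "q \<in> {enn2real (spectral_energy lam S c) / (\<Sum>k. (cmod (c k))\<^sup>2)
      | c. summable (\<lambda>k. (cmod (c k))\<^sup>2) \<and> c \<noteq> (\<lambda>k. 0)}"
  then obtain c where q: "q = enn2real (spectral_energy lam S c) / (\<Sum>k. (cmod (c k))\<^sup>2)"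
    and c: "summable (\<lambda>k. (cmod (c k))\<^sup>2)" "c \<noteq> (\<lambda>k. 0)"
    by blast
  obtain k where "c k \<noteq> 0"
    using c(2) by (auto simp: fun_eq_iff)
  then have "0 < (\<Sum>k. (cmod (c k))\<^sup>2)"
    by (intro suminf_pos2[OF c(1), of k]) auto
  then show "1 * Inf (eigen_ratios lam S) \<le> q"
    unfolding q using spectral_energy_ge[OF c(1) S, of lam] by (simp add: field_simps)
qed simp

end

section \<open>The observability constants of the wave and Schroedinger equations\<close>

theorem theorem1:
  fixes M :: "('m::{t2_space,second_countable_topology}, 'n::finite) riem"
    and \<Omega> \<omega> :: "'m set" and bc :: "'m bc"
    and \<phi> :: "nat \<Rightarrow> 'm \<Rightarrow> real" and lam :: "nat \<Rightarrow> real"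
  defines "N \<equiv> domain_measure M \<Omega>"
    and "X \<equiv> state_space M \<Omega> bc"
    and "A \<equiv> neg_laplacian M \<Omega> bc"
  assumes "riemannian_manifold M"
    and "open \<Omega>" "connected \<Omega>" "\<Omega> \<noteq> {}" "riem_bounded M \<Omega>"
    and "frontier \<Omega> = {} \<longrightarrow> compact \<Omega>"
    and "admissible_bc M \<Omega> bc"
    and "positive_selfadjoint_op N X A"
    and "real_eigenbasis N X A \<phi> lam"
    and "\<omega> \<subseteq> \<Omega>" "\<omega> \<in> sets (riem_volume M)"
  shows "2 * wave_constant N X A \<omega> = schroedinger_constant N X A \<omega> \<and>
    schroedinger_constant N X A \<omega> = Inf
      {enn2real (\<integral>\<^sup>+x\<in>\<omega>. (\<Sum>\<^sub>\<infinity>\<mu>\<in>range lam.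
           ennreal ((cmod (L2_sum N (\<lambda>k x. c k * of_real (\<phi> k x)) {j. lam j = \<mu>} x))\<^sup>2)) \<partial>N)
         / (\<Sum>k. (cmod (c k))\<^sup>2)
       | c :: nat \<Rightarrow> complex. summable (\<lambda>k. (cmod (c k))\<^sup>2) \<and> c \<noteq> (\<lambda>k. 0)}"
proof -
  define e where "e k x = complex_of_real (\<phi> k x)" for k x
  have sa: "selfadjoint_op N X A"
    using \<open>positive_selfadjoint_op N X A\<close> by (simp add: positive_selfadjoint_op_def)
  have H: "hilbert_subspace N X"
    using sa by (simp add: selfadjoint_op_def)
  have basis: "\<And>j. 0 < lam j" "\<And>j. (e j, \<lambda>x. of_real ((lam j)\<^sup>2 * \<phi> j x)) \<in> A"
    "\<And>i j. ip N (e i) (e j) = (if i = j then 1 else 0)"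
    "\<And>u \<epsilon>. u \<in> X \<Longrightarrow> 0 < \<epsilon> \<Longrightarrow> \<exists>m a. l2norm N (\<lambda>x. u x - (\<Sum>j<m. a j * e j x)) < \<epsilon>"
    using \<open>real_eigenbasis N X A \<phi> lam\<close> unfolding real_eigenbasis_def e_def by auto
  have eX: "e j \<in> X" for j
    using basis(2)[of j] by (simp add: A_def X_def neg_laplacian_def)
  interpret orthonormal_basis N X e
    by unfold_locales (fact H eX basis)+
  have "A = diag (\<lambda>j. (lam j)\<^sup>2)"
    using basis(2) by (intro selfadjoint_op_eq_diag[OF sa]) (simp add: e_def)
  have S: "\<omega> \<in> sets N"
    using \<open>\<omega> \<subseteq> \<Omega>\<close> \<open>\<omega> \<in> sets (riem_volume M)\<close>
    unfolding N_def domain_measure_def sets_restrict_space by blast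
  have "2 * wave_constant N X A \<omega> = schroedinger_constant N X A \<omega>"
    unfolding \<open>A = _\<close> wave_constant_diag[OF S basis(1)] schroedinger_constant_diag[OF S basis(1)]
    by simp
  moreover have "schroedinger_constant N X A \<omega>
      = Inf {enn2real (spectral_energy lam \<omega> c) / (\<Sum>k. (cmod (c k))\<^sup>2)
      | c. summable (\<lambda>k. (cmod (c k))\<^sup>2) \<and> c \<noteq> (\<lambda>k. 0)}"
    unfolding \<open>A = _\<close> spectral_constant_eq[OF S] by (rule schroedinger_constant_diag[OF S basis(1)])
  ultimately show ?thesis
    unfolding spectral_energy_def e_def by (intro conjI)
qed

end
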